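(* Let $q$ be a power of an odd prime $p$ and let $\mathbf{A} = \mathbb{F}_q[T]$. Then $\mathrm{SL}_2(\mathbf{A})$ is a polynomial family over $\mathbf{A}$ with $52$ parameters.
   Context: $\mathbb{F}_q$ is the finite field with $q$ elements and $T$ is an indeterminate. For a commutative ring $R$ with identity, a subset $X \subseteq R^h$ is called a polynomial family over $R$ with $d$ parameters ($d$ a positive integer) if there exist polynomials $P_1, \ldots, P_h \in R[x_1, \ldots, x_d]$ such that $X = \{(P_1(t), \ldots, P_h(t)) : t \in R^d\}$. The set $\mathrm{SL}_2(\mathbf{A})$ is viewed as a subset of $\mathbf{A}^4$ via the matrix entries. *)

theory Defs
  imports "HOL-Analysis.Determinants" "HOL-Library.Poly_Mapping"
    "HOL-Computational_Algebra.Polynomial" "HOL-Computational_Algebra.Primes"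
begin

(* A polynomial in x_0, x_1, ... is a finitely supported map sending each monomial
   (a finitely supported exponent function) to its coefficient; the ring structure
   is the convolution product of Poly_Mapping. *)
type_synonym 'r mpoly = "(nat \<Rightarrow>\<^sub>0 nat) \<Rightarrow>\<^sub>0 'r"

definition mpoly_vars :: "'r::zero mpoly \<Rightarrow> nat set" where
  "mpoly_vars P = (\<Union>m\<in>Poly_Mapping.keys P. Poly_Mapping.keys m)"

definition mpoly_eval :: "(nat \<Rightarrow> 'r) \<Rightarrow> 'r::comm_ring_1 mpoly \<Rightarrow> 'r" where
  "mpoly_eval t P = (\<Sum>m\<in>Poly_Mapping.keys P.
     Poly_Mapping.lookup P m * (\<Prod>i\<in>Poly_Mapping.keys m. t i ^ Poly_Mapping.lookup m i))"

(* Elements of R^n are lists of length n. The polynomials are indexed from 0, so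
   R[x_1, ..., x_d] consists of the P with mpoly_vars P contained in {..<d}. *)
definition polynomial_family :: "nat \<Rightarrow> nat \<Rightarrow> 'r::comm_ring_1 list set \<Rightarrow> bool" where
  "polynomial_family h d X \<longleftrightarrow> 0 < d \<and>
     (\<exists>Ps :: 'r mpoly list. length Ps = h \<and> (\<forall>P\<in>set Ps. mpoly_vars P \<subseteq> {..<d}) \<and>
        X = {map (mpoly_eval (\<lambda>i. t ! i)) Ps | t. length t = d})"

definition SL2 :: "('r::comm_ring_1 ^ 2 ^ 2) set" where
  "SL2 = {M. det M = 1}"

definition matrix_entries :: "'r ^ 2 ^ 2 \<Rightarrow> 'r list" where
  "matrix_entries M = [M $ 1 $ 1, M $ 1 $ 2, M $ 2 $ 1, M $ 2 $ 2]"

end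

theory Submission
  imports Defs "HOL-Number_Theory.Cong" "HOL-Analysis.FPS_Convergence"
    "HOL-Analysis.Complex_Transcendental" "HOL-Computational_Algebra.Polynomial_FPS"
    "HOL-Library.Cardinality"
begin

text \<open>
  The idea is to write every matrix of \<open>SL\<^sub>2(A)\<close>, for \<open>A = F\<^sub>q[T]\<close> with \<open>q\<close> odd, as a product of a bounded
  number of factors, each of which runs through a family that is parametrised by polynomials.
  Elementary matrices cost one parameter each, but no bounded number of them suffices, because continued
  fractions over \<open>A\<close> can be arbitrarily long. So larger families with few parameters are needed.

  The first such family comes from conjugation. Let \<open>\<alpha>\<close> have rows \<open>(a, b)\<close> and \<open>(c s\<^sup>2, d)\<close> with
  \<open>a\<close> and \<open>d\<close> congruent to 1 modulo \<open>s\<close>, and let \<open>\<delta> = diag(s, 1/s)\<close>. Then \<open>\<delta> \<alpha> \<delta>\<^sup>-\<^sup>1\<close> has rows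
  \<open>(a, b s\<^sup>2)\<close> and \<open>(c, d)\<close>. The quotient \<open>\<alpha>\<^sup>-\<^sup>1 \<delta> \<alpha> \<delta>\<^sup>-\<^sup>1\<close> is a polynomial function of five
  free parameters (\<open>swindle\<close>): \<open>\<delta>\<close> is a product of four elementary matrices, and conjugates of
  elementary matrices are transvections, whose vectors may be left free. So five parameters pay for
  moving a square \<open>s\<^sup>2\<close> from one off-diagonal entry to the other (\<open>mat2_times_swindle\<close>).

  The second family consists of the commutators of \<open>diag(1, -1)\<close> with matrices of determinant 2
  (\<open>reflection_commutator\<close>). Its first rows are the \<open>(x, e)\<close> for which \<open>e = b p\<close> with
  \<open>x = 1\<close> modulo \<open>b\<close> and \<open>x = -1\<close> modulo \<open>p\<close>. Two transvections replace \<open>b\<close> by an irreducible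
  polynomial and then \<open>p\<close> by a constant times a square, after which the first family applies;
  this gives 14 parameters (\<open>polycover_reflection_commutator\<close>). The two families together cover, with 20
  parameters, all matrices with first row \<open>(x, s\<^sup>2 e)\<close> such that \<open>s\<close> divides \<open>x - 1\<close> and \<open>e\<close> divides
  \<open>x\<^sup>2 - 1\<close> (\<open>polycover_reducible_rows\<close>).

  Powers lie in this class. If \<open>\<beta>\<close> has off-diagonal entries \<open>b\<close> and \<open>c\<close>, then \<open>\<beta>\<^sup>n = f + g \<beta>\<close> has
  off-diagonal entries \<open>g b\<close> and \<open>g c\<close>, and \<open>g\<close> divides \<open>x\<^sup>2 - 1\<close> for the corner entry \<open>x\<close>
  because the determinant is 1. If \<open>c\<close> is irreducible and
  \<open>x = 1\<close> modulo \<open>c\<close>, then also \<open>c\<close> divides \<open>g\<close>, so the entry \<open>g c\<close> contains the square \<open>c\<^sup>2\<close>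
  (\<open>mat2_power_offdiagonal\<close>). To exploit this, a general matrix is first changed by elementary
  matrices and a constant diagonal matrix so that \<open>b\<close> and \<open>c\<close> are, up to constants, irreducible
  of degrees \<open>m = 1\<close> modulo \<open>q - 1\<close> and \<open>n = 1\<close> modulo \<open>m\<close>, and the corner entry is \<open>z = y\<^sup>q\<^sup>-\<^sup>1\<close>. With
  \<open>N = (q\<^sup>n - 1)/(q - 1)\<close>, Fermat's little theorem gives \<open>z\<^sup>N = 1\<close> modulo \<open>c\<close>, and since \<open>q\<^sup>m - 1\<close>
  divides \<open>(q - 1)(N - 1)\<close>, also \<open>z\<^sup>N\<^sup>-\<^sup>1 = 1\<close> modulo \<open>b\<close>. So the transpose of \<open>\<beta>\<^sup>N\<close> and the
  inverse of \<open>\<beta>\<^sup>N\<^sup>-\<^sup>1\<close> lie in the class, and \<open>\<beta>\<close> is their product. The count is \<open>20 + 20\<close> for the two powers,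
  4 for the diagonal matrix and 3 for elementary matrices, in total 47; five further parameters
  may be ignored (\<open>polycover_SL2_poly\<close>).

  The arithmetic input is Dirichlet's theorem for \<open>F\<^sub>q[T]\<close> with the degree prescribed modulo a given
  number (\<open>ex_irreducible_in_progression\<close>). It is proved with characters of the ray class group that
  records the residue and the degree of a monic polynomial. The L-series of each character is
  rational with at most one pole, which lies on the circle of radius \<open>1/q\<close>. The numerators do
  not vanish at \<open>1/q\<close>, because the logarithmic derivative of the product of all L-series has
  nonnegative coefficients. Comparing the growth of logarithmic derivatives at \<open>1/q\<close> then shows
  that every class contains an irreducible polynomial.
\<close>

section \<open>Polynomial functions and polynomial families of matrices\<close>

text \<open>Polynomial maps as a closure of functions: compositions of such maps are again of this form by
  construction, and formal polynomials are only extracted at the end, in \<open>polyfun_imp_mpoly\<close>. The set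
  \<open>V\<close> holds the indices of the variables that may occur.\<close>

inductive polyfun :: "nat set \<Rightarrow> ((nat \<Rightarrow> 'r::comm_ring_1) \<Rightarrow> 'r) \<Rightarrow> bool" for V where
  polyfun_const: "polyfun V (\<lambda>t. c)"
| polyfun_var: "i \<in> V \<Longrightarrow> polyfun V (\<lambda>t. t i)"
| polyfun_add: "polyfun V f \<Longrightarrow> polyfun V g \<Longrightarrow> polyfun V (\<lambda>t. f t + g t)"
| polyfun_mult: "polyfun V f \<Longrightarrow> polyfun V g \<Longrightarrow> polyfun V (\<lambda>t. f t * g t)"

lemma polyfun_uminus: "polyfun V f \<Longrightarrow> polyfun V (\<lambda>t. - f t)"
  using polyfun_mult[OF polyfun_const[of V "-1"]] by fastforce

lemma polyfun_diff: "polyfun V f \<Longrightarrow> polyfun V g \<Longrightarrow> polyfun V (\<lambda>t. f t - g t)"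
  using polyfun_add[OF _ polyfun_uminus, of V f g] by simp

lemma polyfun_power: "polyfun V f \<Longrightarrow> polyfun V (\<lambda>t. f t ^ k)"
  by (induction k) (auto intro: polyfun_const polyfun_mult)

lemmas polyfun_intros = polyfun_const polyfun_add polyfun_mult polyfun_uminus polyfun_diff polyfun_power

lemma polyfun_rename:
  assumes "polyfun V f" and "s ` V \<subseteq> W"
  shows "polyfun W (\<lambda>t. f (\<lambda>i. t (s i)))"
  using assms(1)
proof induction
  case (polyfun_var i)
  then show ?case using assms(2) by (intro polyfun.polyfun_var) auto
qed (auto intro: polyfun.intros)

lemma polyfun_mono: "polyfun V f \<Longrightarrow> V \<subseteq> W \<Longrightarrow> polyfun W f"
  using polyfun_rename[of V f id W] by simp

lemma polyfun_cong:
  assumes "polyfun V f" and "\<And>i. i \<in> V \<Longrightarrow> t i = t' i"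
  shows "f t = f t'"
  using assms by induction auto

definition mon_eval :: "(nat \<Rightarrow> 'r::comm_ring_1) \<Rightarrow> (nat \<Rightarrow>\<^sub>0 nat) \<Rightarrow> 'r" where
  "mon_eval t m = (\<Prod>i\<in>Poly_Mapping.keys m. t i ^ Poly_Mapping.lookup m i)"

lemma mon_eval_superset:
  "finite S \<Longrightarrow> Poly_Mapping.keys m \<subseteq> S \<Longrightarrow>
    mon_eval t m = (\<Prod>i\<in>S. t i ^ Poly_Mapping.lookup m i)"
  unfolding mon_eval_def
  by (rule prod.mono_neutral_left) (auto simp: Poly_Mapping.in_keys_iff)

lemma mon_eval_add: "mon_eval t (m + n) = mon_eval t m * mon_eval t n"
proof -
  let ?S = "Poly_Mapping.keys m \<union> Poly_Mapping.keys n"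
  have "Poly_Mapping.keys (m + n) \<subseteq> ?S" by (rule Poly_Mapping.keys_add)
  then show ?thesis
    by (simp add: mon_eval_superset[of ?S] lookup_add power_add prod.distrib)
qed

lemma mpoly_eval_superset:
  "finite S \<Longrightarrow> Poly_Mapping.keys P \<subseteq> S \<Longrightarrow>
    mpoly_eval t P = (\<Sum>m\<in>S. Poly_Mapping.lookup P m * mon_eval t m)"
  unfolding mpoly_eval_def mon_eval_def
  by (rule sum.mono_neutral_left) (auto simp: Poly_Mapping.in_keys_iff)

lemma mpoly_eval_add: "mpoly_eval t (P + Q) = mpoly_eval t P + mpoly_eval t Q"
proof -
  let ?S = "Poly_Mapping.keys P \<union> Poly_Mapping.keys Q"
  have "Poly_Mapping.keys (P + Q) \<subseteq> ?S" by (rule Poly_Mapping.keys_add)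
  then show ?thesis
    by (simp add: mpoly_eval_superset[of ?S] lookup_add algebra_simps sum.distrib)
qed

lemma mpoly_eval_single: "mpoly_eval t (Poly_Mapping.single m c) = c * mon_eval t m"
  by (subst mpoly_eval_superset[of "{m}"]) auto

text \<open>Every polynomial is a sum of terms; this reduces multiplicativity of evaluation to products of
  two terms, where it is additivity of exponents.\<close>

lemma mpoly_induct [case_names single add]:
  fixes P :: "'r::comm_ring_1 mpoly"
  assumes single: "\<And>m c. R (Poly_Mapping.single m c)"
    and add: "\<And>P Q. R P \<Longrightarrow> R Q \<Longrightarrow> R (P + Q)"
  shows "R P"
proof (induction P rule: update_induct)
  case const
  show ?case using single[of undefined 0] by simp
next
  case (update f a b)
  have "Poly_Mapping.update a b f = f + Poly_Mapping.single a b"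
    using update(1)
    by (intro poly_mapping_eqI)
       (auto simp: lookup_update lookup_add lookup_single Poly_Mapping.in_keys_iff when_def)
  then show ?case using update single add by metis
qed

lemma mpoly_eval_mult: "mpoly_eval t (P * Q) = mpoly_eval t P * mpoly_eval t Q"
proof (induction P rule: mpoly_induct)
  case (single m c)
  show ?case
    by (induction Q rule: mpoly_induct)
       (simp_all add: mult_single mpoly_eval_single mon_eval_add mpoly_eval_add algebra_simps)
qed (simp add: mpoly_eval_add algebra_simps)

lemma mpoly_vars_add: "mpoly_vars (P + Q) \<subseteq> mpoly_vars P \<union> mpoly_vars Q"
  using Poly_Mapping.keys_add[of P Q] by (force simp: mpoly_vars_def)

lemma mpoly_vars_mult: "mpoly_vars (P * Q) \<subseteq> mpoly_vars P \<union> mpoly_vars Q"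
proof
  fix i assume "i \<in> mpoly_vars (P * Q)"
  then obtain m where "m \<in> Poly_Mapping.keys (P * Q)" "i \<in> Poly_Mapping.keys m"
    by (auto simp: mpoly_vars_def)
  then obtain a b where "a \<in> Poly_Mapping.keys P" "b \<in> Poly_Mapping.keys Q" "m = a + b"
    using Poly_Mapping.keys_mult[of P Q] by blast
  with \<open>i \<in> Poly_Mapping.keys m\<close> show "i \<in> mpoly_vars P \<union> mpoly_vars Q"
    using Poly_Mapping.keys_add[of a b] by (auto simp: mpoly_vars_def)
qed

lemma polyfun_imp_mpoly:
  assumes "polyfun V f"
  shows "\<exists>P. mpoly_vars P \<subseteq> V \<and> (\<forall>t. mpoly_eval t P = f t)"
  using assms
proof induction
  case (polyfun_const c)
  show ?case
    by (intro exI[of _ "Poly_Mapping.single 0 c"])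
       (auto simp: mpoly_vars_def mpoly_eval_single mon_eval_def split: if_splits)
next
  case (polyfun_var i)
  then show ?case
    by (intro exI[of _ "Poly_Mapping.single (Poly_Mapping.single i 1) 1"])
       (auto simp: mpoly_vars_def mpoly_eval_single mon_eval_def split: if_splits)
next
  case (polyfun_add f g)
  then obtain P Q where "mpoly_vars P \<subseteq> V" "\<forall>t. mpoly_eval t P = f t"
    "mpoly_vars Q \<subseteq> V" "\<forall>t. mpoly_eval t Q = g t" by blast
  then show ?case using mpoly_vars_add[of P Q]
    by (intro exI[of _ "P + Q"]) (auto simp: mpoly_eval_add)
next
  case (polyfun_mult f g)
  then obtain P Q where "mpoly_vars P \<subseteq> V" "\<forall>t. mpoly_eval t P = f t"
    "mpoly_vars Q \<subseteq> V" "\<forall>t. mpoly_eval t Q = g t" by blast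
  then show ?case using mpoly_vars_mult[of P Q]
    by (intro exI[of _ "P * Q"]) (auto simp: mpoly_eval_mult)
qed

definition mat2 :: "'r \<Rightarrow> 'r \<Rightarrow> 'r \<Rightarrow> 'r \<Rightarrow> 'r::comm_ring_1 ^ 2 ^ 2" where
  "mat2 a b c d = vector [vector [a, b], vector [c, d]]"

lemma mat2_nth [simp]:
  "mat2 a b c d $ 1 $ 1 = a" "mat2 a b c d $ 1 $ 2 = b"
  "mat2 a b c d $ 2 $ 1 = c" "mat2 a b c d $ 2 $ 2 = d"
  by (simp_all add: mat2_def)

lemma mat2_collapse: "mat2 (M$1$1) (M$1$2) (M$2$1) (M$2$2) = M"
  by (simp add: vec_eq_iff forall_2)

lemma mat2_eq_iff [simp]:
  "mat2 a b c d = mat2 a' b' c' d' \<longleftrightarrow> a = a' \<and> b = b' \<and> c = c' \<and> d = d'"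
  by (metis mat2_nth)

lemma mat2_cases [cases type]: obtains a b c d where "M = mat2 a b c d"
  using mat2_collapse by metis

lemma mat2_mult [simp]:
  "mat2 a b c d ** mat2 a' b' c' d' =
    mat2 (a * a' + b * c') (a * b' + b * d') (c * a' + d * c') (c * b' + d * d')"
  by (simp add: vec_eq_iff forall_2 matrix_matrix_mult_def sum_2)

lemma det_mat2 [simp]: "det (mat2 a b c d) = a * d - b * c"
  by (simp add: det_2)

lemma transpose_mat2 [simp]: "transpose (mat2 a b c d) = mat2 a c b d"
  by (simp add: vec_eq_iff forall_2 transpose_def)

lemma mat_1_mat2: "mat 1 = mat2 1 0 0 1"
  by (simp add: vec_eq_iff forall_2 mat_def)

text \<open>The determinant is required to be 1 for all parameter values, not only for those of interest. So
  the range of such a map never leaves \<open>SL2\<close>, and covering \<open>SL2\<close> is the same as parametrising it.\<close>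

definition polymat :: "nat set \<Rightarrow> ((nat \<Rightarrow> 'r) \<Rightarrow> 'r::comm_ring_1 ^ 2 ^ 2) \<Rightarrow> bool" where
  "polymat V F \<longleftrightarrow> (\<forall>i j. polyfun V (\<lambda>t. F t $ i $ j)) \<and> (\<forall>t. det (F t) = 1)"

lemma polymat_mat2:
  assumes "polyfun V f" "polyfun V g" "polyfun V h" "polyfun V k"
    and "\<And>t. f t * k t - g t * h t = 1"
  shows "polymat V (\<lambda>t. mat2 (f t) (g t) (h t) (k t))"
proof -
  have "polyfun V (\<lambda>t. mat2 (f t) (g t) (h t) (k t) $ i $ j)" for i j :: 2
    using exhaust_2[of i] exhaust_2[of j] assms(1-4) by auto
  then show ?thesis using assms(5) by (simp add: polymat_def)
qed

lemma polymat_mult: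
  assumes "polymat V F" and "polymat V G"
  shows "polymat V (\<lambda>t. F t ** G t)"
proof -
  have 1: "polyfun V (\<lambda>t. F t $ i $ j)" "polyfun V (\<lambda>t. G t $ i $ j)" for i j
    using assms by (auto simp: polymat_def)
  have "polyfun V (\<lambda>t. (F t ** G t) $ i $ j)" for i j
    by (simp add: matrix_matrix_mult_def sum_2) (intro polyfun_intros 1)
  then show ?thesis using assms by (simp add: polymat_def det_mul)
qed

lemma polymat_rename:
  assumes "polymat V F" and "s ` V \<subseteq> W"
  shows "polymat W (\<lambda>t. F (\<lambda>i. t (s i)))"
proof -
  have "polyfun W (\<lambda>t. F (\<lambda>i. t (s i)) $ i $ j)" for i j
    by (rule polyfun_rename[of V "\<lambda>t. F t $ i $ j"]) (use assms in \<open>simp_all add: polymat_def\<close>)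
  then show ?thesis using assms(1) by (simp add: polymat_def)
qed

lemma polymat_mono: "polymat V F \<Longrightarrow> V \<subseteq> W \<Longrightarrow> polymat W F"
  by (simp add: polymat_def polyfun_mono[of V])

lemma polymat_cong:
  assumes "polymat V F" and "\<And>i. i \<in> V \<Longrightarrow> t i = t' i"
  shows "F t = F t'"
proof -
  have "F t $ i $ j = F t' $ i $ j" for i j
    by (rule polyfun_cong[of V "\<lambda>t. F t $ i $ j"]) (use assms in \<open>simp_all add: polymat_def\<close>)
  then show ?thesis by (simp add: vec_eq_iff)
qed

lemma polymat_transpose: "polymat V F \<Longrightarrow> polymat V (\<lambda>t. transpose (F t))"
  by (simp add: polymat_def) (simp add: transpose_def)

text \<open>Asking for inclusion in the range, and not for equality, allows families to be thinned out and
  multiplied freely; the determinant condition in \<open>polymat\<close> recovers equality for \<open>SL2\<close> itself.\<close>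

definition polycover :: "nat \<Rightarrow> ('r::comm_ring_1 ^ 2 ^ 2) set \<Rightarrow> bool" where
  "polycover n S \<longleftrightarrow> (\<exists>F. polymat {..<n} F \<and> S \<subseteq> range F)"

lemma polycover_subset: "polycover n S \<Longrightarrow> S' \<subseteq> S \<Longrightarrow> polycover n S'"
  unfolding polycover_def by blast

lemma polycover_mono: "polycover n S \<Longrightarrow> n \<le> m \<Longrightarrow> polycover m S"
  unfolding polycover_def using polymat_mono[of "{..<n}" _ "{..<m}"] by auto

text \<open>The second factor gets fresh variables by a shift of indices, so that the numbers of parameters add.\<close>

lemma polycover_mult:
  assumes "polycover n S" and "polycover m T"
  shows "polycover (n + m) {A ** B |A B. A \<in> S \<and> B \<in> T}"
proof -
  obtain F where F: "polymat {..<n} F" "S \<subseteq> range F"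
    using assms(1) unfolding polycover_def by blast
  obtain G where G: "polymat {..<m} G" "T \<subseteq> range G"
    using assms(2) unfolding polycover_def by blast
  define H where "H t = F t ** G (\<lambda>i. t (i + n))" for t
  have "polymat {..<n+m} H"
    unfolding H_def by (intro polymat_mult polymat_mono[OF F(1)] polymat_rename[OF G(1)]) auto
  moreover have "A ** B \<in> range H" if A: "A \<in> S" and B: "B \<in> T" for A B
  proof -
    obtain s where s: "A = F s" using A F(2) by blast
    obtain t where t: "B = G t" using B G(2) by blast
    define u where "u i = (if i < n then s i else t (i - n))" for i
    have "F u = F s" by (rule polymat_cong[OF F(1)]) (simp add: u_def)
    moreover have "G (\<lambda>i. u (i + n)) = G t" by (simp add: u_def)
    ultimately have "A ** B = H u" unfolding s t by (simp add: H_def)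
    then show ?thesis by blast
  qed
  then have "{A ** B |A B. A \<in> S \<and> B \<in> T} \<subseteq> range H" by auto
  ultimately show ?thesis unfolding polycover_def by blast
qed

lemma polycover_transpose:
  assumes "polycover n S"
  shows "polycover n {M. transpose M \<in> S}"
proof -
  obtain F where F: "polymat {..<n} F" "S \<subseteq> range F"
    using assms(1) unfolding polycover_def by blast
  have "M \<in> range (\<lambda>t. transpose (F t))" if M: "transpose M \<in> S" for M
  proof -
    obtain t where "transpose M = F t" using M F(2) by blast
    then have "M = transpose (F t)" using transpose_transpose[of M] by simp
    then show ?thesis by blast
  qed
  then have "{M. transpose M \<in> S} \<subseteq> range (\<lambda>t. transpose (F t))" by blast
  with polymat_transpose[OF F(1)] show ?thesis unfolding polycover_def by blast
qed

lemma polycover_SL2_imp_polynomial_family: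
  assumes "polycover n (SL2 :: ('r::comm_ring_1 ^ 2 ^ 2) set)" and "0 < n"
  shows "polynomial_family 4 n (matrix_entries ` (SL2 :: ('r ^ 2 ^ 2) set))"
proof -
  obtain F :: "_ \<Rightarrow> 'r ^ 2 ^ 2" where "polymat {..<n} F" and F3: "SL2 \<subseteq> range F"
    using assms(1) unfolding polycover_def by blast
  then have F: "\<And>i j. polyfun {..<n} (\<lambda>t. F t $ i $ j)" "\<And>t. det (F t) = 1"
    by (simp_all add: polymat_def)
  with F3 have range: "SL2 = range F" by (auto simp: SL2_def)
  obtain P where P: "\<And>i j. mpoly_vars (P i j) \<subseteq> {..<n}" "\<And>i j t. mpoly_eval t (P i j) = F t $ i $ j"
    using polyfun_imp_mpoly[OF F(1)] by metis
  let ?Ps = "[P 1 1, P 1 2, P 2 1, P 2 2]"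
  have eval: "map (mpoly_eval t) ?Ps = matrix_entries (F t)" for t
    by (simp add: matrix_entries_def P)
  have trunc: "F t = F (\<lambda>i. map t [0..<n] ! i)" for t
    by (simp add: vec_eq_iff) (auto intro!: polyfun_cong[OF F(1)])
  have "matrix_entries ` SL2 = {map (mpoly_eval (\<lambda>i. t ! i)) ?Ps |t. length t = n}"
  proof (intro equalityI subsetI)
    fix x assume "x \<in> matrix_entries ` (SL2 :: ('r ^ 2 ^ 2) set)"
    then obtain t where "x = matrix_entries (F t)" by (auto simp: range)
    then have "x = map (mpoly_eval (\<lambda>i. map t [0..<n] ! i)) ?Ps"
      unfolding eval trunc[of t, symmetric] .
    then show "x \<in> {map (mpoly_eval (\<lambda>i. t ! i)) ?Ps |t. length t = n}"
      by (intro CollectI exI[of _ "map t [0..<n]"]) auto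
  next
    fix x assume "x \<in> {map (mpoly_eval (\<lambda>i. t ! i)) ?Ps |t. length t = n}"
    then obtain t where "x = matrix_entries (F (\<lambda>i. t ! i))" using eval by blast
    then show "x \<in> matrix_entries ` SL2" by (auto simp: range)
  qed
  then show ?thesis unfolding polynomial_family_def using assms(2) P(1)
    by (intro conjI exI[of _ ?Ps]) auto
qed

section \<open>Elementary matrices, transvections and two special families\<close>

abbreviation upper :: "'r \<Rightarrow> 'r::comm_ring_1 ^ 2 ^ 2" where "upper x \<equiv> mat2 1 x 0 1"
abbreviation lower :: "'r \<Rightarrow> 'r::comm_ring_1 ^ 2 ^ 2" where "lower x \<equiv> mat2 1 0 x 1"

text \<open>The matrix \<open>1 + x (v, w)\<^sup>T (-w, v)\<close>, which is \<open>\<gamma> E \<gamma>\<^sup>-\<^sup>1\<close> for an elementary matrix \<open>E\<close> with entry \<open>x\<close> above the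
  diagonal whenever \<open>(v, w)\<close> is the first column of \<open>\<gamma>\<close> in \<open>SL\<^sub>2\<close>. The formula has determinant 1 for
  arbitrary \<open>v\<close> and \<open>w\<close>, so the three parameters are free.\<close>

definition transvec :: "'r \<Rightarrow> 'r \<Rightarrow> 'r \<Rightarrow> 'r::comm_ring_1 ^ 2 ^ 2" where
  "transvec x v w = mat2 (1 - x * v * w) (x * v^2) (- x * w^2) (1 + x * v * w)"

lemma polymat_upper: "polyfun V f \<Longrightarrow> polymat V (\<lambda>t. upper (f t))"
  by (rule polymat_mat2) (auto intro: polyfun_const)

lemma polymat_lower: "polyfun V f \<Longrightarrow> polymat V (\<lambda>t. lower (f t))"
  by (rule polymat_mat2) (auto intro: polyfun_const)

lemma polymat_transvec:
  "polyfun V f \<Longrightarrow> polyfun V g \<Longrightarrow> polyfun V h \<Longrightarrow> polymat V (\<lambda>t. transvec (f t) (g t) (h t))"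
  unfolding transvec_def
  by (rule polymat_mat2) (auto intro!: polyfun_intros simp: algebra_simps power2_eq_square)

lemma polycoverI: "polymat {..<n} F \<Longrightarrow> S \<subseteq> range F \<Longrightarrow> polycover n S"
  unfolding polycover_def by blast

lemma polycover_upper: "polycover 1 (range (upper :: 'r \<Rightarrow> 'r::comm_ring_1 ^ 2 ^ 2))"
proof (rule polycoverI)
  show "polymat {..<1} (\<lambda>t :: nat \<Rightarrow> 'r. upper (t 0))"
    by (intro polymat_upper polyfun_var) simp
  have "upper x \<in> range (\<lambda>t :: nat \<Rightarrow> 'r. upper (t 0))" for x
    by (rule range_eqI[of _ _ "\<lambda>_. x"]) simp
  then show "range upper \<subseteq> range (\<lambda>t :: nat \<Rightarrow> 'r. upper (t 0))" by blast
qed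

lemma polycover_lower: "polycover 1 (range (lower :: 'r \<Rightarrow> 'r::comm_ring_1 ^ 2 ^ 2))"
proof (rule polycoverI)
  show "polymat {..<1} (\<lambda>t :: nat \<Rightarrow> 'r. lower (t 0))"
    by (intro polymat_lower polyfun_var) simp
  have "lower x \<in> range (\<lambda>t :: nat \<Rightarrow> 'r. lower (t 0))" for x
    by (rule range_eqI[of _ _ "\<lambda>_. x"]) simp
  then show "range lower \<subseteq> range (\<lambda>t :: nat \<Rightarrow> 'r. lower (t 0))" by blast
qed

lemma polycover_transvec: "polycover 3 {transvec x v w |x v w :: 'r::comm_ring_1. True}"
proof (rule polycoverI)
  show "polymat {..<3} (\<lambda>t :: nat \<Rightarrow> 'r. transvec (t 0) (t 1) (t 2))"
    by (intro polymat_transvec polyfun_var) simp_all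
  have "transvec x v w \<in> range (\<lambda>t :: nat \<Rightarrow> 'r. transvec (t 0) (t 1) (t 2))" for x v w
    by (rule range_eqI[of _ _ "(!) [x, v, w]"]) simp
  then show "{transvec x v w |x v w. True} \<subseteq> range (\<lambda>t :: nat \<Rightarrow> 'r. transvec (t 0) (t 1) (t 2))"
    by blast
qed

text \<open>Written with \<open>\<alpha>\<close> for the matrix with rows \<open>(a, b)\<close>, \<open>(c s\<^sup>2, d)\<close>, and with \<open>U\<close>, \<open>L\<close> for upper and lower
  elementary matrices, this is \<open>\<alpha>\<^sup>-\<^sup>1 \<delta> \<alpha> \<delta>\<^sup>-\<^sup>1\<close>, expanded along
  \<open>\<delta> = diag(s, 1/s) = U(-1) L(1 - s) U(1/s) L(s\<^sup>2 - s)\<close>. The first two factors are the conjugates by \<open>\<alpha>\<close> of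
  \<open>U(-1)\<close> and \<open>L(1 - s)\<close>. The third is \<open>\<alpha>\<^sup>-\<^sup>1 U(1/s) \<alpha> U(-1/s)\<close>; its denominators cancel since \<open>a\<close> and
  \<open>d\<close> are \<open>1 + s a'\<close> and \<open>1 + s d'\<close>. The fourth is the commutator of \<open>\<alpha>\<^sup>-\<^sup>1\<close> and \<open>L(s\<^sup>2 - s)\<close>,
  conjugated by \<open>U(1/s)\<close>, where denominators cancel for the same reason. The last two
  factors complete \<open>\<delta>\<^sup>-\<^sup>1\<close>. All factors are written so that their
  determinant is 1 identically in the five parameters, whether or not these come from some \<open>\<alpha>\<close>.\<close>

definition swindle :: "'r \<Rightarrow> 'r \<Rightarrow> 'r \<Rightarrow> 'r \<Rightarrow> 'r \<Rightarrow> 'r::comm_ring_1 ^ 2 ^ 2" where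
  "swindle s a' b c d' = (let a = 1 + s * a'; d = 1 + s * d'; w = s - 1; k = s * w in
     transvec (-1) d (- (c * s^2))
     ** transvec w b (- a)
     ** mat2 (1 + d * c * s) (2 * d' + s * d'^2 - d * c) (- (c^2) * s^3) (1 - c * d * s + c^2 * s^2)
     ** mat2 (1 - k * a * b + k^2 * b^2 + w * (a^2 - 1 - k * a * b))
             (- k * b^2 + w * (2 * a * b - k * b^2) - w * (2 * a' + s * a'^2 - w * a * b))
             (k * (a^2 - 1 - k * a * b))
             (1 + k * a * b - w * (a^2 - 1 - k * a * b))
     ** lower w ** upper 1)"

lemma polymat_swindle:
  assumes "polyfun V s" "polyfun V a" "polyfun V b" "polyfun V c" "polyfun V d"
  shows "polymat V (\<lambda>t. swindle (s t) (a t) (b t) (c t) (d t))"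
  unfolding swindle_def Let_def
  apply (intro polymat_mult polymat_transvec polymat_lower polymat_upper polymat_mat2 polyfun_intros assms)
   apply (simp add: algebra_simps power2_eq_square power3_eq_cube)
  apply (simp add: algebra_simps power2_eq_square)
  done

lemma polycover_swindle: "polycover 5 {swindle s a b c d |s a b c d :: 'r::comm_ring_1. True}"
proof (rule polycoverI)
  show "polymat {..<5} (\<lambda>t :: nat \<Rightarrow> 'r. swindle (t 0) (t 1) (t 2) (t 3) (t 4))"
    by (intro polymat_swindle polyfun_var) simp_all
  have "swindle s a b c d \<in> range (\<lambda>t :: nat \<Rightarrow> 'r. swindle (t 0) (t 1) (t 2) (t 3) (t 4))" for s a b c d
    by (rule range_eqI[of _ _ "(!) [s, a, b, c, d]"]) (simp add: eval_nat_numeral)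
  then show "{swindle s a b c d |s a b c d. True}
      \<subseteq> range (\<lambda>t :: nat \<Rightarrow> 'r. swindle (t 0) (t 1) (t 2) (t 3) (t 4))"
    by blast
qed

lemma mat2_conj_upper:
  assumes "a * d - b * c = 1"
  shows "mat2 a b c d ** transvec x d (- c) = upper x ** mat2 a b (c :: 'r::idom) d"
proof -
  have "a * (x * d^2) + b * (1 + x * d * (- c)) = b + x * d"
    "a * (1 - x * d * (- c)) + b * (- x * (- c)^2) = a + x * c"
    using assms by algebra+
  then show ?thesis by (simp add: transvec_def algebra_simps power2_eq_square)
qed

lemma mat2_conj_lower:
  assumes "a * d - b * c = 1"
  shows "mat2 a b c d ** transvec (- x) b (- a) = lower x ** mat2 a b (c :: 'r::idom) d"
proof -
  have "c * (1 - (- x) * b * (- a)) + d * (- (- x) * (- a)^2) = x * a + c"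
    "c * ((- x) * b^2) + d * (1 + (- x) * b * (- a)) = x * b + d"
    using assms by algebra+
  then show ?thesis by (simp add: transvec_def algebra_simps power2_eq_square)
qed

text \<open>Conjugation by \<open>diag(s, 1/s)\<close> moves \<open>s\<^sup>2\<close> from the lower left to the upper right entry. The hypothesis
  \<open>rel\<close> is the determinant equation after division by \<open>s\<close>.\<close>

lemma mat2_times_swindle:
  fixes s a b c d :: "'r::idom"
  assumes rel: "a' + d' + s * a' * d' = s * b * c"
    and a: "a = 1 + s * a'" and d: "d = 1 + s * d'"
  shows "mat2 a b (c * s^2) d ** swindle s a' b c d' = mat2 a (b * s^2) c d"
proof -
  define w k where w: "w = s - 1" and k: "k = s * w"
  let ?A = "mat2 a b (c * s^2) d"
  let ?T3 = "mat2 (1 + d * c * s) (2 * d' + s * d'^2 - d * c) (- (c^2) * s^3) (1 - c * d * s + c^2 * s^2)"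
  let ?T4 = "mat2 (1 - k * a * b + k^2 * b^2 + w * (a^2 - 1 - k * a * b))
             (- k * b^2 + w * (2 * a * b - k * b^2) - w * (2 * a' + s * a'^2 - w * a * b))
             (k * (a^2 - 1 - k * a * b))
             (1 + k * a * b - w * (a^2 - 1 - k * a * b))"
  have det: "a * d - b * (c * s^2) = 1"
    unfolding a d using rel by algebra
  have 1: "?A ** transvec (-1) d (- (c * s^2)) = upper (-1) ** ?A"
    by (rule mat2_conj_upper[OF det])
  have 2: "?A ** transvec w b (- a) = lower (- w) ** ?A"
    using mat2_conj_lower[OF det, of "- w"] by simp
  have 3: "?A ** ?T3 = mat2 (a + c * s) (b - c + d' - a') (c * s^2) (d - c * s)"
    unfolding mat2_mult mat2_eq_iff
    by (intro conjI) (use rel a d in \<open>algebra | simp add: algebra_simps power2_eq_square power3_eq_cube\<close>)+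
  have 4: "mat2 (a + c * s) (b - c + d' - a') (c * s^2) (d - c * s) ** ?T4 =
     mat2 ((a+c) - w*(b * s^2+d-a-c)) (b * s^2+d-a-c)
       (c - w * (d-c) + w * ((a+c) - w*(b * s^2+d-a-c))) (d-c+ w *(b * s^2+d-a-c))"
    unfolding mat2_mult mat2_eq_iff by (intro conjI) (use rel a d k w in algebra)+
  also have "\<dots> = lower w ** upper 1 ** mat2 a (b * s^2) c d ** upper (-1) ** lower (- w)"
    by (simp add: algebra_simps)
  finally have 4: "mat2 (a + c * s) (b - c + d' - a') (c * s^2) (d - c * s) ** ?T4 =
     lower w ** upper 1 ** mat2 a (b * s^2) c d ** upper (-1) ** lower (- w)" .
  have "?A ** swindle s a' b c d' = ?A ** transvec (-1) d (- (c * s^2))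
     ** transvec w b (- a) ** ?T3 ** ?T4 ** lower w ** upper 1"
    by (simp only: swindle_def Let_def a d k w matrix_mul_assoc)
  also have "\<dots> = upper (-1) ** (?A ** transvec w b (- a)) ** ?T3 ** ?T4 ** lower w ** upper 1"
    by (simp only: 1 matrix_mul_assoc)
  also have "\<dots> = upper (-1) ** lower (- w) ** (?A ** ?T3) ** ?T4 ** lower w ** upper 1"
    by (simp only: 2 matrix_mul_assoc)
  also have "\<dots> = upper (-1) ** lower (- w)
      ** (mat2 (a + c * s) (b - c + d' - a') (c * s^2) (d - c * s) ** ?T4) ** lower w ** upper 1"
    by (simp only: 3 matrix_mul_assoc)
  also have "\<dots> = (upper (-1) ** (lower (- w) ** lower w) ** upper 1) ** mat2 a (b * s^2) c d
       ** (upper (-1) ** (lower (- w) ** lower w) ** upper 1)"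
    by (simp only: 4 matrix_mul_assoc)
  also have "upper (-1) ** (lower (- w) ** lower w) ** upper 1 = mat 1"
    by (simp add: mat_1_mat2)
  finally show ?thesis by simp
qed

lemma mat2_same_first_row:
  assumes "a * d - b * c = 1" and "a * d' - b * c' = (1 :: 'r::idom)"
  shows "mat2 a b c' d' = lower (c' * d - c * d') ** mat2 a b c d"
proof -
  have "(c' * d - c * d') * a + c = c'" "(c' * d - c * d') * b + d = d'"
    using assms by algebra+
  then show ?thesis by simp
qed

text \<open>The commutator of \<open>\<omega>\<close> and \<open>diag(1, -1)\<close>, where \<open>\<omega>\<close> has rows \<open>(p, b)\<close> and \<open>(z, u)\<close> and determinant
  \<open>p u - b z = 2\<close>. The determinant 2 cancels the factor 2 in the off-diagonal entries of the commutator.\<close>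

definition reflection_commutator :: "'r \<Rightarrow> 'r \<Rightarrow> 'r \<Rightarrow> 'r \<Rightarrow> 'r::comm_ring_1 ^ 2 ^ 2" where
  "reflection_commutator p b z u = mat2 (1 + b * z) (b * p) (z * u) (1 + b * z)"

text \<open>Multiplying \<open>\<omega>\<close> on the right by an elementary matrix changes its commutator with \<open>diag(1, -1)\<close> by a
  conjugate of the square of that elementary matrix, because \<open>diag(1, -1)\<close> inverts elementary matrices by
  conjugation. So \<open>b\<close> may be changed modulo \<open>p\<close>, and in the next lemma \<open>p\<close> modulo \<open>b\<close>, at the
  cost of one transvection.\<close>

lemma reflection_commutator_upper:
  fixes p b z u :: "'r::idom"
  assumes "p * u - b * z = 2"
  shows "reflection_commutator p b z u = transvec (- y) p z ** reflection_commutator p (b + y * p) z (u + y * z)"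
  unfolding reflection_commutator_def transvec_def mat2_mult mat2_eq_iff
  by (intro conjI) (use assms in \<open>algebra | simp add: algebra_simps power2_eq_square\<close>)+

lemma reflection_commutator_lower:
  fixes p b z u :: "'r::idom"
  assumes "p * u - b * z = 2"
  shows "reflection_commutator p b z u = transvec y b u ** reflection_commutator (p + y * b) b (z + y * u) u"
  unfolding reflection_commutator_def transvec_def mat2_mult mat2_eq_iff
  by (intro conjI) (use assms in \<open>algebra | simp add: algebra_simps power2_eq_square\<close>)+

text \<open>If \<open>p\<close> is a constant times \<open>r\<^sup>2\<close>, then the diagonal entry \<open>1 + b z\<close> is \<open>-1\<close> modulo \<open>r\<close>, since
  \<open>2 + b z = p u\<close>. So \<open>r\<^sup>2\<close> can be moved to the lower left entry of the negative matrix.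
  What remains has first row \<open>(1 + b z, k b)\<close>, the first row of a product of two elementary matrices.\<close>

lemma reflection_commutator_square:
  fixes b z u r k k' :: "'r::idom"
  assumes "k * r^2 * u - b * z = 2" and "k * k' = 1"
  shows "\<exists>x. reflection_commutator (k * r^2) b z u = lower x ** upper (k * b) ** lower (z * k')
           ** swindle r (- (k * r * u)) (- (k * b)) (- (z * u)) (- (k * r * u))"
proof -
  let ?X = "1 + b * z" and ?neg = "mat2 (-1) 0 0 (-1) :: 'r ^ 2 ^ 2"
  let ?Q = "swindle r (- (k * r * u)) (- (k * b)) (- (z * u)) (- (k * r * u))"
  have rel: "k * r^2 * u = 2 + b * z"
    using assms(1) by (simp add: algebra_simps)
  then have X: "- ?X = 1 + r * (- (k * r * u))"
    by (simp add: algebra_simps power2_eq_square)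
  have "r * - (k * r * u) * - (k * r * u) = (k * r * u) * (k * r^2 * u)"
    by (simp add: algebra_simps power2_eq_square)
  then have "- (k * r * u) + - (k * r * u) + r * - (k * r * u) * - (k * r * u) = r * - (k * b) * - (z * u)"
    unfolding rel by (simp add: algebra_simps)
  then have "mat2 (- ?X) (- (k * b)) (- (z * u) * r^2) (- ?X) ** ?Q
      = mat2 (- ?X) (- (k * b) * r^2) (- (z * u)) (- ?X)"
    by (rule mat2_times_swindle[OF _ X X])
  then have "?neg ** mat2 (- ?X) (- (k * b)) (- (z * u) * r^2) (- ?X) ** ?Q
      = ?neg ** mat2 (- ?X) (- (k * b) * r^2) (- (z * u)) (- ?X)"
    by (simp only: matrix_mul_assoc[symmetric])
  then have 1: "mat2 ?X (k * b) (z * u * r^2) ?X ** ?Q = reflection_commutator (k * r^2) b z u"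
    by (simp add: reflection_commutator_def algebra_simps)
  have 2: "upper (k * b) ** lower (z * k') = mat2 ?X (k * b) (z * k') 1"
    using assms(2) by (simp add: algebra_simps)
  have d1: "?X * 1 - k * b * (z * k') = 1"
    using assms(2) by algebra
  have "k * b * (z * u * r^2) = b * z * (k * r^2 * u)"
    by (simp add: algebra_simps)
  then have d2: "?X * ?X - k * b * (z * u * r^2) = 1"
    unfolding rel by (simp add: algebra_simps)
  have "mat2 ?X (k * b) (z * u * r^2) ?X
      = lower (z * u * r^2 * 1 - z * k' * ?X) ** mat2 ?X (k * b) (z * k') 1"
    by (rule mat2_same_first_row[OF d1 d2])
  then show ?thesis
    unfolding 1[symmetric] 2[symmetric] by (auto simp only: matrix_mul_assoc)
qed

section \<open>Arithmetic modulo an irreducible polynomial\<close>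

text \<open>Euclid's algorithm as an induction, in which the degree of 0 counts as smaller than that of constants.\<close>

lemma poly_bezout:
  fixes a b :: "'a::field poly"
  shows "\<exists>d u v. d = u * a + v * b \<and> d dvd a \<and> d dvd b"
proof (induction "if b = 0 then 0 else Suc (degree b)" arbitrary: a b rule: less_induct)
  case less
  show ?case
  proof (cases "b = 0")
    case True
    then show ?thesis by (intro exI[of _ a] exI[of _ 1] exI[of _ 0]) auto
  next
    case False
    have "(if a mod b = 0 then 0 else Suc (degree (a mod b))) < (if b = 0 then 0 else Suc (degree b))"
      using False degree_mod_less[of b a] by auto
    from less[OF this] obtain d u v where d: "d = u * b + v * (a mod b)" "d dvd b" "d dvd a mod b"
      by metis
    have "d = v * a + (u - v * (a div b)) * b"
      unfolding d(1) minus_div_mult_eq_mod[symmetric] by (simp add: algebra_simps)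
    moreover have "d dvd a" using d(2,3) dvd_mod_iff by blast
    ultimately show ?thesis using d(2) by blast
  qed
qed

lemma coprime_poly_bezout:
  fixes a b :: "'a::field poly"
  assumes "coprime a b"
  obtains u v where "u * a + v * b = 1"
proof -
  obtain d u v where d: "d = u * a + v * b" "d dvd a" "d dvd b"
    using poly_bezout by metis
  then have "is_unit d" using assms coprime_common_divisor by blast
  then obtain e where "1 = d * e" by (elim dvdE)
  then have "(e * u) * a + (e * v) * b = 1" using d(1) by (simp add: algebra_simps)
  then show ?thesis by (rule that)
qed

lemma irreducible_poly_coprime:
  fixes p a :: "'a::field poly"
  assumes "irreducible p" and "\<not> p dvd a"
  shows "coprime p a"
proof (rule coprimeI)
  fix c assume "c dvd p" "c dvd a"
  then show "is_unit c" using assms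
    by (metis dvd_trans irreducible_altdef)
qed

lemma irreducible_poly_imp_prime_elem:
  fixes p :: "'a::field poly"
  assumes "irreducible p"
  shows "prime_elem p"
proof (rule prime_elemI)
  show "p \<noteq> 0" "\<not> p dvd 1" using assms by (auto simp: irreducible_def)
  fix a b assume ab: "p dvd a * b"
  show "p dvd a \<or> p dvd b"
  proof (rule disjCI)
    assume "\<not> p dvd b"
    then obtain u v where "u * p + v * b = 1"
      using irreducible_poly_coprime[OF assms] coprime_poly_bezout by metis
    then have "a = a * u * p + v * (a * b)" by algebra
    then show "p dvd a" using ab by (metis dvd_add dvd_mult dvd_triv_right)
  qed
qed

lemma irreducible_poly_degree:
  fixes p :: "'a::field poly"
  assumes "irreducible p"
  shows "0 < degree p"
  using assms is_unit_iff_degree[of p] by (auto simp: irreducible_def)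

lemma prime_elem_dvd_prod:
  assumes "prime_elem p" and "finite S" and "p dvd (\<Prod>x\<in>S. f x)"
  shows "\<exists>x\<in>S. p dvd f x"
  using assms(2,3)
proof (induction S)
  case empty
  then show ?case using assms(1) by (simp add: prime_elem_def)
next
  case (insert x S)
  then show ?case using prime_elem_dvd_mult_iff[OF assms(1)] by auto
qed

lemma geometric_sum_nat: "(\<Sum>i<n. q ^ i) * (q - 1) = q ^ n - (1::nat)" if q: "0 < q"
proof -
  obtain w where "q = Suc w" using gr0_implies_Suc[OF q] by blast
  moreover have "(\<Sum>i<n. Suc w ^ i) * w + 1 = Suc w ^ n"
    by (induction n) (auto simp: algebra_simps)
  ultimately show ?thesis by simp
qed

text \<open>The bound is on the support and not on the degree, because the degree of 0 is 0: with \<open>n = 0\<close> this is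
  \<open>{0}\<close>, the right set of residues modulo a constant.\<close>

definition polys_below :: "nat \<Rightarrow> 'a::zero poly set" where
  "polys_below n = {f. \<forall>i\<ge>n. coeff f i = 0}"

lemma polys_below_Suc: "polys_below (Suc n) = (\<lambda>(c, f). pCons c f) ` (UNIV \<times> polys_below n)"
proof (intro equalityI subsetI)
  fix f assume f: "f \<in> polys_below (Suc n)"
  obtain c g where "f = pCons c g" by (cases f)
  moreover have "g \<in> polys_below n"
    unfolding polys_below_def
  proof (intro CollectI allI impI)
    fix i assume "n \<le> i"
    then have "coeff f (Suc i) = 0" using f by (simp add: polys_below_def)
    then show "coeff g i = 0" using \<open>f = pCons c g\<close> by simp
  qed
  ultimately show "f \<in> (\<lambda>(c, f). pCons c f) ` (UNIV \<times> polys_below n)" by auto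
qed (auto simp: polys_below_def coeff_pCons split: nat.splits)

lemma polys_below_0: "polys_below 0 = {0}"
  by (auto simp: polys_below_def poly_eq_iff)

lemma polys_below_iff:
  assumes "0 < n"
  shows "f \<in> polys_below n \<longleftrightarrow> degree f < n"
proof
  assume f: "f \<in> polys_below n"
  show "degree f < n"
  proof (rule ccontr)
    assume "\<not> degree f < n"
    then have "lead_coeff f = 0" using f by (simp add: polys_below_def)
    then show False using \<open>\<not> degree f < n\<close> assms by simp
  qed
next
  assume "degree f < n"
  then show "f \<in> polys_below n" by (auto simp: polys_below_def intro: coeff_eq_0)
qed

lemma finite_polys_below: "finite (polys_below n :: 'a::{finite,zero} poly set)"
  by (induction n) (auto simp: polys_below_0 polys_below_Suc)

lemma card_polys_below: "card (polys_below n :: 'a::{finite,zero} poly set) = CARD('a) ^ n"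
proof (induction n)
  case (Suc n)
  have "inj_on (\<lambda>(c, f). pCons c f) (UNIV \<times> (polys_below n :: 'a poly set))"
    by (auto simp: inj_on_def)
  then show ?case using Suc
    by (simp add: polys_below_Suc card_image card_cartesian_product)
qed (simp add: polys_below_0)

text \<open>The classical argument: multiplication by \<open>y\<close> permutes the nonzero residues modulo \<open>p\<close>, so it
  does not change their product.\<close>

lemma poly_fermat:
  fixes p y :: "'a::{finite,field} poly"
  assumes "irreducible p" and "\<not> p dvd y"
  shows "[y ^ (CARD('a) ^ degree p - 1) = 1] (mod p)"
proof -
  have prime: "prime_elem p" using assms(1) by (rule irreducible_poly_imp_prime_elem)
  have deg: "0 < degree p" using assms(1) by (rule irreducible_poly_degree)
  have p0: "p \<noteq> 0" using deg by auto
  define R where "R = polys_below (degree p) - {0 :: 'a poly}"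
  have R: "f \<in> R \<longleftrightarrow> f \<noteq> 0 \<and> degree f < degree p" for f
    using polys_below_iff[OF deg] by (auto simp: R_def)
  have fin: "finite R" by (simp add: R_def finite_polys_below)
  have cardR: "card R = CARD('a) ^ degree p - 1"
    using card_polys_below[of "degree p", where 'a = 'a]
    by (simp add: R_def card_Diff_singleton_if finite_polys_below) (simp add: polys_below_def)
  have ndvd: "\<not> p dvd f" if "f \<in> R" for f
    using that R dvd_imp_degree_le[of p f] by auto
  define g where "g f = (y * f) mod p" for f
  have g_in: "g f \<in> R" if "f \<in> R" for f
  proof -
    have "\<not> p dvd y * f" using ndvd[OF that] assms(2) prime_elem_dvd_mult_iff[OF prime] by blast
    then show ?thesis using degree_mod_less_degree[OF p0] by (auto simp: R g_def mod_eq_0_iff_dvd)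
  qed
  have inj: "inj_on g R"
  proof (rule inj_onI)
    fix f f' assume f: "f \<in> R" "f' \<in> R" "g f = g f'"
    then have "p dvd y * (f - f')"
      by (simp add: g_def mod_eq_dvd_iff right_diff_distrib)
    then have "p dvd f - f'" using assms(2) prime_elem_dvd_mult_iff[OF prime] by blast
    moreover have "degree (f - f') < degree p"
      using f R by (auto intro: degree_diff_less)
    ultimately show "f = f'" using dvd_imp_degree_le[of p "f - f'"] by auto
  qed
  have "g ` R = R" using g_in inj fin by (meson endo_inj_surj image_subsetI)
  then have "(\<Prod>f\<in>R. f) = (\<Prod>f\<in>R. g f)" using prod.reindex[OF inj, of "\<lambda>f. f"] by simp
  also have "[(\<Prod>f\<in>R. g f) = (\<Prod>f\<in>R. y * f)] (mod p)"
    by (rule cong_prod) (simp add: g_def)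
  also have "(\<Prod>f\<in>R. y * f) = y ^ card R * (\<Prod>f\<in>R. f)"
    by (simp add: prod.distrib)
  finally have "p dvd (\<Prod>f\<in>R. f) - y ^ card R * (\<Prod>f\<in>R. f)"
    by (simp add: cong_iff_dvd_diff)
  also have "(\<Prod>f\<in>R. f) - y ^ card R * (\<Prod>f\<in>R. f) = (1 - y ^ card R) * (\<Prod>f\<in>R. f)"
    by (simp add: algebra_simps)
  finally have "p dvd (1 - y ^ card R) \<or> p dvd (\<Prod>f\<in>R. f)"
    using prime_elem_dvd_mult_iff[OF prime] by blast
  moreover have "\<not> p dvd (\<Prod>f\<in>R. f)"
    using ndvd prime_elem_dvd_prod[OF prime fin] by blast
  ultimately show ?thesis
    by (metis cardR cong_iff_dvd_diff cong_sym)
qed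

text \<open>Both sides have the same leading term as polynomials in \<open>x\<close> and agree at all \<open>q\<close> constants;
  their difference has degree less than \<open>q\<close>, so it is 0. Substitution extends this from the indeterminate to
  any polynomial \<open>x\<close>.\<close>

lemma prod_minus_constants:
  fixes x :: "'a::{finite,field} poly"
  shows "(\<Prod>c\<in>UNIV. x - [:c:]) = x ^ CARD('a) - x"
proof -
  let ?X = "[:0, 1:] :: 'a poly"
  let ?q = "CARD('a)"
  have q: "1 < ?q" using card_mono[of UNIV "{0, 1 :: 'a}"] by simp
  have frob: "c ^ ?q = c" for c :: 'a
  proof (cases "c = 0")
    case False
    have "(\<Prod>y\<in>UNIV-{0}. c * y) = (\<Prod>y\<in>UNIV-{0}. y)"
      by (rule prod.reindex_bij_witness[of _ "\<lambda>y. y / c" "\<lambda>y. c * y"]) (use False in auto)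
    then have "c ^ (?q - 1) = 1" by (simp add: prod.distrib card_Diff_singleton)
    then show ?thesis using q by (simp add: power_eq_if[of c ?q])
  qed (use q in simp)
  define g where "g = (\<Prod>c\<in>UNIV. ?X - [:c:]) - (?X ^ ?q - ?X)"
  have "g = 0"
  proof (rule ccontr)
    assume "g \<noteq> 0"
    have X1: "?X ^ ?q = monom 1 ?q" by (metis monom_altdef smult_1_left)
    have prodX: "(\<Prod>c\<in>UNIV. ?X - [:c:]) = (\<Prod>c\<in>UNIV. [:- c, 1:] :: 'a poly)"
      by simp
    have deg1: "degree (\<Prod>c\<in>UNIV. ?X - [:c:]) = ?q"
      unfolding prodX by (subst degree_prod_eq_sum_degree) auto
    have lead1: "lead_coeff (\<Prod>c\<in>UNIV. ?X - [:c:]) = 1"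
      unfolding prodX by (simp add: lead_coeff_prod)
    have "coeff g i = 0" if "i \<ge> ?q" for i
    proof (cases "i = ?q")
      case True
      then show ?thesis using deg1 lead1 q
        by (simp add: g_def X1) (simp add: coeff_pCons split: nat.splits)
    next
      case False
      then have "i > ?q" using that by simp
      then have "coeff (\<Prod>c\<in>UNIV. ?X - [:c:]) i = 0" using deg1 by (intro coeff_eq_0) simp
      then show ?thesis using \<open>i > ?q\<close> q
        by (simp add: g_def X1) (simp add: coeff_pCons split: nat.splits)
    qed
    then have "degree g < ?q" using q polys_below_iff[of ?q g] by (simp add: polys_below_def)
    moreover have "poly g c = 0" for c
      by (simp add: g_def poly_prod frob)
    then have "{c. poly g c = 0} = UNIV" by simp
    then have "?q \<le> degree g" using card_poly_roots_bound[OF \<open>g \<noteq> 0\<close>] by simp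
    ultimately show False by simp
  qed
  then have "pcompose g x = 0" by simp
  moreover have "pcompose (?X ^ n) x = x ^ n" for n
    by (induction n) (simp_all add: pcompose_mult pcompose_pCons pcompose_1)
  moreover have "[:- c:] + x = x - [:c:]" for c :: 'a
  proof -
    have "[:- c:] = - [:c:]" by simp
    then show ?thesis by (simp only: uminus_add_conv_diff)
  qed
  ultimately show ?thesis
    by (simp add: g_def pcompose_diff pcompose_prod pcompose_pCons)
qed

text \<open>Here \<open>y\<^sup>N\<close> is the norm of \<open>y\<close> from the residue field of \<open>p\<close> to the field of constants: it is fixed by the
  Frobenius map, so \<open>p\<close> divides the product of all \<open>y\<^sup>N - c\<close> over constants \<open>c\<close>.\<close>

lemma norm_cong_const:
  fixes p y :: "'a::{finite,field} poly"
  assumes "irreducible p" and "\<not> p dvd y" and N: "N * (CARD('a) - 1) = CARD('a) ^ degree p - 1"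
  obtains k where "k \<noteq> 0" and "[y ^ N = [:k:]] (mod p)"
proof -
  let ?q = "CARD('a)"
  have prime: "prime_elem p" using assms(1) by (rule irreducible_poly_imp_prime_elem)
  have "[(y ^ N) ^ (?q - 1) = 1] (mod p)"
    using poly_fermat[OF assms(1,2)] N by (simp add: power_mult[symmetric])
  then have "[(y ^ N) ^ (?q - 1) * y ^ N = 1 * y ^ N] (mod p)" by (rule cong_mult) simp
  moreover have "(y ^ N) ^ (?q - 1) * y ^ N = (y ^ N) ^ ?q"
    by (metis finite_UNIV_card_ge_0 finite_class.finite_UNIV power_minus_mult)
  ultimately have "p dvd (\<Prod>c\<in>UNIV. y ^ N - [:c:])"
    unfolding prod_minus_constants by (simp add: cong_iff_dvd_diff)
  then obtain k where k: "p dvd y ^ N - [:k:]"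
    using prime_elem_dvd_prod[OF prime finite_class.finite_UNIV, of "\<lambda>c. y ^ N - [:c:]"] by blast
  have "k \<noteq> 0"
  proof
    assume "k = 0"
    then have "p dvd y" using k prime_elem_dvd_power[OF prime] by simp
    then show False using assms(2) by simp
  qed
  with k show ?thesis using that by (simp add: cong_iff_dvd_diff)
qed

text \<open>If the degree of \<open>p\<close> is 1 modulo \<open>q - 1\<close>, the norm exponent \<open>N = 1 + q + q\<^sup>2 + \<dots>\<close> is also 1
  modulo \<open>q - 1\<close>. So \<open>a\<^sup>N\<close>, a constant modulo \<open>p\<close>, is \<open>a\<close> times a \<open>(q - 1)\<close>-th power.\<close>

lemma cong_const_times_power:
  fixes p a :: "'a::{finite,field} poly"
  assumes "irreducible p" and "\<not> p dvd a" and "[degree p = 1] (mod (CARD('a) - 1))"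
  obtains k y where "k \<noteq> 0" and "[a = [:k:] * y ^ (CARD('a) - 1)] (mod p)"
proof -
  let ?q = "CARD('a)"
  define N where "N = (\<Sum>i<degree p. ?q ^ i)"
  have q: "1 < ?q" using card_mono[of UNIV "{0, 1 :: 'a}"] by simp
  have N1: "N * (?q - 1) = ?q ^ degree p - 1"
    unfolding N_def using geometric_sum_nat[of ?q] q by simp
  obtain k where k: "k \<noteq> 0" "[a ^ N = [:k:]] (mod p)"
    using norm_cong_const[OF assms(1,2) N1] .
  have "[?q = 1] (mod (?q - 1))" using q by (simp add: cong_altdef_nat)
  then have "[N = (\<Sum>i<degree p. 1 ^ i)] (mod (?q - 1))"
    unfolding N_def by (intro cong_sum cong_pow)
  then have "[N = 1] (mod (?q - 1))" using assms(3) cong_trans by force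
  moreover have "N \<ge> 1"
    using irreducible_poly_degree[OF assms(1)] unfolding N_def
    by (subst sum.remove[of _ 0]) auto
  ultimately obtain j where j: "N = 1 + (?q - 1) * j"
    by (metis cong_le_nat add.commute mult.commute)
  have "\<not> p dvd a ^ j"
    using assms(2) prime_elem_dvd_power[OF irreducible_poly_imp_prime_elem[OF assms(1)]] by blast
  with assms(1) have "coprime p (a ^ j)" by (rule irreducible_poly_coprime)
  then obtain u v where uv: "u * p + v * a ^ j = 1" by (rule coprime_poly_bezout)
  then have "v * a ^ j - 1 = p * (- u)" by (simp add: algebra_simps)
  then have "[v * a ^ j = 1] (mod p)" unfolding cong_iff_dvd_diff by (metis dvd_triv_left)
  then have "[(v * a ^ j) ^ (?q - 1) = 1 ^ (?q - 1)] (mod p)" by (rule cong_pow)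
  then have "[a * (v * a ^ j) ^ (?q - 1) = a * 1] (mod p)" by (intro cong_mult) simp_all
  moreover have "a * (v * a ^ j) ^ (?q - 1) = a ^ N * v ^ (?q - 1)"
    by (simp add: j power_add power_mult_distrib power_mult[symmetric] mult.commute mult.left_commute)
  moreover have "[a ^ N * v ^ (?q - 1) = [:k:] * v ^ (?q - 1)] (mod p)"
    using k(2) by (intro cong_mult) simp_all
  ultimately have "[a = [:k:] * v ^ (?q - 1)] (mod p)"
    by (metis cong_sym cong_trans mult.right_neutral)
  with k(1) show ?thesis by (rule that)
qed

section \<open>Ray classes of monic polynomials and their characters\<close>

lemma coprime_poly_mult_iff:
  fixes a b c :: "'a::field poly"
  shows "coprime (a * b) c \<longleftrightarrow> coprime a c \<and> coprime b c"
proof (intro iffI conjI)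
  assume ab: "coprime a c \<and> coprime b c"
  then obtain u v where 1: "u * a + v * c = 1" using coprime_poly_bezout by metis
  obtain s t where 2: "s * b + t * c = 1" using ab coprime_poly_bezout by metis
  show "coprime (a * b) c"
  proof (rule coprimeI)
    fix d assume d: "d dvd a * b" "d dvd c"
    have "1 = (u * a + v * c) * (s * b + t * c)" using 1 2 by simp
    also have "\<dots> = (u * s) * (a * b) + (u * a * t + v * s * b + v * c * t) * c"
      by (simp add: algebra_simps)
    finally show "is_unit d" using d by (metis dvd_add dvd_mult)
  qed
next
  assume "coprime (a * b) c"
  then show "coprime a c" "coprime b c"
    by (meson coprime_def dvd_mult dvd_mult2)+
qed

lemma coprime_poly_mod_iff:
  fixes a c :: "'a::field poly"
  shows "coprime (a mod c) c \<longleftrightarrow> coprime a c"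
  unfolding coprime_def using dvd_mod_iff by blast

text \<open>Unless \<open>n\<close> divides \<open>k\<close>, multiplication by a primitive root permutes the roots of unity and multiplies the sum by a number
  other than 1.\<close>

lemma sum_power_roots_unity:
  assumes "0 < n"
  shows "(\<Sum>z | z ^ n = (1 :: complex). z ^ k) = (if n dvd k then of_nat n else 0)"
proof (cases "n dvd k")
  case True
  then obtain m where "k = n * m" by (elim dvdE)
  then have "(\<Sum>z | z ^ n = (1 :: complex). z ^ k) = (\<Sum>z | z ^ n = (1 :: complex). 1)"
    by (intro sum.cong) (auto simp: power_mult)
  then show ?thesis using True card_roots_unity_eq[OF assms] by simp
next
  case False
  define w where "w = exp (2 * of_real pi * \<i> * of_nat 1 / of_nat n :: complex)"
  have w: "w ^ n = 1" using complex_root_unity[of n 1] assms by (simp add: w_def)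
  have "w ^ k = exp (2 * of_real pi * \<i> * of_nat k / of_nat n)"
    by (simp add: w_def exp_of_nat_mult[symmetric] mult_ac)
  then have wk: "w ^ k \<noteq> 1" using complex_root_unity_eq_1[of n k] assms False by simp
  let ?R = "{z :: complex. z ^ n = 1}"
  have "w \<noteq> 0" by (simp add: w_def)
  have "(\<Sum>z\<in>?R. z ^ k) = (\<Sum>z\<in>?R. (w * z) ^ k)"
    by (rule sum.reindex_bij_witness[of _ "\<lambda>z. w * z" "\<lambda>z. z / w"])
       (use w \<open>w \<noteq> 0\<close> in \<open>auto simp: power_mult_distrib power_divide\<close>)
  also have "\<dots> = w ^ k * (\<Sum>z\<in>?R. z ^ k)"
    by (simp add: power_mult_distrib sum_distrib_left)
  finally show ?thesis using wk False by simp
qed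

text \<open>Monic polynomials prime to the modulus \<open>h\<close> are classified by their residue modulo \<open>h\<close> together with their
  degree modulo \<open>r\<close>. The classes form a finite abelian group under multiplication; it is used through
  representatives, and its characters are taken as functions on polynomials.\<close>

locale ray =
  fixes h :: "'a::{finite,field} poly" and r :: nat
  assumes h_monic: "lead_coeff h = 1" and r_pos: "0 < r"
begin

definition units :: "'a poly set" where "units = {f. lead_coeff f = 1 \<and> coprime f h}"

definition ray_class :: "'a poly \<Rightarrow> 'a poly \<times> nat" where "ray_class f = (f mod h, degree f mod r)"

lemma h_nz: "h \<noteq> 0" using h_monic by auto

lemma units_nz: "f \<in> units \<Longrightarrow> f \<noteq> 0" by (auto simp: units_def)

lemma units_1 [simp]: "1 \<in> units" by (simp add: units_def)

lemma units_mult_iff: "lead_coeff f = 1 \<Longrightarrow> lead_coeff g = 1 \<Longrightarrow> f * g \<in> units \<longleftrightarrow> f \<in> units \<and> g \<in> units"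
  by (auto simp: units_def coprime_poly_mult_iff lead_coeff_mult)

lemma units_mult: "f \<in> units \<Longrightarrow> g \<in> units \<Longrightarrow> f * g \<in> units"
  by (auto simp: units_def coprime_poly_mult_iff lead_coeff_mult)

lemma units_power: "f \<in> units \<Longrightarrow> f ^ n \<in> units"
  by (induction n) (auto intro: units_mult)

lemma units_ray_class: "ray_class f = ray_class g \<Longrightarrow> lead_coeff f = 1 \<Longrightarrow> g \<in> units \<Longrightarrow> f \<in> units"
  unfolding units_def ray_class_def using coprime_poly_mod_iff[of f h] coprime_poly_mod_iff[of g h] by auto

lemma ray_class_mult:
  assumes "ray_class f = ray_class f'" "ray_class g = ray_class g'" "f \<noteq> 0" "f' \<noteq> 0" "g \<noteq> 0" "g' \<noteq> 0"
  shows "ray_class (f * g) = ray_class (f' * g')"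
  using assms by (auto simp: ray_class_def degree_mult_eq intro: mod_mult_cong mod_add_cong)

lemma ray_class_cancel:
  assumes x: "x \<in> units" and fg: "f \<noteq> 0" "g \<noteq> 0" and eq: "ray_class (x * f) = ray_class (x * g)"
  shows "ray_class f = ray_class g"
proof -
  have x0: "x \<noteq> 0" using units_nz x by auto
  obtain u v where uv: "u * x + v * h = 1" using x coprime_poly_bezout[of x h] by (auto simp: units_def)
  have "h dvd x * f - x * g" using eq by (simp add: ray_class_def mod_eq_dvd_iff)
  then have "h dvd u * (x * f - x * g)" by (rule dvd_mult)
  then have "h dvd u * (x * f - x * g) + v * h * (f - g)" by simp
  also have "u * (x * f - x * g) + v * h * (f - g) = (u * x + v * h) * (f - g)"
    by (simp add: algebra_simps)
  finally have "f mod h = g mod h" using uv by (simp add: mod_eq_dvd_iff)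
  moreover have "(degree x + degree f) mod r = (degree x + degree g) mod r"
    using eq x0 fg by (simp add: ray_class_def degree_mult_eq)
  then have "degree f mod r = degree g mod r"
    by (metis cong_add_lcancel_nat unique_euclidean_semiring_class.cong_def)
  ultimately show ?thesis by (simp add: ray_class_def)
qed

lemma mod_in_below: "f mod h \<in> polys_below (degree h)"
proof (cases "degree h = 0")
  case True
  then have "is_unit h" using h_nz is_unit_iff_degree by blast
  then have "f mod h = 0" by (simp add: mod_eq_0_iff_dvd unit_imp_dvd)
  then show ?thesis by (simp add: polys_below_def)
next
  case False
  then show ?thesis using degree_mod_less[OF h_nz, of f] by (subst polys_below_iff) auto
qed

lemma finite_ray_classes: "finite (range ray_class)"
proof (rule finite_subset)
  show "range ray_class \<subseteq> polys_below (degree h) \<times> {..<r}"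
    using mod_in_below r_pos by (auto simp: ray_class_def)
qed (simp add: finite_polys_below)

text \<open>An exponent of the ray class group: by the pigeonhole principle some power of each class is trivial, with an
  exponent at most the number of values of \<open>ray_class\<close>, and the factorial is a multiple of all these exponents.\<close>

definition ray_exponent :: nat where "ray_exponent = fact (card (range ray_class))"

lemma ray_exponent_pos: "0 < ray_exponent" by (simp add: ray_exponent_def)

lemma ray_class_power_1: "ray_class y = ray_class 1 \<Longrightarrow> y \<in> units \<Longrightarrow> ray_class (y ^ m) = ray_class 1"
proof (induction m)
  case (Suc m)
  then have "ray_class (y * y ^ m) = ray_class (1 * 1)"
    using units_nz by (intro ray_class_mult) auto
  then show ?case by simp
qed simp

lemma ray_class_power_exponent:
  assumes x: "x \<in> units"
  shows "ray_class (x ^ ray_exponent) = ray_class 1"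
proof -
  let ?K = "card (range ray_class)"
  have "\<not> inj_on (\<lambda>i. ray_class (x ^ i)) {..?K}"
  proof
    assume "inj_on (\<lambda>i. ray_class (x ^ i)) {..?K}"
    then have "card {..?K} \<le> ?K"
      by (rule card_inj_on_le) (use finite_ray_classes in auto)
    then show False by simp
  qed
  then obtain i j where ij: "i < j" "j \<le> ?K" "ray_class (x ^ i) = ray_class (x ^ j)"
    unfolding inj_on_def by (metis atMost_iff linorder_neqE_nat)
  have "ray_class (x ^ i * 1) = ray_class (x ^ i * x ^ (j - i))"
    using ij by (simp add: power_add[symmetric])
  then have 1: "ray_class (x ^ (j - i)) = ray_class 1"
    using ray_class_cancel[OF units_power[OF x], of 1 "x ^ (j - i)" i] units_nz[OF x] by simp
  have "(j - i) dvd ray_exponent" unfolding ray_exponent_def using ij by (intro dvd_fact) auto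
  then obtain m where "ray_exponent = (j - i) * m" by (elim dvdE)
  then show ?thesis using ray_class_power_1[OF 1 units_power[OF x], of m] by (simp add: power_mult)
qed

text \<open>A polynomial of the required degree with the required residue is \<open>T\<^sup>k h + (c mod h)\<close>, where \<open>k > 0\<close> is
  chosen so that the degree \<open>k + degree h\<close> is \<open>s\<close> modulo \<open>r\<close>.\<close>

lemma ex_units:
  assumes "coprime c h"
  obtains f where "f \<in> units" and "ray_class f = (c mod h, s mod r)" and "degree h < degree f"
proof -
  define k where "k = s + r * (degree h + 1) - degree h"
  have le: "degree h + 1 \<le> r * (degree h + 1)"
    using mult_le_mono1[of 1 r "degree h + 1"] r_pos by simp
  then have k: "0 < k" "k + degree h = s + r * (degree h + 1)" by (auto simp: k_def)
  define f where "f = monom 1 k * h + c mod h"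
  have deg1: "degree (monom 1 k * h) = k + degree h"
    using h_nz by (simp add: degree_mult_eq degree_monom_eq)
  have small: "degree (c mod h) < k + degree h"
    using mod_in_below[of c] k(1) polys_below_iff[of "k + degree h" "c mod h"]
    by (auto simp: polys_below_def)
  then have deg: "degree f = k + degree h"
    unfolding f_def by (subst degree_add_eq_left) (simp_all add: deg1)
  have "coeff f (k + degree h) = lead_coeff (monom 1 k * h) + coeff (c mod h) (k + degree h)"
    by (simp add: f_def deg1)
  then have lc: "lead_coeff f = 1"
    using small h_monic deg by (simp add: lead_coeff_mult coeff_eq_0 degree_monom_eq)
  have "f mod h = c mod h" by (simp add: f_def)
  then have "coprime f h" using assms coprime_poly_mod_iff by metis
  then have "f \<in> units" using lc by (simp add: units_def)
  moreover have "degree f mod r = s mod r"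
    unfolding deg k(2) by (rule mod_mult_self2)
  then have "ray_class f = (c mod h, s mod r)"
    using \<open>f mod h = c mod h\<close> by (simp add: ray_class_def)
  ultimately show ?thesis using that[of f] deg k(1) by simp
qed

text \<open>Characters are extended by 0 to polynomials that are not monic or not prime to \<open>h\<close>. This makes a
  character determined by its values on classes, so that there are finitely many, and it makes them
  multiplicative on all monic polynomials.\<close>

definition chars :: "('a poly \<Rightarrow> complex) set" where
  "chars = {psi. (\<forall>f. f \<notin> units \<longrightarrow> psi f = 0) \<and> psi 1 = 1 \<and>
     (\<forall>f\<in>units. \<forall>g\<in>units. psi (f * g) = psi f * psi g) \<and>
     (\<forall>f\<in>units. \<forall>g\<in>units. ray_class f = ray_class g \<longrightarrow> psi f = psi g)}"

lemma character_D:
  assumes "psi \<in> chars"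
  shows "f \<notin> units \<Longrightarrow> psi f = 0" "psi 1 = 1" "f \<in> units \<Longrightarrow> g \<in> units \<Longrightarrow> psi (f * g) = psi f * psi g"
    "f \<in> units \<Longrightarrow> g \<in> units \<Longrightarrow> ray_class f = ray_class g \<Longrightarrow> psi f = psi g"
proof -
  have "(\<forall>f. f \<notin> units \<longrightarrow> psi f = 0) \<and> psi 1 = 1 \<and>
     (\<forall>f\<in>units. \<forall>g\<in>units. psi (f * g) = psi f * psi g) \<and>
     (\<forall>f\<in>units. \<forall>g\<in>units. ray_class f = ray_class g \<longrightarrow> psi f = psi g)"
    using assms unfolding chars_def by (rule CollectD)
  note * = this[THEN conjunct1] this[THEN conjunct2, THEN conjunct1]
    this[THEN conjunct2, THEN conjunct2, THEN conjunct1]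
    this[THEN conjunct2, THEN conjunct2, THEN conjunct2]
  show "f \<notin> units \<Longrightarrow> psi f = 0" using *(1) by blast
  show "psi 1 = 1" by (rule *(2))
  show "f \<in> units \<Longrightarrow> g \<in> units \<Longrightarrow> psi (f * g) = psi f * psi g" using *(3) by blast
  show "f \<in> units \<Longrightarrow> g \<in> units \<Longrightarrow> ray_class f = ray_class g \<Longrightarrow> psi f = psi g" using *(4) by blast
qed

lemma character_I:
  assumes "\<And>f. f \<notin> units \<Longrightarrow> psi f = 0" "psi 1 = 1"
    "\<And>f g. f \<in> units \<Longrightarrow> g \<in> units \<Longrightarrow> psi (f * g) = psi f * psi g"
    "\<And>f g. f \<in> units \<Longrightarrow> g \<in> units \<Longrightarrow> ray_class f = ray_class g \<Longrightarrow> psi f = psi g"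
  shows "psi \<in> chars"
  unfolding chars_def using assms by blast

lemma character_mult_monic: "psi \<in> chars \<Longrightarrow> lead_coeff f = 1 \<Longrightarrow> lead_coeff g = 1 \<Longrightarrow> psi (f * g) = psi f * psi g"
  using character_D(1)[of psi f] character_D(1)[of psi g] character_D(1)[of psi "f * g"] character_D(3)[of psi f g] units_mult_iff[of f g]
  by (cases "f \<in> units"; cases "g \<in> units") auto

lemma character_power_monic: "psi \<in> chars \<Longrightarrow> lead_coeff f = 1 \<Longrightarrow> psi (f ^ n) = psi f ^ n"
  by (induction n) (simp_all add: character_D(2) character_mult_monic lead_coeff_power)

lemma character_ray_class:
  "psi \<in> chars \<Longrightarrow> lead_coeff f = 1 \<Longrightarrow> lead_coeff g = 1 \<Longrightarrow> ray_class f = ray_class g \<Longrightarrow> psi f = psi g"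
  using character_D(1)[of psi f] character_D(1)[of psi g] character_D(4)[of psi f g] units_ray_class[of f g] units_ray_class[of g f]
  by (cases "f \<in> units"; cases "g \<in> units") auto

lemma character_power_exponent: "psi \<in> chars \<Longrightarrow> f \<in> units \<Longrightarrow> psi f ^ ray_exponent = 1"
  using character_power_monic[of psi f ray_exponent] character_D(2)[of psi] character_D(4)[of psi "f ^ ray_exponent" 1] ray_class_power_exponent[of f] units_power[of f ray_exponent]
  by (simp add: units_def)

lemma character_norm_le_1: "psi \<in> chars \<Longrightarrow> norm (psi f) \<le> 1"
proof (cases "f \<in> units")
  case True
  assume "psi \<in> chars"
  from character_power_exponent[OF this True] have "norm (psi f) = 1 \<or> ray_exponent = 0" by (rule power_eq_1_iff)
  then show ?thesis using ray_exponent_pos by simp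
qed (simp add: character_D(1))

lemma character_mult: "psi \<in> chars \<Longrightarrow> phi \<in> chars \<Longrightarrow> (\<lambda>f. psi f * phi f) \<in> chars"
proof (rule character_I)
  fix f g assume *: "psi \<in> chars" "phi \<in> chars" "f \<in> units" "g \<in> units" "ray_class f = ray_class g"
  show "psi f * phi f = psi g * phi g"
    using character_D(4)[OF *(1,3,4,5)] character_D(4)[OF *(2,3,4,5)] by simp
qed (simp_all add: character_D(1-3))

lemma character_power: "psi \<in> chars \<Longrightarrow> 0 < n \<Longrightarrow> (\<lambda>f. psi f ^ n) \<in> chars"
proof (rule character_I)
  fix f g assume *: "psi \<in> chars" "f \<in> units" "g \<in> units" "ray_class f = ray_class g"
  show "psi f ^ n = psi g ^ n"
    using character_D(4)[OF *] by simp
qed (simp_all add: character_D(1-3) power_mult_distrib)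

definition principal_character :: "'a poly \<Rightarrow> complex" where "principal_character f = (if f \<in> units then 1 else 0)"

lemma principal_character_in: "principal_character \<in> chars"
  by (rule character_I) (simp_all add: principal_character_def units_mult)

lemma finite_characters: "finite chars"
proof -
  let ?R = "insert 0 {z :: complex. z ^ ray_exponent = 1}"
  have finR: "finite ?R" using finite_roots_unity[of ray_exponent] ray_exponent_pos by simp
  let ?c = "\<lambda>F f. if f \<in> units then (F (ray_class f) :: complex) else 0"
  have "chars \<subseteq> ?c ` (range ray_class \<rightarrow>\<^sub>E ?R)"
  proof
    fix psi assume psi: "psi \<in> chars"
    define rep where "rep k = (SOME f. f \<in> units \<and> ray_class f = k)" for k
    have rep: "rep (ray_class g) \<in> units \<and> ray_class (rep (ray_class g)) = ray_class g" if "g \<in> units" for g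
      unfolding rep_def by (rule someI[of "\<lambda>f. f \<in> units \<and> ray_class f = ray_class g" g]) (simp add: that)
    define G where "G k = (if k \<in> ray_class ` units then psi (rep k) else 0)" for k
    have G: "G k \<in> ?R" for k
    proof (cases "k \<in> ray_class ` units")
      case True
      then obtain g where g: "g \<in> units" "k = ray_class g" by blast
      have "psi (rep k) ^ ray_exponent = 1" using character_power_exponent[OF psi] rep[OF g(1)] g(2) by simp
      then show ?thesis using True by (simp add: G_def)
    qed (simp add: G_def)
    have "?c (restrict G (range ray_class)) = psi"
    proof
      fix f
      show "?c (restrict G (range ray_class)) f = psi f"
      proof (cases "f \<in> units")
        case True
        have "psi (rep (ray_class f)) = psi f" using character_D(4)[OF psi, of "rep (ray_class f)" f] rep[OF True] True by simp
        then show ?thesis using True by (simp add: G_def)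
      qed (simp add: character_D(1)[OF psi])
    qed
    moreover have "restrict G (range ray_class) \<in> range ray_class \<rightarrow>\<^sub>E ?R"
      using G by (simp add: restrict_PiE_iff del: insert_iff)
    ultimately show "psi \<in> ?c ` (range ray_class \<rightarrow>\<^sub>E ?R)"
      by (intro image_eqI[OF sym])
  qed
  moreover have "finite (?c ` (range ray_class \<rightarrow>\<^sub>E ?R))"
    by (intro finite_imageI finite_PiE finite_ray_classes) (rule finR)
  ultimately show ?thesis by (rule finite_subset)
qed

text \<open>Characters are found as simultaneous eigenfunctions. Each class \<open>x\<close> acts by translation on the functions
  on the ray class group, and \<open>x\<^sup>e\<close> with \<open>e = ray_exponent\<close> acts trivially, so every function is a sum of
  eigenfunctions for the action of \<open>x\<close>, the projections \<open>proj x m\<close> with \<open>m\<^sup>e = 1\<close>. Since the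
  translations commute, projecting preserves the eigenfunction property for other classes. Starting
  from the indicator function of the trivial class, which \<open>g\<close> does not fix, one picks an eigenfunction for
  \<open>g\<close> whose eigenvalue is not 1, and then one projection for each class. The resulting common
  eigenfunction, scaled to be 1 at the identity, is a character.\<close>

lemma separation:
  assumes g: "g \<in> units" "ray_class g \<noteq> ray_class 1"
  shows "\<exists>psi\<in>chars. psi g \<noteq> 1"
proof -
  define Phi :: "('a poly \<Rightarrow> complex) set" where
    "Phi = {phi. (\<forall>f\<in>units. \<forall>f'\<in>units. ray_class f = ray_class f' \<longrightarrow> phi f = phi f') \<and> (\<exists>f\<in>units. phi f \<noteq> 0)}"
  (* Up to the factor e, the projection onto the eigenfunctions with eigenvalue m under translation by x. *)
  define proj where "proj x m phi = (\<lambda>f. \<Sum>k<ray_exponent. (1 / m) ^ k * phi (x ^ k * f))"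
    for x :: "'a poly" and m :: complex and phi :: "'a poly \<Rightarrow> complex"
  have PhiD: "phi f = phi f'"
    if "phi \<in> Phi" "f \<in> units" "f' \<in> units" "ray_class f = ray_class f'" for phi f f'
  proof -
    have "\<forall>f\<in>units. \<forall>f'\<in>units. ray_class f = ray_class f' \<longrightarrow> phi f = phi f'"
      using that(1) unfolding Phi_def mem_Collect_eq by (rule conjunct1)
    then show ?thesis using that(2-4) by blast
  qed
  have PhiI: "phi \<in> Phi"
    if "\<And>f f'. f \<in> units \<Longrightarrow> f' \<in> units \<Longrightarrow> ray_class f = ray_class f' \<Longrightarrow> phi f = phi f'" "\<exists>f\<in>units. phi f \<noteq> 0" for phi
    unfolding Phi_def mem_Collect_eq using that(1) by (intro conjI that(2) ballI impI) blast
  have inv: "phi (x * f) = phi (x * f')"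
    if "phi \<in> Phi" "x \<in> units" "f \<in> units" "f' \<in> units" "ray_class f = ray_class f'" for phi x f f'
    by (rule PhiD[OF that(1) units_mult[OF that(2,3)] units_mult[OF that(2,4)]])
       (rule ray_class_mult; use that units_nz in simp)
  have proj_inv: "proj x m phi f = proj x m phi f'"
    if "phi \<in> Phi" "x \<in> units" "f \<in> units" "f' \<in> units" "ray_class f = ray_class f'" for phi x m f f'
    unfolding proj_def using inv[OF that(1) units_power[OF that(2)] that(3-5)] by simp
  have proj_eig: "proj x m phi (x * f) = m * proj x m phi f"
    if "phi \<in> Phi" "x \<in> units" "f \<in> units" "m ^ ray_exponent = 1" for phi x m f
  proof -
    have m0: "m \<noteq> 0" using that(4) ray_exponent_pos by (auto simp: zero_power)
    let ?t = "\<lambda>k. (1 / m) ^ k * phi (x ^ k * f)"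
    have "phi (x ^ ray_exponent * f) = phi f"
    proof -
      have "phi (f * x ^ ray_exponent) = phi (f * 1)"
        by (rule inv) (use that units_power ray_class_power_exponent in auto)
      then show ?thesis by (simp add: mult.commute)
    qed
    then have te: "?t ray_exponent = ?t 0" using that(4) by (simp add: power_divide)
    have "proj x m phi (x * f) = (\<Sum>k<ray_exponent. m * ?t (Suc k))"
      unfolding proj_def by (intro sum.cong) (use m0 in \<open>simp_all add: mult_ac\<close>)
    also have "\<dots> = m * (\<Sum>k<ray_exponent. ?t (Suc k))" by (simp add: sum_distrib_left)
    also have "(\<Sum>k<ray_exponent. ?t (Suc k)) = (\<Sum>k<ray_exponent. ?t k)"
      using sum.lessThan_Suc_shift[of ?t ray_exponent] te by simp
    finally show ?thesis by (simp add: proj_def)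
  qed
  have proj_keep: "proj x m phi (y * f) = l * proj x m phi f"
    if "x \<in> units" "f \<in> units" "\<forall>f\<in>units. phi (y * f) = l * phi f" for phi x m y l f
  proof -
    have "phi (x ^ k * (y * f)) = l * phi (x ^ k * f)" for k
      using that(3) units_mult[OF units_power[OF that(1)] that(2)] by (simp add: mult.left_commute)
    then show ?thesis by (simp add: proj_def sum_distrib_left mult_ac)
  qed
  have proj_sum: "(\<Sum>m | m ^ ray_exponent = 1. proj x m phi f) = of_nat ray_exponent * phi f" for x phi f
  proof -
    have "(\<Sum>m | m ^ ray_exponent = 1. (1 / m) ^ k) = (if k = 0 then of_nat ray_exponent else 0 :: complex)" if "k < ray_exponent" for k
    proof -
      have "(\<Sum>m | m ^ ray_exponent = 1. (1 / m) ^ k) = (\<Sum>m | m ^ ray_exponent = (1::complex). m ^ k)"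
        by (rule sum.reindex_bij_witness[of _ "\<lambda>m. 1 / m" "\<lambda>m. 1 / m"]) (auto simp: power_divide)
      also have "\<dots> = (if k = 0 then of_nat ray_exponent else 0)"
        using sum_power_roots_unity[OF ray_exponent_pos, of k] that nat_dvd_not_less[of k ray_exponent] by auto
      finally show ?thesis .
    qed
    then have "(\<Sum>m | m ^ ray_exponent = 1. proj x m phi f) = (\<Sum>k<ray_exponent. (if k = 0 then of_nat ray_exponent else 0) * phi (x ^ k * f))"
      unfolding proj_def by (subst sum.swap) (simp add: sum_distrib_right[symmetric])
    also have "\<dots> = (\<Sum>k<ray_exponent. if k = 0 then of_nat ray_exponent * phi f else 0)"
      by (intro sum.cong) auto
    also have "\<dots> = of_nat ray_exponent * phi f" using ray_exponent_pos by (simp add: sum.delta)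
    finally show ?thesis .
  qed
  have step: "\<exists>m. m ^ ray_exponent = 1 \<and> (\<exists>f\<in>units. proj x m phi f \<noteq> 0)" if phi: "phi \<in> Phi" for x phi
  proof (rule ccontr)
    assume none: "\<not> ?thesis"
    obtain f where f: "f \<in> units" "phi f \<noteq> 0"
      using phi unfolding Phi_def by blast
    have "of_nat ray_exponent * phi f = 0"
      unfolding proj_sum[of x phi f, symmetric] using none f by (intro sum.neutral) auto
    then show False using f ray_exponent_pos by simp
  qed
  have start: "\<exists>phi\<in>Phi. \<exists>l. l \<noteq> 1 \<and> (\<forall>f\<in>units. phi (g * f) = l * phi f)"
  proof -
    (* If only the eigenvalue 1 occurred, d would be invariant under translation by g. *)
    define d :: "'a poly \<Rightarrow> complex" where "d f = (if ray_class f = ray_class 1 then 1 else 0)" for f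
    have d: "d \<in> Phi" by (rule PhiI) (auto simp: d_def intro!: bexI[of _ 1])
    have "\<exists>m. m ^ ray_exponent = 1 \<and> m \<noteq> 1 \<and> (\<exists>f\<in>units. proj g m d f \<noteq> 0)"
    proof (rule ccontr)
      assume none: "\<not> ?thesis"
      have "of_nat ray_exponent * d f = proj g 1 d f" if "f \<in> units" for f
      proof -
        have "of_nat ray_exponent * d f = (\<Sum>m | m ^ ray_exponent = 1. proj g m d f)" using proj_sum by simp
        also have "\<dots> = (\<Sum>m\<in>{1}. proj g m d f)"
          using none that finite_roots_unity[of ray_exponent] ray_exponent_pos by (intro sum.mono_neutral_right) auto
        finally show ?thesis by simp
      qed
      from this[of g] this[of 1] have "of_nat ray_exponent * d g = of_nat ray_exponent * d 1"
        using proj_eig[OF d g(1), of 1 1] g(1) by simp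
      then show False using ray_exponent_pos g(2) by (simp add: d_def)
    qed
    then obtain m f where m: "m ^ ray_exponent = 1" "m \<noteq> 1" "f \<in> units" "proj g m d f \<noteq> 0" by blast
    have "proj g m d \<in> Phi" by (rule PhiI) (use proj_inv[OF d g(1)] m(3,4) in blast)+
    then show ?thesis using proj_eig[OF d g(1) _ m(1)] m(2) by blast
  qed
  have joint: "\<exists>phi\<in>Phi. (\<exists>l. l \<noteq> 1 \<and> (\<forall>f\<in>units. phi (g * f) = l * phi f)) \<and>
     (\<forall>x\<in>S. \<exists>l. \<forall>f\<in>units. phi (x * f) = l * phi f)" if "finite S" "S \<subseteq> units" for S
    using that
  proof (induction S)
    case empty
    then show ?case using start by simp
  next
    case (insert x S)
    then obtain phi where phi: "phi \<in> Phi" "\<exists>l. l \<noteq> 1 \<and> (\<forall>f\<in>units. phi (g * f) = l * phi f)"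
      "\<forall>x\<in>S. \<exists>l. \<forall>f\<in>units. phi (x * f) = l * phi f" by auto
    have x: "x \<in> units" using insert by simp
    obtain m where m: "m ^ ray_exponent = 1" "\<exists>f\<in>units. proj x m phi f \<noteq> 0" using step[OF phi(1)] by blast
    let ?phi = "proj x m phi"
    have "?phi \<in> Phi" by (rule PhiI) (use proj_inv[OF phi(1) x] m(2) in blast)+
    moreover have "\<exists>l. l \<noteq> 1 \<and> (\<forall>f\<in>units. ?phi (g * f) = l * ?phi f)"
      using phi(2) proj_keep[OF x] by metis
    moreover have "\<exists>l. \<forall>f\<in>units. ?phi (y * f) = l * ?phi f" if y: "y \<in> insert x S" for y
    proof (cases "y = x")
      case True
      then show ?thesis using proj_eig[OF phi(1) x _ m(1)] by blast
    next
      case False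
      then show ?thesis using y phi(3) proj_keep[OF x] by (metis insertE)
    qed
    ultimately show ?case by blast
  qed
  (* Translation by x depends only on the class of x, so finitely many projections suffice. *)
  define rep where "rep k = (SOME f. f \<in> units \<and> ray_class f = k)" for k
  have rep: "rep (ray_class f) \<in> units \<and> ray_class (rep (ray_class f)) = ray_class f" if "f \<in> units" for f
    unfolding rep_def using someI[of "\<lambda>f'. f' \<in> units \<and> ray_class f' = ray_class f" f] that by blast
  have "finite (rep ` ray_class ` units)" by (intro finite_imageI finite_subset[OF _ finite_ray_classes]) auto
  moreover have "rep ` ray_class ` units \<subseteq> units" using rep by auto
  ultimately have "\<exists>phi\<in>Phi. (\<exists>l. l \<noteq> 1 \<and> (\<forall>f\<in>units. phi (g * f) = l * phi f)) \<and>
     (\<forall>x\<in>rep ` ray_class ` units. \<exists>l. \<forall>f\<in>units. phi (x * f) = l * phi f)" by (rule joint)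
  then obtain phi l where phi: "phi \<in> Phi" and l: "l \<noteq> 1" "\<forall>f\<in>units. phi (g * f) = l * phi f"
    and S: "\<forall>x\<in>rep ` ray_class ` units. \<exists>l. \<forall>f\<in>units. phi (x * f) = l * phi f"
    by (elim bexE conjE exE) (rule that)
  have eig: "\<exists>l. \<forall>f\<in>units. phi (x * f) = l * phi f" if x: "x \<in> units" for x
  proof -
    have "rep (ray_class x) \<in> rep ` ray_class ` units" using x by simp
    from bspec[OF S this] obtain l where l: "\<forall>f\<in>units. phi (rep (ray_class x) * f) = l * phi f" ..
    have "phi (x * f) = l * phi f" if f: "f \<in> units" for f
    proof -
      have "phi (f * x) = phi (f * rep (ray_class x))"
        by (rule inv[OF phi f x]) (use rep[OF x] in simp_all)
      then show ?thesis using bspec[OF l f] by (simp add: mult.commute)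
    qed
    then show ?thesis by blast
  qed
  have phi1: "phi 1 \<noteq> 0"
  proof
    assume "phi 1 = 0"
    have "phi f = 0" if f: "f \<in> units" for f
    proof -
      obtain l where l: "\<forall>g\<in>units. phi (f * g) = l * phi g" using eig[OF f] ..
      from bspec[OF l units_1] \<open>phi 1 = 0\<close> show ?thesis by simp
    qed
    moreover have "\<exists>f\<in>units. phi f \<noteq> 0"
      using phi unfolding Phi_def mem_Collect_eq by (rule conjunct2)
    ultimately show False by blast
  qed
  define psi where "psi f = (if f \<in> units then phi f / phi 1 else 0)" for f
  have mult: "phi (x * f) * phi 1 = phi x * phi f" if "x \<in> units" "f \<in> units" for x f
  proof -
    obtain l where l: "\<forall>f\<in>units. phi (x * f) = l * phi f" using eig[OF \<open>x \<in> units\<close>] ..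
    have "phi x = l * phi 1" using bspec[OF l units_1] by simp
    then show ?thesis using l that(2) by simp
  qed
  have "psi \<in> chars"
  proof (rule character_I)
    fix f g assume "f \<in> units" "g \<in> units"
    then show "psi (f * g) = psi f * psi g"
      using mult[of f g] phi1 units_mult[of f g] by (simp add: psi_def field_simps)
  next
    fix f g assume "f \<in> units" "g \<in> units" "ray_class f = ray_class g"
    moreover have "\<forall>f\<in>units. \<forall>f'\<in>units. ray_class f = ray_class f' \<longrightarrow> phi f = phi f'"
      using phi unfolding Phi_def mem_Collect_eq by (rule conjunct1)
    ultimately have "phi f = phi g" by blast
    then show "psi f = psi g" using \<open>f \<in> units\<close> \<open>g \<in> units\<close> by (simp add: psi_def)
  qed (use phi1 in \<open>auto simp: psi_def\<close>)
  moreover have "phi g = l * phi 1" using bspec[OF l(2) units_1] by simp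
  then have "psi g \<noteq> 1" using l(1) phi1 g(1) by (simp add: psi_def)
  ultimately show ?thesis by blast
qed

text \<open>If \<open>f\<close> is not in the trivial class, multiplication by a character \<open>phi\<close> with \<open>phi f \<noteq> 1\<close> permutes
  the characters.\<close>

lemma orthogonality:
  assumes "f \<in> units"
  shows "(\<Sum>psi\<in>chars. psi f) = (if ray_class f = ray_class 1 then of_nat (card chars) else 0)"
proof (cases "ray_class f = ray_class 1")
  case True
  then have "psi f = 1" if "psi \<in> chars" for psi
    using character_D(2)[OF that] character_D(4)[OF that assms units_1] True by simp
  then have "(\<Sum>psi\<in>chars. psi f) = (\<Sum>psi\<in>chars. 1)" by (intro sum.cong) auto
  then show ?thesis using True by simp
next
  case False
  then obtain phi where phi: "phi \<in> chars" "phi f \<noteq> 1" using separation assms by blast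
  have "(\<Sum>psi\<in>chars. psi f) = (\<Sum>psi\<in>chars. phi f * psi f)"
  (* The inverse character is a power of phi; the exponent 2e - 1 is positive even for e = 1,
     so that this power still vanishes outside the domain. *)
  proof (rule sum.reindex_bij_witness[of _ "\<lambda>psi f. phi f * psi f" "\<lambda>psi f. phi f ^ (ray_exponent * 2 - 1) * psi f"])
    have pw: "phi f * phi f ^ (ray_exponent * 2 - 1) = (if f \<in> units then 1 else 0)" for f
    proof (cases "f \<in> units")
      case True
      have "phi f * phi f ^ (ray_exponent * 2 - 1) = phi f ^ (ray_exponent * 2)"
        using ray_exponent_pos by (metis mult_pos_pos pos2 power_minus_mult mult.commute)
      then show ?thesis using character_power_exponent[OF phi(1) True] True by (simp add: power_mult)
    qed (simp add: character_D(1)[OF phi(1)])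
    have e2: "0 < ray_exponent * 2 - 1" using ray_exponent_pos by simp
    fix psi assume psi: "psi \<in> chars"
    show "(\<lambda>f. phi f ^ (ray_exponent * 2 - 1) * psi f) \<in> chars" by (intro character_mult character_power phi psi e2)
    show "(\<lambda>f. phi f * psi f) \<in> chars" by (intro character_mult phi psi)
    show *: "(\<lambda>f. phi f * (phi f ^ (ray_exponent * 2 - 1) * psi f)) = psi"
      by (rule ext) (use pw character_D(1)[OF psi] in \<open>simp add: mult.assoc[symmetric]\<close>)
    show "(\<lambda>f. phi f ^ (ray_exponent * 2 - 1) * (phi f * psi f)) = psi"
      using * by (simp add: mult.left_commute)
    show "phi f * (phi f ^ (ray_exponent * 2 - 1) * psi f) = psi f"
      using * by (rule fun_cong)
  qed
  also have "\<dots> = phi f * (\<Sum>psi\<in>chars. psi f)" by (simp add: sum_distrib_left)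
  finally show ?thesis using phi(2) False by simp
qed

text \<open>Since \<open>g\<close> to the group exponent is trivial, \<open>g ^ (ray_exponent - 1)\<close> represents the inverse of the class
  of \<open>g\<close>. So the left side detects the class of \<open>g\<close>, without complex conjugates.\<close>

lemma orthogonality_class:
  assumes "g \<in> units" "f \<in> units"
  shows "(\<Sum>psi\<in>chars. psi (g ^ (ray_exponent - 1)) * psi f) = (if ray_class f = ray_class g then of_nat (card chars) else 0)"
proof -
  have "(\<Sum>psi\<in>chars. psi (g ^ (ray_exponent - 1)) * psi f) = (\<Sum>psi\<in>chars. psi (g ^ (ray_exponent - 1) * f))"
    by (intro sum.cong) (use assms units_power character_D(3) in auto)
  also have "\<dots> = (if ray_class (g ^ (ray_exponent - 1) * f) = ray_class 1 then of_nat (card chars) else 0)"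
    by (rule orthogonality) (use assms units_power units_mult in auto)
  also have "ray_class (g ^ (ray_exponent - 1) * f) = ray_class 1 \<longleftrightarrow> ray_class f = ray_class g"
  proof -
    have ge: "g ^ (ray_exponent - 1) * g = g ^ ray_exponent" using ray_exponent_pos by (metis power_minus_mult)
    have "ray_class (g ^ (ray_exponent - 1) * g) = ray_class 1" unfolding ge using ray_class_power_exponent assms by simp
    then show ?thesis
      using ray_class_cancel[OF units_power[OF assms(1)], of f g "ray_exponent - 1"] units_nz assms
        ray_class_mult[of "g ^ (ray_exponent - 1)" "g ^ (ray_exponent - 1)" f g] by auto
  qed
  finally show ?thesis .
qed

end

section \<open>Unique factorisation and logarithmic derivatives\<close>

lemma monic_irreducible_factor:
  fixes f :: "'a::field poly"
  assumes "0 < degree f"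
  shows "\<exists>Q. lead_coeff Q = 1 \<and> irreducible Q \<and> Q dvd f"
proof -
  define D where "D = {g. g dvd f \<and> 0 < degree g}"
  have "f \<in> D" using assms by (simp add: D_def)
  then obtain g where g: "g \<in> D" "\<And>g'. g' \<in> D \<Longrightarrow> degree g \<le> degree g'"
    using ex_has_least_nat[of "\<lambda>g. g \<in> D" f degree] by blast
  then have g0: "g \<noteq> 0" "0 < degree g" "g dvd f" by (auto simp: D_def)
  define Q where "Q = smult (inverse (lead_coeff g)) g"
  have Q: "lead_coeff Q = 1" "degree Q = degree g" "Q \<noteq> 0" "Q dvd f"
    using g0 by (simp_all add: Q_def smult_dvd_iff)
  have "irreducible Q"
  proof (rule irreducibleI)
    show "\<not> is_unit Q" using Q g0 is_unit_iff_degree[of Q] by auto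
    fix a b assume ab: "Q = a * b"
    then have nz: "a \<noteq> 0" "b \<noteq> 0" using Q(3) by auto
    show "is_unit a \<or> is_unit b"
    proof (rule disjCI)
      assume "\<not> is_unit b"
      then have "0 < degree b" using nz is_unit_iff_degree[of b] by auto
      moreover have "b dvd f" using ab Q(4) by (metis dvd_mult_right)
      ultimately have "degree g \<le> degree b" using g(2) by (simp add: D_def)
      then have "degree a = 0" using ab nz Q(2) by (simp add: degree_mult_eq)
      then show "is_unit a" using nz is_unit_iff_degree[of a] by auto
    qed
  qed (rule Q(3))
  with Q show ?thesis by blast
qed

lemma monic_irreducible_dvd_imp_eq:
  fixes P Q :: "'a::field poly"
  assumes "lead_coeff P = 1" "lead_coeff Q = 1" "irreducible P" "irreducible Q" "P dvd Q"
  shows "P = Q"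
proof -
  obtain c where c: "Q = P * c" using assms(5) by (elim dvdE)
  then have "is_unit c" using assms(3,4) irreducibleD[of Q P c] by (auto simp: irreducible_def)
  then have "degree c = 0" by (metis is_unit_iff_degree not_is_unit_0)
  then obtain k where "c = [:k:]" by (rule degree_eq_zeroE)
  with c have Q: "Q = smult k P" by simp
  then have "k = 1" using assms(1,2) by (cases "k = 0") auto
  then show ?thesis using Q by simp
qed

lemma prime_elem_power_dvd_cancel:
  assumes "prime_elem P" "\<not> P dvd Q" "P ^ j dvd Q * (g :: 'a::idom)"
  shows "P ^ j dvd g"
  using assms(3)
proof (induction j arbitrary: g)
  case (Suc j)
  have "P dvd Q * g" using Suc.prems by (metis dvd_mult_left power_Suc)
  then obtain k where k: "g = P * k" using assms(1,2) by (metis dvdE prime_elem_dvd_mult_iff)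
  then have "P * P ^ j dvd P * (Q * k)" using Suc.prems by (simp add: mult.left_commute)
  then have "P ^ j dvd Q * k" using assms(1) by (simp add: prime_elem_def)
  then have "P ^ j dvd k" by (rule Suc.IH)
  then show ?case unfolding k power_Suc by (rule mult_dvd_mono[OF dvd_refl])
qed simp

definition monics :: "nat \<Rightarrow> 'a::{finite,field} poly set" where
  "monics n = {f. lead_coeff f = 1 \<and> degree f = n}"

text \<open>Pairs are used instead of the powers themselves, so that the base \<open>P\<close>, whose degree is the weight in the
  von Mangoldt function, is at hand.\<close>

definition prime_powers :: "nat \<Rightarrow> ('a::{finite,field} poly \<times> nat) set" where
  "prime_powers n = {(P, j). lead_coeff P = 1 \<and> irreducible P \<and> 0 < j \<and> j * degree P = n}"

definition prime_power_divisors :: "'a::{finite,field} poly \<Rightarrow> ('a poly \<times> nat) set" where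
  "prime_power_divisors f = {(P, j). lead_coeff P = 1 \<and> irreducible P \<and> 0 < j \<and> P ^ j dvd f}"

lemma monics_eq: "monics n = (\<lambda>g. monom 1 n + g) ` polys_below n"
proof (intro equalityI subsetI)
  fix f :: "'a poly" assume f: "f \<in> monics n"
  have "f - monom 1 n \<in> polys_below n"
    unfolding polys_below_def
  proof (intro CollectI allI impI)
    fix i assume "n \<le> i"
    then show "coeff (f - monom 1 n) i = 0"
      using f coeff_eq_0[of f i] by (cases "i = n") (auto simp: monics_def)
  qed
  then show "f \<in> (\<lambda>g. monom 1 n + g) ` polys_below n" by (intro image_eqI[of _ _ "f - monom 1 n"]) auto
next
  fix f :: "'a poly" assume "f \<in> (\<lambda>g. monom 1 n + g) ` polys_below n"
  then have c: "coeff f n = 1" "\<forall>i>n. coeff f i = 0" by (auto simp: polys_below_def)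
  have "degree f = n"
    by (intro antisym degree_le le_degree) (use c in auto)
  then show "f \<in> monics n" using c by (simp add: monics_def)
qed

lemma finite_monics: "finite (monics n)"
  unfolding monics_eq by (intro finite_imageI finite_polys_below)

lemma card_monics: "card (monics n :: 'a::{finite,field} poly set) = CARD('a) ^ n"
  unfolding monics_eq by (subst card_image) (auto simp: inj_on_def card_polys_below)

lemma prime_powers_bound:
  assumes "(P, j) \<in> prime_powers n"
  shows "j \<le> n" "P \<in> polys_below (Suc (n div j))" "degree P \<le> n" "0 < n"
proof -
  have P: "0 < degree P" "0 < j" "j * degree P = n"
    using assms irreducible_poly_degree by (auto simp: prime_powers_def)
  then show "j \<le> n" by auto
  show "degree P \<le> n" using P by auto
  have "degree P = n div j" using P by auto
  then show "P \<in> polys_below (Suc (n div j))" by (subst polys_below_iff) auto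
  show "0 < n" using P by auto
qed

lemma finite_prime_powers: "finite (prime_powers n :: ('a::{finite,field} poly \<times> nat) set)"
proof (rule finite_subset)
  show "(prime_powers n :: ('a poly \<times> nat) set) \<subseteq> polys_below (Suc n) \<times> {..n}"
  proof (rule subrelI)
    fix P :: "'a poly" and j assume "(P, j) \<in> prime_powers n"
    from prime_powers_bound[OF this] show "(P, j) \<in> polys_below (Suc n) \<times> {..n}"
      by (auto simp: polys_below_iff)
  qed
qed (simp add: finite_polys_below)

lemma prime_power_divisors_1: "prime_power_divisors 1 = {}"
proof -
  have "\<not> P ^ j dvd 1" if "irreducible P" "0 < j" for P :: "'a poly" and j
    using that by (metis dvd_power dvd_trans irreducible_def)
  then show ?thesis by (auto simp: prime_power_divisors_def)
qed

lemma finite_prime_power_divisors: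
  assumes "f \<noteq> 0"
  shows "finite (prime_power_divisors f)"
proof (rule finite_subset)
  show "prime_power_divisors f \<subseteq> polys_below (Suc (degree f)) \<times> {..degree f}"
  proof (rule subrelI)
    fix P :: "'a poly" and j assume "(P, j) \<in> prime_power_divisors f"
    then have P: "irreducible P" "0 < j" "P ^ j dvd f" by (auto simp: prime_power_divisors_def)
    have "P \<noteq> 0" using P(1) by auto
    then have "j * degree P \<le> degree f"
      using dvd_imp_degree_le[OF P(3) assms] by (simp add: degree_power_eq)
    moreover have "j \<le> j * degree P" "degree P \<le> j * degree P"
      using irreducible_poly_degree[OF P(1)] P(2) by auto
    ultimately have "degree P \<le> degree f" "j \<le> degree f" by linarith+
    then show "(P, j) \<in> polys_below (Suc (degree f)) \<times> {..degree f}"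
      by (simp add: polys_below_iff)
  qed
qed (simp add: finite_polys_below)

text \<open>The polynomial analogue of \<open>log n = \<Sum>d | n. \<Lambda>(d)\<close>, which is all that is needed of unique
  factorisation. Splitting off an irreducible factor \<open>Q\<close> shifts the powers of \<open>Q\<close> by one and adds \<open>Q\<close>
  itself.\<close>

lemma degree_eq_sum_prime_power_divisors:
  "lead_coeff f = 1 \<Longrightarrow> degree f = (\<Sum>(P, j)\<in>prime_power_divisors f. degree P)"
proof (induction "degree f" arbitrary: f rule: less_induct)
  case less
  show ?case
  proof (cases "degree f = 0")
    case True
    then obtain k where "f = [:k:]" by (rule degree_eq_zeroE)
    then have "f = 1" using less.prems by (simp add: one_pCons)
    then show ?thesis by (simp add: prime_power_divisors_1)
  next
    case False
    then obtain Q where Q: "lead_coeff Q = 1" "irreducible Q" "Q dvd f"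
      using monic_irreducible_factor[of f] by auto
    then obtain g where g: "f = Q * g" by (elim dvdE)
    have lg: "lead_coeff g = 1" using less.prems Q(1) g by (simp add: lead_coeff_mult)
    then have nz: "g \<noteq> 0" "Q \<noteq> 0" using Q(1) by auto
    have degf: "degree f = degree Q + degree g" using g nz by (simp add: degree_mult_eq)
    have IH: "degree g = (\<Sum>(P, j)\<in>prime_power_divisors g. degree P)"
      by (rule less.hyps) (use degf irreducible_poly_degree[OF Q(2)] lg in auto)
    have Qprime: "prime_elem Q" using Q(2) by (rule irreducible_poly_imp_prime_elem)
    (* Powers of Q that divide f are Q itself and Q times those that divide g. *)
    define sh where "sh = (\<lambda>(P, j). if P = Q then (P, Suc j) else (P, j))"
    have "prime_power_divisors f = insert (Q, 1) (sh ` prime_power_divisors g)"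
    proof (intro equalityI subsetI)
      fix x assume x: "x \<in> prime_power_divisors f"
      obtain P j where Pj: "x = (P, j)" by (cases x)
      then have P: "lead_coeff P = 1" "irreducible P" "0 < j" "P ^ j dvd Q * g"
        using x g by (auto simp: prime_power_divisors_def)
      show "x \<in> insert (Q, 1) (sh ` prime_power_divisors g)"
      proof (cases "P = Q")
        case True
        obtain i where i: "j = Suc i" using P(3) gr0_implies_Suc by blast
        then have "Q ^ i dvd g" using P(4) True nz by simp
        then show ?thesis
          using True i P Pj by (cases "i = 0") (auto simp: sh_def prime_power_divisors_def image_iff split: if_splits)
      next
        case False
        then have "\<not> P dvd Q" using monic_irreducible_dvd_imp_eq P Q by blast
        then have "P ^ j dvd g"
          using prime_elem_power_dvd_cancel[OF irreducible_poly_imp_prime_elem[OF P(2)] _ P(4)] by simp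
        then have "(P, j) \<in> prime_power_divisors g" using P by (simp add: prime_power_divisors_def)
        then have "sh (P, j) \<in> sh ` prime_power_divisors g" by (rule imageI)
        then show ?thesis using False Pj by (simp add: sh_def)
      qed
    next
      fix x assume "x \<in> insert (Q, 1) (sh ` prime_power_divisors g)"
      then consider "x = (Q, 1)" | P j where "(P, j) \<in> prime_power_divisors g" "x = sh (P, j)"
        by auto
      then show "x \<in> prime_power_divisors f"
        by cases (use g Q in \<open>auto simp: prime_power_divisors_def sh_def mult_dvd_mono split: if_splits\<close>)
    qed
    moreover have "(Q, 1) \<notin> sh ` prime_power_divisors g"
      by (auto simp: sh_def prime_power_divisors_def split: if_splits)
    moreover have "inj_on sh (prime_power_divisors g)"
      by (auto simp: inj_on_def sh_def split: if_splits)
    ultimately have "(\<Sum>(P, j)\<in>prime_power_divisors f. degree P)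
        = degree Q + (\<Sum>x\<in>prime_power_divisors g. degree (fst (sh x)))"
      using finite_prime_power_divisors[OF nz(1)]
      by (simp add: sum.reindex case_prod_unfold)
    also have "(\<Sum>x\<in>prime_power_divisors g. degree (fst (sh x))) = degree g"
      unfolding IH by (intro sum.cong) (auto simp: sh_def)
    finally show ?thesis using degf by simp
  qed
qed

lemma fps_log_deriv_prod:
  fixes A B :: "'b \<Rightarrow> 'c::field fps"
  assumes "finite S" "\<And>i. i \<in> S \<Longrightarrow> fps_X * fps_deriv (A i) = A i * B i"
  shows "fps_X * fps_deriv (\<Prod>i\<in>S. A i) = (\<Prod>i\<in>S. A i) * (\<Sum>i\<in>S. B i)"
  using assms
proof (induction S)
  case (insert x S)
  have "fps_X * fps_deriv (A x * prod A S) = (fps_X * fps_deriv (A x)) * prod A S + A x * (fps_X * fps_deriv (prod A S))"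
    by (simp add: algebra_simps)
  then show ?case using insert by (simp add: algebra_simps)
qed simp

context ray begin

lemma poly_add_below:
  assumes "g \<noteq> 0" "p \<in> polys_below (degree h)"
  shows "degree (g * h + p) = degree g + degree h" "lead_coeff (g * h + p) = lead_coeff g"
proof -
  have dgh: "degree (g * h) = degree g + degree h" using assms(1) h_nz by (simp add: degree_mult_eq)
  have c: "coeff (g * h + p) i = coeff (g * h) i" if "degree h \<le> i" for i
    using assms(2) that by (simp add: polys_below_def)
  have "coeff (g * h) (degree g + degree h) = lead_coeff g"
    using h_monic by (simp add: coeff_mult_degree_sum)
  then have lc: "coeff (g * h + p) (degree g + degree h) = lead_coeff g" using c by simp
  show deg: "degree (g * h + p) = degree g + degree h"
  proof (rule antisym)
    show "degree (g * h + p) \<le> degree g + degree h"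
      by (rule degree_le) (use c dgh in \<open>auto intro: coeff_eq_0\<close>)
    show "degree g + degree h \<le> degree (g * h + p)"
      by (rule le_degree) (use lc assms(1) in simp)
  qed
  show "lead_coeff (g * h + p) = lead_coeff g" using lc deg by simp
qed

lemma mod_below: "p \<in> polys_below (degree h) \<Longrightarrow> p mod h = p"
proof (cases "degree h = 0")
  case False
  assume "p \<in> polys_below (degree h)"
  then show ?thesis using False by (simp add: polys_below_iff mod_poly_less)
qed (simp add: polys_below_0)

lemma sum_monics:
  assumes "degree h \<le> n"
  shows "(\<Sum>f\<in>monics n. F f) = (\<Sum>p\<in>polys_below (degree h). \<Sum>m\<in>monics (n - degree h). F (m * h + p))"
proof -
  have "(\<Sum>f\<in>monics n. F f) = (\<Sum>x\<in>polys_below (degree h) \<times> monics (n - degree h). F (snd x * h + fst x))"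
  proof (rule sum.reindex_bij_witness[of _ "\<lambda>x. snd x * h + fst x" "\<lambda>f. (f mod h, f div h)"])
    fix f :: "'a poly" assume f: "f \<in> monics n"
    have eq: "f = f div h * h + f mod h" by simp
    have "f div h \<noteq> 0"
    proof
      assume "f div h = 0"
      then have "f \<in> polys_below (degree h)" using eq mod_in_below[of f] by simp
      then have "lead_coeff f = 0" using f assms by (simp add: polys_below_def monics_def)
      then show False using f by (auto simp: monics_def)
    qed
    from poly_add_below[OF this mod_in_below[of f]]
    have "degree f = degree (f div h) + degree h" "lead_coeff f = lead_coeff (f div h)"
      unfolding eq[symmetric] by blast+
    with f show "(f mod h, f div h) \<in> polys_below (degree h) \<times> monics (n - degree h)"
      using mod_in_below[of f] by (auto simp: monics_def)
  next
    fix x :: "'a poly \<times> 'a poly" assume x: "x \<in> polys_below (degree h) \<times> monics (n - degree h)"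
    then have nz: "snd x \<noteq> 0" and below: "fst x \<in> polys_below (degree h)" by (auto simp: monics_def)
    show "snd x * h + fst x \<in> monics n"
      using poly_add_below[OF nz below] x assms by (auto simp: monics_def)
    have m: "(snd x * h + fst x) mod h = fst x" using mod_below[OF below] by simp
    then have "(snd x * h + fst x) div h * h = snd x * h"
      using div_mult_mod_eq[of "snd x * h + fst x" h] by (metis add_right_cancel)
    then have "(snd x * h + fst x) div h = snd x" using h_nz by simp
    with m show "((snd x * h + fst x) mod h, (snd x * h + fst x) div h) = x" by simp
  qed simp_all
  then show ?thesis by (simp add: sum.cartesian_product case_prod_unfold)
qed

text \<open>The L-series of \<open>psi\<close> is the power series with these coefficients, in the variable \<open>u = q\<^sup>-\<^sup>s\<close>.\<close>

definition L_coeff :: "('a poly \<Rightarrow> complex) \<Rightarrow> nat \<Rightarrow> complex" where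
  "L_coeff psi n = (\<Sum>f\<in>monics n. psi f)"

text \<open>The coefficients of \<open>u L'(u) / L(u)\<close>, by \<open>L_coeff_recursion\<close>.\<close>

definition log_coeff :: "('a poly \<Rightarrow> complex) \<Rightarrow> nat \<Rightarrow> complex" where
  "log_coeff psi n = (\<Sum>(P, j)\<in>prime_powers n. of_nat (degree P) * psi P ^ j)"

lemma L_coeff_0: "psi \<in> chars \<Longrightarrow> L_coeff psi 0 = 1"
  by (simp add: L_coeff_def monics_eq polys_below_0 character_D(2))

text \<open>This is \<open>u L' = L (u L'/L)\<close>, compared coefficientwise: by \<open>degree_eq_sum_prime_power_divisors\<close> the left
  side counts pairs of \<open>f\<close> and a prime power \<open>P\<^sup>j\<close> that divides \<open>f\<close>, and \<open>f\<close> is then replaced by \<open>P\<^sup>j\<close> and the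
  cofactor \<open>k\<close>. In this form no Euler product is needed.\<close>

lemma L_coeff_recursion:
  assumes psi: "psi \<in> chars"
  shows "of_nat n * L_coeff psi n = (\<Sum>i\<le>n. log_coeff psi i * L_coeff psi (n - i))"
proof -
  have "of_nat n * L_coeff psi n = (\<Sum>f\<in>monics n. of_nat (degree f) * psi f)"
    by (simp add: L_coeff_def sum_distrib_left monics_def)
  also have "\<dots> = (\<Sum>f\<in>monics n. \<Sum>(P, j)\<in>prime_power_divisors f. of_nat (degree P) * psi f)"
  proof (rule sum.cong)
    fix f :: "'a poly" assume "f \<in> monics n"
    then have "lead_coeff f = 1" by (auto simp: monics_def)
    then have "degree f = (\<Sum>(P, j)\<in>prime_power_divisors f. degree P)"
      by (rule degree_eq_sum_prime_power_divisors)
    then have "(of_nat (degree f) :: complex) = of_nat (\<Sum>(P, j)\<in>prime_power_divisors f. degree P)"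
      by (rule arg_cong)
    then show "of_nat (degree f) * psi f = (\<Sum>(P, j)\<in>prime_power_divisors f. of_nat (degree P) * psi f)"
      by (simp add: sum_distrib_right case_prod_unfold)
  qed simp
  also have "\<dots> = (\<Sum>(f, P, j)\<in>Sigma (monics n) prime_power_divisors. of_nat (degree P) * psi f)"
  proof -
    have "\<forall>f\<in>monics n. finite (prime_power_divisors f :: ('a poly \<times> nat) set)"
      by (auto simp: monics_def intro!: finite_prime_power_divisors)
    then show ?thesis by (subst sum.Sigma) (simp_all add: finite_monics case_prod_unfold)
  qed
  also have "\<dots> = (\<Sum>(i, (P, j), k)\<in>Sigma {..n} (\<lambda>i. prime_powers i \<times> monics (n - i)).
      of_nat (degree P) * psi P ^ j * psi k)"
  proof -
    define A where "A = Sigma (monics n) (prime_power_divisors :: 'a poly \<Rightarrow> _)"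
    define B where "B = Sigma {..n} (\<lambda>i. (prime_powers i :: ('a poly \<times> nat) set) \<times> (monics (n - i) :: 'a poly set))"
    define to where "to = (\<lambda>(f :: 'a poly, P, j). (j * degree P, (P, j), f div P ^ j))"
    define fro where "fro = (\<lambda>(i :: nat, (P, j), k). (P ^ j * k :: 'a poly, P, j))"
    have 1: "fro (to (f, P, j)) = (f, P, j) \<and> to (f, P, j) \<in> B \<and>
        of_nat (degree P) * psi P ^ j * psi (f div P ^ j) = of_nat (degree P) * psi f"
      if x: "(f, P, j) \<in> A" for f P j
    proof -
      have P: "lead_coeff P = 1" "irreducible P" "0 < j" "P ^ j dvd f" "lead_coeff f = 1" "degree f = n"
        using x by (auto simp: A_def prime_power_divisors_def monics_def)
      obtain k where k: "f = P ^ j * k" using P(4) by (elim dvdE)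
      have nz: "P \<noteq> 0" "P ^ j \<noteq> 0" using P by auto
      have fk: "f div P ^ j = k" using k nz by simp
      have lk: "lead_coeff k = 1" using P(1,5) k by (simp add: lead_coeff_mult lead_coeff_power)
      then have k0: "k \<noteq> 0" by auto
      have deg: "n = j * degree P + degree k" using P(6) k nz k0 by (simp add: degree_mult_eq degree_power_eq)
      have "psi f = psi P ^ j * psi k"
        using k character_mult_monic[OF psi, of "P ^ j" k] character_power_monic[OF psi P(1)] P(1) lk by (simp add: lead_coeff_power)
      moreover have "to (f, P, j) \<in> B"
        using fk P deg lk by (auto simp: to_def B_def prime_powers_def monics_def)
      moreover have "fro (to (f, P, j)) = (f, P, j)"
        using fk k by (simp add: to_def fro_def)
      ultimately show ?thesis using fk by simp
    qed
    have 2: "to (fro (i, (P, j), k)) = (i, (P, j), k) \<and> fro (i, (P, j), k) \<in> A"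
      if x: "(i, (P, j), k) \<in> B" for i P j k
    proof -
      have P: "lead_coeff P = 1" "irreducible P" "0 < j" "j * degree P = i" "lead_coeff k = 1"
        "degree k = n - i" "i \<le> n" using x by (auto simp: B_def prime_powers_def monics_def)
      then have nz: "P \<noteq> 0" "k \<noteq> 0" by auto
      have "lead_coeff (P ^ j * k) = 1"
        unfolding lead_coeff_mult lead_coeff_power P(1,5) by simp
      moreover have "degree (P ^ j * k) = n"
        using P nz by (simp add: degree_mult_eq degree_power_eq)
      ultimately have "P ^ j * k \<in> monics n"
        unfolding monics_def by blast
      then have "fro (i, (P, j), k) \<in> A"
        using P by (auto simp: A_def fro_def prime_power_divisors_def)
      then show ?thesis using P(4) nz by (simp add: to_def fro_def)
    qed
    have "(\<Sum>x\<in>A. case x of (f, P, j) \<Rightarrow> of_nat (degree P) * psi f)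
        = (\<Sum>y\<in>B. case y of (i, (P, j), k) \<Rightarrow> of_nat (degree P) * psi P ^ j * psi k)"
    proof (rule sum.reindex_bij_witness[of A fro to B])
      fix x assume x: "x \<in> A"
      obtain f P j where fPj: "x = (f, P, j)" by (cases x)
      from 1[of f P j] x fPj
      show "fro (to x) = x" "to x \<in> B"
        "(case to x of (i, (P, j), k) \<Rightarrow> of_nat (degree P) * psi P ^ j * psi k)
          = (case x of (f, P, j) \<Rightarrow> of_nat (degree P) * psi f)"
        by (simp_all add: to_def)
    next
      fix y assume y: "y \<in> B"
      obtain i P j k where "y = (i, (P, j), k)" by (metis surj_pair)
      with 2[of i P j k] y show "to (fro y) = y" "fro y \<in> A" by simp_all
    qed
    then show ?thesis unfolding A_def B_def by (simp add: case_prod_unfold)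
  qed
  also have "\<dots> = (\<Sum>i\<le>n. \<Sum>((P, j), k)\<in>prime_powers i \<times> monics (n - i).
      of_nat (degree P) * psi P ^ j * psi k)"
    by (subst sum.Sigma) (simp_all add: finite_monics finite_prime_powers case_prod_unfold)
  also have "\<dots> = (\<Sum>i\<le>n. log_coeff psi i * L_coeff psi (n - i))"
    by (intro sum.cong refl) (simp add: log_coeff_def L_coeff_def sum_product sum.cartesian_product case_prod_unfold)
  finally show ?thesis .
qed

end

section \<open>The L-series of a character is rational\<close>

context ray begin

lemma q_gt_1: "1 < CARD('a)"
  using card_mono[of UNIV "{0, 1 :: 'a}"] by simp

text \<open>The monic polynomials of degree \<open>n\<close> are the \<open>m h + p\<close> with \<open>m\<close> monic and \<open>p\<close> a residue. For fixed
  \<open>p\<close> all of them have the same class, that of \<open>rep n p\<close>.\<close>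

definition rep :: "nat \<Rightarrow> 'a poly \<Rightarrow> 'a poly" where
  "rep n p = monom 1 (n - degree h) * h + p"

lemma rep:
  assumes "degree h \<le> n" "p \<in> polys_below (degree h)"
  shows "lead_coeff (rep n p) = 1" "degree (rep n p) = n" "rep n p mod h = p"
proof -
  have "monom 1 (n - degree h) \<noteq> (0 :: 'a poly)" by simp
  from poly_add_below[OF this assms(2)] assms(1)
  show "lead_coeff (rep n p) = 1" "degree (rep n p) = n"
    unfolding rep_def by (simp_all add: degree_monom_eq)
  show "rep n p mod h = p" using mod_below[OF assms(2)] by (simp add: rep_def)
qed

lemma L_coeff_eq_sum_rep:
  assumes psi: "psi \<in> chars" and n: "degree h \<le> n"
  shows "L_coeff psi n = of_nat CARD('a) ^ (n - degree h) * (\<Sum>p\<in>polys_below (degree h). psi (rep n p))"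
proof -
  have "psi (m * h + p) = psi (rep n p)"
    if m: "m \<in> monics (n - degree h)" and p: "p \<in> polys_below (degree h)" for m p
  proof (rule character_ray_class[OF psi])
    have nz: "m \<noteq> 0" and lm: "lead_coeff m = 1" and dm: "degree m = n - degree h"
      using m by (auto simp: monics_def)
    note pb = poly_add_below[OF nz p]
    show "lead_coeff (m * h + p) = 1" using pb lm by simp
    show "lead_coeff (rep n p) = 1" using rep[OF n p] by simp
    show "ray_class (m * h + p) = ray_class (rep n p)"
      unfolding ray_class_def using pb dm n rep[OF n p] mod_below[OF p] by simp
  qed
  then have "L_coeff psi n = (\<Sum>p\<in>polys_below (degree h). \<Sum>m\<in>(monics (n - degree h) :: 'a poly set). psi (rep n p))"
    unfolding L_coeff_def sum_monics[OF n] by (intro sum.cong) auto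
  then show ?thesis by (simp add: card_monics sum_distrib_left)
qed

text \<open>Multiplication by \<open>x\<close> permutes the residues modulo \<open>h\<close> and, as the degree of \<open>x\<close> is divisible by \<open>r\<close>, keeps
  the degree modulo \<open>r\<close>. If \<open>psi x \<noteq> 1\<close>, this forces the sum to vanish.\<close>

lemma sum_rep_mult:
  assumes psi: "psi \<in> chars" and n: "degree h \<le> n" and x: "x \<in> units" "r dvd degree x"
  shows "psi x * (\<Sum>p\<in>polys_below (degree h). psi (rep n p)) = (\<Sum>p\<in>polys_below (degree h). psi (rep n p))"
proof -
  let ?B = "polys_below (degree h) :: 'a poly set"
  define g where "g p = (x * p) mod h" for p
  have lx: "lead_coeff x = 1" and x0: "x \<noteq> 0" using x by (auto simp: units_def)
  have g_in: "g ` ?B \<subseteq> ?B" using mod_in_below by (auto simp: g_def)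
  have inj: "inj_on g ?B"
  proof (rule inj_onI)
    fix p p' assume p: "p \<in> ?B" "p' \<in> ?B" "g p = g p'"
    let ?n = "Suc (degree h)"
    have n': "degree h \<le> ?n" by simp
    have "(x * rep ?n p) mod h = (x * rep ?n p') mod h"
      using p rep(3)[OF n' p(1)] rep(3)[OF n' p(2)] unfolding g_def by (metis mod_mult_right_eq)
    moreover have nz: "rep ?n p \<noteq> 0" "rep ?n p' \<noteq> 0"
      using rep(2)[OF n' p(1)] rep(2)[OF n' p(2)] by auto
    ultimately have "ray_class (x * rep ?n p) = ray_class (x * rep ?n p')"
      using rep(2)[OF n' p(1)] rep(2)[OF n' p(2)] x0 by (simp add: ray_class_def degree_mult_eq)
    from ray_class_cancel[OF x(1) nz this] show "p = p'"
      using rep(3)[OF n' p(1)] rep(3)[OF n' p(2)] by (simp add: ray_class_def)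
  qed
  have img: "g ` ?B = ?B" by (rule endo_inj_surj[OF finite_polys_below g_in inj])
  have "psi x * psi (rep n p) = psi (rep n (g p))" if p: "p \<in> ?B" for p
  proof -
    have gp: "g p \<in> ?B" using g_in p by blast
    note r1 = rep[OF n p] and r2 = rep[OF n gp]
    have nz: "rep n p \<noteq> 0" using r1(1) by auto
    have "psi x * psi (rep n p) = psi (x * rep n p)" using character_mult_monic[OF psi lx r1(1)] by simp
    also have "\<dots> = psi (rep n (g p))"
    proof (rule character_ray_class[OF psi])
      show "lead_coeff (x * rep n p) = 1" using lx r1(1) by (simp only: lead_coeff_mult) simp
      show "lead_coeff (rep n (g p)) = 1" by (rule r2(1))
      have "(x * rep n p) mod h = g p" unfolding g_def using r1(3) by (metis mod_mult_right_eq)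
      moreover have "degree (x * rep n p) mod r = n mod r"
        using nz x0 x(2) r1(2) by (auto simp: degree_mult_eq elim!: dvdE)
      ultimately show "ray_class (x * rep n p) = ray_class (rep n (g p))" using r2(2,3) by (simp add: ray_class_def)
    qed
    finally show ?thesis .
  qed
  then have "psi x * (\<Sum>p\<in>?B. psi (rep n p)) = (\<Sum>p\<in>?B. psi (rep n (g p)))"
    by (simp add: sum_distrib_left)
  also have "\<dots> = (\<Sum>p\<in>g ` ?B. psi (rep n p))" by (simp add: sum.reindex[OF inj])
  finally show ?thesis unfolding img .
qed

text \<open>These characters depend on the degree alone, by \<open>degree_only_eq\<close>: they play the role of the
  principal character, and their L-series are the ones with a pole.\<close>

definition degree_only :: "('a poly \<Rightarrow> complex) \<Rightarrow> bool" where
  "degree_only psi \<longleftrightarrow> (\<forall>x\<in>units. r dvd degree x \<longrightarrow> psi x = 1)"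

definition degree_one_rep :: "'a poly" where "degree_one_rep = (SOME f. f \<in> units \<and> degree f mod r = 1 mod r)"

lemma degree_one_rep: "degree_one_rep \<in> units" "degree degree_one_rep mod r = 1 mod r"
proof -
  obtain f where "f \<in> units" "ray_class f = (1 mod h, 1 mod r)" using ex_units[of 1 1] by auto
  then have "\<exists>f. f \<in> units \<and> degree f mod r = 1 mod r" by (auto simp: ray_class_def)
  from someI_ex[OF this] show "degree_one_rep \<in> units" "degree degree_one_rep mod r = 1 mod r" by (auto simp: degree_one_rep_def)
qed

text \<open>The value on polynomials of degree 1 modulo \<open>r\<close> for a character that depends on the degree alone. The value 0
  in the other case makes \<open>1 - q (degree_root psi) u\<close> the denominator of the L-series for every
  character, since it is 1 when the L-series is a polynomial.\<close>

definition degree_root :: "('a poly \<Rightarrow> complex) \<Rightarrow> complex" where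
  "degree_root psi = (if degree_only psi then psi degree_one_rep else 0)"

lemma power_cong_root: "z ^ r = (1 :: complex) \<Longrightarrow> i mod r = j mod r \<Longrightarrow> z ^ i = z ^ j"
proof -
  assume z: "z ^ r = 1" and ij: "i mod r = j mod r"
  have "z ^ k = z ^ (k mod r)" for k
  proof -
    have "z ^ k = z ^ (r * (k div r) + k mod r)" by simp
    also have "\<dots> = z ^ (k mod r)" using z by (simp only: power_add power_mult) simp
    finally show ?thesis .
  qed
  then show ?thesis using ij by metis
qed

text \<open>A suitable power of \<open>degree_one_rep\<close> brings the degree of \<open>f\<close> to a multiple of \<open>r\<close>, where \<open>psi\<close> is 1.\<close>

lemma degree_only_eq:
  assumes psi: "psi \<in> chars" "degree_only psi"
  shows "degree_root psi ^ r = 1" and "f \<in> units \<Longrightarrow> psi f = degree_root psi ^ degree f"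
proof -
  have z: "degree_root psi = psi degree_one_rep" using psi(2) by (simp add: degree_root_def)
  have lx: "lead_coeff degree_one_rep = 1" using degree_one_rep(1) by (simp add: units_def)
  then have x10: "degree_one_rep \<noteq> 0" by auto
  have "psi (degree_one_rep ^ r) = 1"
    using psi(2) units_power[OF degree_one_rep(1), of r] x10 by (simp add: degree_only_def degree_power_eq)
  then show zr: "degree_root psi ^ r = 1" using character_power_monic[OF psi(1) lx] z by simp
  assume f: "f \<in> units"
  then have lf: "lead_coeff f = 1" and f0: "f \<noteq> 0" by (auto simp: units_def)
  let ?d = "degree f"
  let ?k = "(r - 1) * ?d"
  have "degree (f * degree_one_rep ^ ?k) = ?d + ?k * degree degree_one_rep"
    using f0 x10 by (simp add: degree_mult_eq degree_power_eq)
  moreover have "(?d + ?k * degree degree_one_rep) mod r = (?d + ?k * 1) mod r"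
    using degree_one_rep(2) by (intro mod_add_cong mod_mult_cong) auto
  moreover have "?d + ?k * 1 = r * ?d" using r_pos by (cases r) auto
  ultimately have "r dvd degree (f * degree_one_rep ^ ?k)" by (simp add: mod_eq_0_iff_dvd)
  then have "psi (f * degree_one_rep ^ ?k) = 1"
    using psi(2) units_mult[OF f units_power[OF degree_one_rep(1)]] by (simp add: degree_only_def)
  then have "psi f * degree_root psi ^ ?k = 1"
    using character_mult_monic[OF psi(1) lf, of "degree_one_rep ^ ?k"] character_power_monic[OF psi(1) lx, of ?k] lx z
    by (simp add: lead_coeff_power)
  moreover have "degree_root psi ^ ?d * degree_root psi ^ ?k = 1"
  proof -
    have "degree_root psi ^ ?d * degree_root psi ^ ?k = degree_root psi ^ (r * ?d)"
      using r_pos by (cases r) (auto simp: power_add[symmetric])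
    then show ?thesis using zr by (simp add: power_mult)
  qed
  ultimately show "psi f = degree_root psi ^ degree f"
    by (metis mult_right_cancel mult_zero_right zero_neq_one)
qed

text \<open>From the degree of \<open>h\<close> on, the coefficients form a geometric progression, so the L-series is rational.\<close>

lemma L_coeff_Suc:
  assumes psi: "psi \<in> chars" and n: "degree h \<le> n"
  shows "L_coeff psi (Suc n) = of_nat CARD('a) * degree_root psi * L_coeff psi n"
proof (cases "degree_only psi")
  case True
  have sn: "degree h \<le> Suc n" using n by simp
  have "psi (rep (Suc n) p) = degree_root psi * psi (rep n p)" if p: "p \<in> polys_below (degree h)" for p
  proof -
    note r1 = rep[OF n p] and r2 = rep[OF sn p]
    have units: "rep (Suc n) p \<in> units \<longleftrightarrow> rep n p \<in> units"
      using r1 r2 coprime_poly_mod_iff[of "rep n p" h] coprime_poly_mod_iff[of "rep (Suc n) p" h]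
      by (simp add: units_def)
    show ?thesis
    proof (cases "rep n p \<in> units")
      case T: True
      then show ?thesis
        using degree_only_eq(2)[OF psi True T] degree_only_eq(2)[OF psi True, of "rep (Suc n) p"] units r1(2) r2(2)
        by simp
    next
      case False
      then show ?thesis using units character_D(1)[OF psi] by simp
    qed
  qed
  then have "(\<Sum>p\<in>polys_below (degree h). psi (rep (Suc n) p)) = degree_root psi * (\<Sum>p\<in>polys_below (degree h). psi (rep n p))"
    by (simp add: sum_distrib_left)
  then show ?thesis
    unfolding L_coeff_eq_sum_rep[OF psi n] L_coeff_eq_sum_rep[OF psi sn] using n by (simp add: Suc_diff_le)
next
  case False
  then obtain x where x: "x \<in> units" "r dvd degree x" "psi x \<noteq> 1" by (auto simp: degree_only_def)
  have "L_coeff psi m = 0" if m: "degree h \<le> m" for m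
    using sum_rep_mult[OF psi m x(1,2)] x(3) unfolding L_coeff_eq_sum_rep[OF psi m] by simp
  then show ?thesis using n by simp
qed

text \<open>The numerator of the L-series. Truncation at the degree of \<open>h\<close> loses nothing, by \<open>fps_of_Lpoly\<close>.\<close>

definition Lpoly :: "('a poly \<Rightarrow> complex) \<Rightarrow> complex poly" where
  "Lpoly psi = (\<Sum>n\<le>degree h. monom (fps_nth ((1 - fps_const (of_nat CARD('a) * degree_root psi) * fps_X) * Abs_fps (L_coeff psi)) n) n)"

text \<open>The coefficients of \<open>u N'(u) / N(u)\<close> for the numerator \<open>N\<close> of the L-series: the contribution of the denominator
  is removed.\<close>

definition red_log_coeff :: "('a poly \<Rightarrow> complex) \<Rightarrow> nat \<Rightarrow> complex" where
  "red_log_coeff psi n = (if n = 0 then 0 else log_coeff psi n - (of_nat CARD('a) * degree_root psi) ^ n)"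

lemma fps_of_Lpoly:
  assumes psi: "psi \<in> chars"
  shows "fps_of_poly (Lpoly psi) = (1 - fps_const (of_nat CARD('a) * degree_root psi) * fps_X) * Abs_fps (L_coeff psi)"
    (is "_ = ?R")
proof (rule fps_ext)
  fix n
  have R: "fps_nth ?R n = 0" if gt: "n > degree h"
  proof -
    obtain m where m: "n = Suc m" "degree h \<le> m" using gt by (cases n) auto
    have "fps_nth ?R n = L_coeff psi (Suc m) - of_nat CARD('a) * degree_root psi * L_coeff psi m"
      unfolding m by (simp only: left_diff_distrib mult.assoc) simp
    then show ?thesis using L_coeff_Suc[OF psi m(2)] by simp
  qed
  have "coeff (Lpoly psi) n = (\<Sum>i\<le>degree h. if i = n then fps_nth ?R i else 0)"
    by (simp add: Lpoly_def coeff_sum)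
  also have "\<dots> = (if n \<le> degree h then fps_nth ?R n else 0)" by (simp add: sum.delta)
  also have "\<dots> = fps_nth ?R n" using R by (cases "n \<le> degree h") auto
  finally show "fps_nth (fps_of_poly (Lpoly psi)) n = fps_nth ?R n" by simp
qed

lemma coeff_0_Lpoly: "psi \<in> chars \<Longrightarrow> coeff (Lpoly psi) 0 = 1"
proof -
  assume psi: "psi \<in> chars"
  have "coeff (Lpoly psi) 0 = fps_nth (fps_of_poly (Lpoly psi)) 0" by simp
  also have "\<dots> = 1" unfolding fps_of_Lpoly[OF psi] using L_coeff_0[OF psi] by simp
  finally show ?thesis .
qed

lemma log_coeff_0: "log_coeff psi 0 = 0"
proof -
  have "prime_powers 0 = ({} :: ('a poly \<times> nat) set)"
    using prime_powers_bound(4) by (metis bot_nat_0.not_eq_extremum ex_in_conv surj_pair not_less_zero)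
  then show ?thesis by (simp add: log_coeff_def)
qed

text \<open>Logarithmic derivatives add: the factor \<open>1 - c u\<close> by which the L-series is multiplied contributes
  \<open>-c\<^sup>n\<close> to the coefficient of \<open>u\<^sup>n\<close>.\<close>

lemma log_deriv_Lpoly:
  assumes psi: "psi \<in> chars"
  shows "fps_X * fps_deriv (fps_of_poly (Lpoly psi)) = fps_of_poly (Lpoly psi) * Abs_fps (red_log_coeff psi)"
proof -
  define c where "c = of_nat CARD('a) * degree_root psi"
  define L W G where "L = Abs_fps (L_coeff psi)" and "W = Abs_fps (log_coeff psi)"
    and "G = Abs_fps (\<lambda>n. if n = 0 then 0 else c ^ n)"
  define D where "D = 1 - fps_const c * fps_X"
  have LW: "fps_X * fps_deriv L = L * W"
  proof (rule fps_ext)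
    fix n
    have "fps_nth (fps_X * fps_deriv L) n = of_nat n * L_coeff psi n"
      by (cases n) (simp_all add: L_def)
    also have "\<dots> = fps_nth (W * L) n"
      unfolding L_coeff_recursion[OF psi] by (simp add: fps_mult_nth W_def L_def atLeast0AtMost)
    finally show "fps_nth (fps_X * fps_deriv L) n = fps_nth (L * W) n" by (simp add: mult.commute)
  qed
  have DG: "D * G = fps_const c * fps_X"
  proof (rule fps_ext)
    fix n
    have "fps_nth (D * G) n = fps_nth G n - c * fps_nth (fps_X * G) n"
      by (simp only: D_def left_diff_distrib mult.assoc) simp
    also have "\<dots> = fps_nth (fps_const c * fps_X) n"
    proof (cases n)
      case (Suc m)
      then show ?thesis by (cases m) (simp_all add: G_def)
    qed (simp add: G_def)
    finally show "fps_nth (D * G) n = fps_nth (fps_const c * fps_X) n" .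
  qed
  have V: "Abs_fps (red_log_coeff psi) = W - G"
    by (rule fps_ext) (simp add: red_log_coeff_def W_def G_def c_def log_coeff_0)
  have "fps_deriv D = - fps_const c" by (simp add: D_def)
  then have dD: "fps_X * fps_deriv D = - (fps_const c * fps_X)"
    by (simp only: mult_minus_right mult.commute[of fps_X])
  have "fps_X * fps_deriv (D * L) = (fps_X * fps_deriv D) * L + D * (fps_X * fps_deriv L)"
    by (simp only: fps_deriv_mult distrib_left mult.assoc mult.left_commute[of fps_X D])
       (simp only: add.commute)
  also have "\<dots> = D * L * W - (D * G) * L" unfolding LW dD DG by (simp only: mult_minus_left mult.assoc uminus_add_conv_diff)
  also have "\<dots> = D * L * (W - G)" by (simp only: right_diff_distrib mult.assoc mult.commute[of G])
  finally show ?thesis unfolding V fps_of_Lpoly[OF psi] D_def L_def c_def .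
qed

text \<open>Only characters that depend on the degree alone contribute. They correspond to the \<open>r\<close>-th roots of
  unity \<open>z\<close>, by way of \<open>psi f = z ^ degree f\<close>, so orthogonality of roots of unity applies.\<close>

lemma sum_degree_root_power:
  assumes f: "f \<in> units" and n: "0 < n"
  shows "(\<Sum>psi\<in>chars. psi f * degree_root psi ^ n) = (if r dvd degree f + n then of_nat r else 0)"
proof -
  (* The character attached to the root of unity z, which depends on the degree alone. *)
  define tw where "tw z = (\<lambda>f. if f \<in> units then z ^ degree f else (0 :: complex))" for z
  let ?R = "{z :: complex. z ^ r = 1}"
  have tw_X: "tw z \<in> chars" if z: "z \<in> ?R" for z
  proof (rule character_I)
    fix f g assume "f \<in> units" "g \<in> units"
    then show "tw z (f * g) = tw z f * tw z g"
      using units_mult units_nz by (simp add: tw_def degree_mult_eq power_add)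
  next
    fix f g assume "f \<in> units" "g \<in> units" "ray_class f = ray_class g"
    then show "tw z f = tw z g" using power_cong_root[of z "degree f" "degree g"] z by (simp add: tw_def ray_class_def)
  qed (simp_all add: tw_def)
  have tw_deg: "degree_only (tw z)" if z: "z \<in> ?R" for z
    unfolding degree_only_def tw_def using z by (auto simp: power_mult elim!: dvdE)
  have tw_root: "degree_root (tw z) = z" if z: "z \<in> ?R" for z
    using tw_deg[OF z] degree_one_rep power_cong_root[of z "degree degree_one_rep" 1] z by (simp add: degree_root_def tw_def)
  have root_tw: "tw (degree_root psi) = psi" "degree_root psi \<in> ?R" if psi: "psi \<in> chars" "degree_only psi" for psi
  proof -
    show "tw (degree_root psi) = psi"
    proof
      fix f show "tw (degree_root psi) f = psi f"
        using degree_only_eq(2)[OF psi, of f] character_D(1)[OF psi(1), of f] by (cases "f \<in> units") (simp_all add: tw_def)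
    qed
    show "degree_root psi \<in> ?R" using degree_only_eq(1)[OF psi] by simp
  qed
  have "(\<Sum>psi\<in>chars. psi f * degree_root psi ^ n) = (\<Sum>psi\<in>{psi \<in> chars. degree_only psi}. psi f * degree_root psi ^ n)"
    by (rule sum.mono_neutral_right) (use finite_characters n in \<open>auto simp: degree_root_def\<close>)
  also have "\<dots> = (\<Sum>z\<in>?R. z ^ (degree f + n))"
    by (rule sum.reindex_bij_witness[of _ tw degree_root])
       (use root_tw tw_root tw_deg tw_X degree_only_eq(2)[OF _ _ f] in \<open>auto simp: power_add\<close>)
  also have "\<dots> = (if r dvd degree f + n then of_nat r else 0)"
    by (rule sum_power_roots_unity[OF r_pos])
  finally show ?thesis .
qed

text \<open>The von Mangoldt function summed over the prime powers of degree \<open>n\<close> in the class of \<open>g\<close>.\<close>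

definition class_weight :: "'a poly \<Rightarrow> nat \<Rightarrow> nat" where
  "class_weight g n = (\<Sum>(P, j)\<in>{(P, j)\<in>prime_powers n. P \<in> units \<and> ray_class (P ^ j) = ray_class g}. degree P)"

text \<open>Orthogonality turns the logarithmic derivatives of all L-series into the prime power count of one
  class.\<close>

lemma sum_log_coeff:
  assumes g: "g \<in> units"
  shows "(\<Sum>psi\<in>chars. psi (g ^ (ray_exponent - 1)) * log_coeff psi n) = of_nat (card chars * class_weight g n)"
proof -
  have "(\<Sum>psi\<in>chars. psi (g ^ (ray_exponent - 1)) * log_coeff psi n)
      = (\<Sum>psi\<in>chars. \<Sum>(P, j)\<in>prime_powers n. of_nat (degree P) * (psi (g ^ (ray_exponent - 1)) * psi (P ^ j)))"
  proof (rule sum.cong[OF refl])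
    fix psi assume psi: "psi \<in> chars"
    have "log_coeff psi n = (\<Sum>(P, j)\<in>prime_powers n. of_nat (degree P) * psi (P ^ j))"
      unfolding log_coeff_def by (rule sum.cong) (auto simp: prime_powers_def character_power_monic[OF psi])
    then show "psi (g ^ (ray_exponent - 1)) * log_coeff psi n
        = (\<Sum>(P, j)\<in>prime_powers n. of_nat (degree P) * (psi (g ^ (ray_exponent - 1)) * psi (P ^ j)))"
      by (simp add: sum_distrib_left case_prod_unfold mult_ac)
  qed
  also have "\<dots> = (\<Sum>(P, j)\<in>prime_powers n. of_nat (degree P) * (\<Sum>psi\<in>chars. psi (g ^ (ray_exponent - 1)) * psi (P ^ j)))"
    by (subst sum.swap) (simp add: sum_distrib_left case_prod_unfold)
  also have "\<dots> = (\<Sum>(P, j)\<in>prime_powers n.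
      if P \<in> units \<and> ray_class (P ^ j) = ray_class g then of_nat (card chars) * of_nat (degree P) else 0)"
  proof (rule sum.cong[OF refl], clarify)
    fix P :: "'a poly" and j assume Pj: "(P, j) \<in> prime_powers n"
    have "(\<Sum>psi\<in>chars. psi (g ^ (ray_exponent - 1)) * psi (P ^ j))
        = (if P \<in> units \<and> ray_class (P ^ j) = ray_class g then of_nat (card chars) else 0)"
    proof (cases "P \<in> units")
      case True
      then show ?thesis using orthogonality_class[OF g units_power[OF True]] by simp
    next
      case False
      have "lead_coeff P = 1" "0 < j" using Pj by (auto simp: prime_powers_def)
      then have "psi (P ^ j) = 0" if "psi \<in> chars" for psi
        using character_power_monic[OF that] character_D(1)[OF that False] by (simp add: zero_power)
      then show ?thesis using False by (simp add: sum.neutral)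
    qed
    then show "of_nat (degree P) * (\<Sum>psi\<in>chars. psi (g ^ (ray_exponent - 1)) * psi (P ^ j))
        = (if P \<in> units \<and> ray_class (P ^ j) = ray_class g then of_nat (card chars) * of_nat (degree P) else 0)"
      by simp
  qed
  also have "\<dots> = (\<Sum>(P, j)\<in>{(P, j)\<in>prime_powers n. P \<in> units \<and> ray_class (P ^ j) = ray_class g}.
      of_nat (card chars) * of_nat (degree P))"
    by (rule sum.mono_neutral_cong_right) (auto simp: finite_prime_powers split: if_splits)
  finally show ?thesis by (simp add: class_weight_def sum_distrib_left case_prod_unfold)
qed

lemma sum_red_log_coeff:
  assumes g: "g \<in> units" and n: "0 < n"
  shows "(\<Sum>psi\<in>chars. psi (g ^ (ray_exponent - 1)) * red_log_coeff psi n) = of_nat (card chars * class_weight g n)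
    - (if r dvd degree (g ^ (ray_exponent - 1)) + n then of_nat (r * CARD('a) ^ n) else 0)"
proof -
  have "(\<Sum>psi\<in>chars. psi (g ^ (ray_exponent - 1)) * red_log_coeff psi n) = (\<Sum>psi\<in>chars. psi (g ^ (ray_exponent - 1)) * log_coeff psi n)
      - of_nat CARD('a) ^ n * (\<Sum>psi\<in>chars. psi (g ^ (ray_exponent - 1)) * degree_root psi ^ n)"
    using n by (simp add: red_log_coeff_def algebra_simps sum_subtractf sum_distrib_left power_mult_distrib)
  then show ?thesis using sum_degree_root_power[OF units_power[OF g] n] sum_log_coeff[OF g] by simp
qed

end

section \<open>The numerators do not vanish\<close>

text \<open>Suppose that \<open>N(1/q) = 0\<close> and let \<open>F = N / (1 - (q u)\<^sup>r)\<close>. The logarithmic derivative of \<open>F\<close> has the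
  nonnegative coefficients \<open>E\<close>, so \<open>F\<close> has nonnegative coefficients \<open>a\<close>. Evaluating
  \<open>N = (1 - (q u)\<^sup>r) F\<close> at \<open>1/q\<close> and truncating beyond the degree of \<open>N\<close>, the sum telescopes to
  \<open>r\<close> consecutive terms \<open>a\<^sub>n q\<^sup>-\<^sup>n\<close>. These have sum 0, so they all vanish. But \<open>n a\<^sub>n\<close> is at least
  \<open>E\<^sub>n\<close>, which is positive infinitely often.\<close>

lemma log_deriv_nonvanishing:
  fixes N :: "complex poly" and E :: "nat \<Rightarrow> real" and q r :: nat
  assumes q: "0 < q" and r: "0 < r" and E: "\<And>n. 0 \<le> E n" and inf: "\<And>B. \<exists>n>B. 0 < E n"
    and N0: "coeff N 0 = 1"
    and N: "fps_X * fps_deriv (fps_of_poly N) = fps_of_poly N *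
      Abs_fps (\<lambda>n. if n = 0 then 0 else of_real (E n) - (if r dvd n then of_nat (r * q ^ n) else 0))"
  shows "poly N (1 / of_nat q) \<noteq> 0"
proof
  assume root: "poly N (1 / of_nat q) = 0"
  define c :: complex where "c = of_nat q ^ r"
  define Q where "Q = 1 - fps_const c * fps_X ^ r"
  define F where "F = fps_of_poly N * inverse Q"
  define Ef where "Ef = Abs_fps (\<lambda>n. if n = 0 then 0 else complex_of_real (E n))"
  define G where "G = Abs_fps (\<lambda>n. if n \<noteq> 0 \<and> r dvd n then of_nat (r * q ^ n) else 0 :: complex)"
  have Q0: "fps_nth Q 0 = 1" using r by (simp add: Q_def)
  then have Qnz: "Q \<noteq> 0" by (metis fps_zero_nth zero_neq_one)
  have QF: "Q * F = fps_of_poly N"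
    using Q0 by (simp add: F_def mult.left_commute[of Q] inverse_mult_eq_1')
  have QG: "Q * G = fps_const (of_nat r * c) * fps_X ^ r"
  proof (rule fps_ext)
    fix n
    have "fps_nth (Q * G) n = fps_nth G n - c * (if n < r then 0 else fps_nth G (n - r))"
      by (simp only: Q_def left_diff_distrib mult.assoc) (simp add: fps_X_power_mult_nth)
    also have "\<dots> = fps_nth (fps_const (of_nat r * c) * fps_X ^ r) n"
    proof -
      consider "n < r" | "n = r" | "n > r" by linarith
      then show ?thesis
      proof cases
        case 1
        then have "fps_nth G n = 0" by (auto simp: G_def dest: dvd_imp_le)
        then show ?thesis using 1 by (simp add: fps_X_power_nth)
      next
        case 2
        then show ?thesis using r by (simp add: G_def c_def fps_X_power_nth)
      next
        case 3
        have "r dvd n \<longleftrightarrow> r dvd n - r" using 3 by (simp add: dvd_minus_self)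
        moreover have "(of_nat (q ^ n) :: complex) = c * of_nat (q ^ (n - r))"
          using 3 by (simp add: c_def power_add[symmetric])
        ultimately show ?thesis using 3 r by (simp add: G_def fps_X_power_nth mult.left_commute)
      qed
    qed
    finally show "fps_nth (Q * G) n = fps_nth (fps_const (of_nat r * c) * fps_X ^ r) n" .
  qed
  have XQ: "fps_X * fps_deriv Q = - (Q * G)"
  proof -
    have "fps_deriv Q = - (fps_const (of_nat r * c) * fps_X ^ (r - 1))"
      by (simp add: Q_def fps_deriv_power fps_of_nat[symmetric] mult.assoc mult.left_commute
           flip: fps_const_mult)
    moreover have "fps_X * (fps_const (of_nat r * c) * fps_X ^ (r - 1)) = fps_const (of_nat r * c) * fps_X ^ r"
      using r by (metis mult.left_commute power_eq_if not_gr_zero)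
    ultimately show ?thesis unfolding QG by (simp only: mult_minus_right)
  qed
  have V: "Abs_fps (\<lambda>n. if n = 0 then 0 else of_real (E n) - (if r dvd n then of_nat (r * q ^ n) else 0)) = Ef - G"
    by (rule fps_ext) (simp add: Ef_def G_def)
  have "fps_X * fps_deriv (Q * F) = (fps_X * fps_deriv Q) * F + Q * (fps_X * fps_deriv F)"
    by (simp only: fps_deriv_mult distrib_left mult.assoc mult.left_commute[of fps_X Q])
       (simp only: add.commute)
  also have "\<dots> = Q * (fps_X * fps_deriv F) - Q * F * G"
    unfolding XQ by (simp only: mult_minus_left mult.assoc uminus_add_conv_diff mult.commute[of G])
  finally have "Q * (fps_X * fps_deriv F) - Q * F * G = Q * F * (Ef - G)"
    using N unfolding V QF by simp
  moreover have "Q * F * (Ef - G) = Q * (F * Ef) - Q * F * G"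
    by (simp only: right_diff_distrib mult.assoc)
  ultimately have "Q * (fps_X * fps_deriv F) - Q * F * G = Q * (F * Ef) - Q * F * G" by (rule trans)
  then have "Q * (fps_X * fps_deriv F) = Q * (F * Ef)" by (simp only: diff_eq_eq diff_add_cancel)
  then have logF: "fps_X * fps_deriv F = F * Ef" by (rule iffD1[OF mult_left_cancel[OF Qnz]])
  have rec: "of_nat n * fps_nth F n = (\<Sum>i<n. fps_nth F i * of_real (E (n - i)))" for n
  proof -
    have "of_nat n * fps_nth F n = fps_nth (fps_X * fps_deriv F) n" by (cases n) simp_all
    also have "\<dots> = (\<Sum>i\<le>n. fps_nth F i * fps_nth Ef (n - i))"
      unfolding logF by (simp add: fps_mult_nth atLeast0AtMost)
    also have "\<dots> = (\<Sum>i<n. fps_nth F i * fps_nth Ef (n - i))"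
      by (rule sum.mono_neutral_right) (auto simp: Ef_def)
    also have "\<dots> = (\<Sum>i<n. fps_nth F i * of_real (E (n - i)))"
      by (rule sum.cong) (auto simp: Ef_def)
    finally show ?thesis .
  qed
  have "fps_nth (Q * F) 0 = 1" unfolding QF using N0 by simp
  then have F0: "fps_nth F 0 = 1" using Q0 by simp
  have "\<exists>a\<ge>0. fps_nth F n = of_real a" for n
  proof (induction n rule: less_induct)
    case (less n)
    then obtain a where a: "\<And>i. i < n \<Longrightarrow> 0 \<le> a i \<and> fps_nth F i = of_real (a i)" by metis
    show ?case
    proof (cases "n = 0")
      case True
      then show ?thesis using F0 by (intro exI[of _ 1]) simp
    next
      case False
      have "of_nat n * fps_nth F n = (\<Sum>i<n. of_real (a i * E (n - i)))"
        unfolding rec by (intro sum.cong) (use a in auto)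
      also have "\<dots> = of_real (\<Sum>i<n. a i * E (n - i))" by (rule of_real_sum[symmetric])
      finally have "fps_nth F n = of_real ((\<Sum>i<n. a i * E (n - i)) / n)"
        using False by (simp add: field_simps)
      moreover have "0 \<le> (\<Sum>i<n. a i * E (n - i)) / n"
        using a E by (intro divide_nonneg_nonneg sum_nonneg mult_nonneg_nonneg) auto
      ultimately show ?thesis by blast
    qed
  qed
  then obtain a where a: "\<And>n. 0 \<le> a n" "\<And>n. fps_nth F n = of_real (a n)" by metis
  have a0: "a 0 = 1" using F0 a(2)[of 0] by simp
  have pos: "0 < a n" if n: "0 < n" "0 < E n" for n
  proof -
    have "complex_of_real (of_nat n * a n) = of_real (\<Sum>i<n. a i * E (n - i))"
      using rec[of n] by (simp add: a(2))
    then have "of_nat n * a n = (\<Sum>i<n. a i * E (n - i))" by (simp only: of_real_eq_iff)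
    also have "\<dots> \<ge> a 0 * E (n - 0)"
      using n a(1) E by (intro member_le_sum[of 0 "{..<n}" "\<lambda>i. a i * E (n - i)"]) auto
    finally have "0 < of_nat n * a n" using a0 n(2) by simp
    then show ?thesis using n(1) by (simp add: zero_less_mult_iff)
  qed
  define x :: real where "x = 1 / of_nat q"
  have x: "0 < x" "of_nat q ^ r * x ^ r = 1" using q by (simp_all add: x_def power_divide)
  have zero: "a K = 0" if K: "degree N \<le> K" "r \<le> K" for K
  proof -
    have coeffN: "coeff N n = of_real (a n - of_nat q ^ r * (if n < r then 0 else a (n - r)))" for n
    proof -
      have "coeff N n = fps_nth (Q * F) n" by (simp add: QF)
      also have "\<dots> = fps_nth F n - c * (if n < r then 0 else fps_nth F (n - r))"
        by (simp only: Q_def left_diff_distrib mult.assoc) (simp add: fps_X_power_mult_nth)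
      finally show ?thesis by (simp add: a(2) c_def)
    qed
    have "0 = poly N (of_real x)" using root by (simp add: x_def)
    also have "\<dots> = (\<Sum>n\<le>K. coeff N n * of_real x ^ n)"
      unfolding poly_altdef using K(1) by (intro sum.mono_neutral_left) (auto simp: coeff_eq_0)
    also have "\<dots> = of_real (\<Sum>n\<le>K. (a n - of_nat q ^ r * (if n < r then 0 else a (n - r))) * x ^ n)"
      by (simp add: coeffN)
    finally have "0 = (\<Sum>n\<le>K. (a n - of_nat q ^ r * (if n < r then 0 else a (n - r))) * x ^ n)"
      by (metis of_real_eq_0_iff)
    also have "\<dots> = (\<Sum>n\<le>K. a n * x ^ n) - (\<Sum>n\<le>K. of_nat q ^ r * (if n < r then 0 else a (n - r)) * x ^ n)"
      by (simp add: left_diff_distrib sum_subtractf)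
    also have "(\<Sum>n\<le>K. of_nat q ^ r * (if n < r then 0 else a (n - r)) * x ^ n)
        = (\<Sum>n\<in>{r..K}. of_nat q ^ r * a (n - r) * x ^ n)"
      by (rule sum.mono_neutral_cong_right) auto
    also have "\<dots> = (\<Sum>n\<le>K - r. of_nat q ^ r * a n * x ^ (n + r))"
      by (rule sum.reindex_bij_witness[of _ "\<lambda>n. n + r" "\<lambda>n. n - r"]) (use K in auto)
    also have "\<dots> = (\<Sum>n\<le>K - r. a n * x ^ n)"
    proof (rule sum.cong[OF refl])
      fix n
      have "of_nat q ^ r * a n * x ^ (n + r) = a n * x ^ n * (of_nat q ^ r * x ^ r)"
        by (simp add: power_add mult_ac)
      then show "of_nat q ^ r * a n * x ^ (n + r) = a n * x ^ n" using x(2) by simp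
    qed
    also have "(\<Sum>n\<le>K. a n * x ^ n) - (\<Sum>n\<le>K - r. a n * x ^ n) = (\<Sum>n\<in>{..K} - {..K - r}. a n * x ^ n)"
      by (rule sum_diff[symmetric]) auto
    finally have "(\<Sum>n\<in>{..K} - {..K - r}. a n * x ^ n) = 0" by simp
    moreover have "a K * x ^ K \<le> (\<Sum>n\<in>{..K} - {..K - r}. a n * x ^ n)"
      by (rule member_le_sum) (use K r a(1) x(1) in auto)
    ultimately have "a K * x ^ K \<le> 0" by simp
    moreover have "0 < x ^ K" using x(1) by simp
    ultimately show ?thesis using a(1)[of K] by (simp add: mult_le_0_iff)
  qed
  obtain n where n: "n > max (degree N) r" "0 < E n" using inf by blast
  then show False using zero[of n] pos[of n] by auto
qed

context ray begin

lemma ex_irreducible_units: "\<exists>P\<in>units. irreducible P"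
proof -
  (* An irreducible factor of h T + 1 is prime to h. *)
  let ?f = "h * [:0, 1:] + 1"
  have "degree (h * [:0, 1:]) = Suc (degree h)" using h_nz by (subst degree_mult_eq) auto
  then have "degree ?f = Suc (degree h)" by (subst degree_add_eq_left) auto
  then obtain P where P: "lead_coeff P = 1" "irreducible P" "P dvd ?f"
    using monic_irreducible_factor[of ?f] by auto
  have "coprime P h"
  proof (rule coprimeI)
    fix d assume "d dvd P" "d dvd h"
    from \<open>d dvd P\<close> P(3) have "d dvd ?f" by (rule dvd_trans)
    moreover from \<open>d dvd h\<close> have "d dvd h * [:0, 1:]" by (rule dvd_mult2)
    ultimately show "is_unit d" by (simp only: dvd_add_right_iff)
  qed
  then show ?thesis using P by (auto simp: units_def)
qed

text \<open>The powers of one irreducible polynomial with exponent divisible by \<open>ray_exponent\<close> lie in the trivial class.\<close>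

lemma class_weight_1_pos: "\<exists>n>B. 0 < class_weight 1 n"
proof -
  obtain P where P: "P \<in> units" "irreducible P" using ex_irreducible_units by blast
  let ?j = "ray_exponent * Suc B"
  let ?n = "?j * degree P"
  have dP: "0 < degree P" using irreducible_poly_degree[OF P(2)] .
  have "ray_class ((P ^ ray_exponent) ^ Suc B) = ray_class 1"
    by (rule ray_class_power_1) (use P ray_class_power_exponent units_power in auto)
  then have "ray_class (P ^ ?j) = ray_class 1" by (simp only: power_mult)
  then have "(P, ?j) \<in> {(P, j)\<in>prime_powers ?n. P \<in> units \<and> ray_class (P ^ j) = ray_class 1}"
    using P ray_exponent_pos by (auto simp: prime_powers_def units_def)
  then have "degree P \<le> class_weight 1 ?n"
    unfolding class_weight_def
    using member_le_sum[of "(P, ?j)" "{(P, j)\<in>prime_powers ?n. P \<in> units \<and> ray_class (P ^ j) = ray_class 1}" "\<lambda>(P, j). degree P"]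
      finite_subset[OF _ finite_prime_powers[of ?n], of "{(P, j)\<in>prime_powers ?n. P \<in> units \<and> ray_class (P ^ j) = ray_class 1}"]
    by auto
  moreover have "B < ?n"
  proof -
    have "Suc B * 1 \<le> Suc B * (ray_exponent * degree P)" using ray_exponent_pos dP by (intro mult_le_mono2) simp
    then show ?thesis by (simp add: algebra_simps)
  qed
  ultimately show ?thesis using dP by (intro exI[of _ ?n]) simp
qed

lemma card_characters_pos: "0 < card chars"
  using finite_characters principal_character_in card_gt_0_iff by blast

text \<open>The product over all characters has, by orthogonality at the trivial class, a logarithmic derivative of the
  form treated in \<open>log_deriv_nonvanishing\<close>. If the product does not vanish, neither does any factor. So real and complex
  characters are treated alike.\<close>

lemma Lpoly_nonzero:
  assumes psi: "psi \<in> chars"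
  shows "poly (Lpoly psi) (1 / of_nat CARD('a)) \<noteq> 0"
proof -
  define N where "N = (\<Prod>psi\<in>chars. Lpoly psi)"
  define E where "E n = real (card chars * class_weight 1 n)" for n
  have "poly N (1 / of_nat CARD('a)) \<noteq> 0"
  proof (rule log_deriv_nonvanishing[OF _ r_pos])
    show "0 < CARD('a)" by simp
    show "\<exists>n>B. 0 < E n" for B
      using class_weight_1_pos[of B] card_characters_pos by (auto simp: E_def)
    have "coeff N 0 = (\<Prod>psi\<in>chars. poly (Lpoly psi) 0)"
      by (simp only: N_def poly_0_coeff_0[symmetric] poly_prod)
    also have "\<dots> = 1" by (rule prod.neutral) (simp add: poly_0_coeff_0 coeff_0_Lpoly)
    finally show "coeff N 0 = 1" .
    have "fps_X * fps_deriv (fps_of_poly N) = fps_of_poly N * (\<Sum>psi\<in>chars. Abs_fps (red_log_coeff psi))"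
      unfolding N_def fps_of_poly_prod by (rule fps_log_deriv_prod[OF finite_characters log_deriv_Lpoly])
    also have "(\<Sum>psi\<in>chars. Abs_fps (red_log_coeff psi)) = Abs_fps (\<lambda>n. if n = 0 then 0 else
        of_real (E n) - (if r dvd n then of_nat (r * CARD('a) ^ n) else 0))"
    proof (rule fps_ext)
      fix n
      show "fps_nth (\<Sum>psi\<in>chars. Abs_fps (red_log_coeff psi)) n = fps_nth (Abs_fps (\<lambda>n. if n = 0 then 0 else
        of_real (E n) - (if r dvd n then of_nat (r * CARD('a) ^ n) else 0))) n"
      proof (cases "n = 0")
        case True
        then show ?thesis by (simp add: fps_sum_nth red_log_coeff_def)
      next
        case False
        have "(\<Sum>psi\<in>chars. red_log_coeff psi n) = (\<Sum>psi\<in>chars. psi (1 ^ (ray_exponent - 1)) * red_log_coeff psi n)"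
          by (intro sum.cong) (simp_all add: character_D(2))
        then show ?thesis using False sum_red_log_coeff[OF units_1, of n] by (simp add: fps_sum_nth E_def)
      qed
    qed
    finally show "fps_X * fps_deriv (fps_of_poly N) = fps_of_poly N * Abs_fps (\<lambda>n. if n = 0 then 0 else
        of_real (E n) - (if r dvd n then of_nat (r * CARD('a) ^ n) else 0))" .
  qed (simp add: E_def)
  then show ?thesis using psi finite_characters by (simp add: N_def poly_prod)
qed

end

section \<open>Irreducible polynomials in arithmetic progressions\<close>

lemma summable_quadratic_geometric:
  fixes x :: real
  assumes x: "0 < x" "x < 1"
  shows "summable (\<lambda>n. real n * (real n + 1) * x ^ n)"
proof -
  (* The ratio of consecutive terms tends to x, so it is eventually below any c between x and 1. *)
  define c where "c = (1 + x) / 2"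
  have c: "c < 1" "x < c" using x by (auto simp: c_def)
  define N where "N = Suc (nat \<lceil>2 * x / (c - x)\<rceil>)"
  show ?thesis
  proof (rule summable_ratio_test[OF c(1), of N])
    fix n assume n: "N \<le> n"
    have "2 * x / (c - x) \<le> real n" using n unfolding N_def by linarith
    then have "2 * x \<le> real n * (c - x)" using c by (simp add: field_simps)
    then have 1: "(real n + 2) * x \<le> c * real n" by (simp add: algebra_simps)
    have "norm (real (Suc n) * (real (Suc n) + 1) * x ^ Suc n) = ((real n + 1) * x ^ n) * ((real n + 2) * x)"
      using x by (simp add: abs_mult algebra_simps)
    also have "\<dots> \<le> ((real n + 1) * x ^ n) * (c * real n)"
      using x 1 by (intro mult_left_mono) auto
    also have "\<dots> = c * norm (real n * (real n + 1) * x ^ n)"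
      using x by (simp add: abs_mult)
    finally show "norm (real (Suc n) * (real (Suc n) + 1) * x ^ Suc n)
        \<le> c * norm (real n * (real n + 1) * x ^ n)" .
  qed
qed

lemma card_prime_powers_le: "card (prime_powers n :: ('a::{finite,field} poly \<times> nat) set) \<le> CARD('a) ^ Suc n * (n + 1)"
proof -
  have "(prime_powers n :: ('a poly \<times> nat) set) \<subseteq> polys_below (Suc n) \<times> {..n}"
  proof (rule subrelI)
    fix P :: "'a poly" and j assume "(P, j) \<in> prime_powers n"
    from prime_powers_bound[OF this] show "(P, j) \<in> polys_below (Suc n) \<times> {..n}"
      by (auto simp: polys_below_iff)
  qed
  from card_mono[OF _ this] show ?thesis
    by (simp add: finite_polys_below card_polys_below)
qed

context ray begin

text \<open>A crude bound, of size \<open>q\<^sup>n\<close> up to a polynomial factor, which suffices for convergence inside the circle of radius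
  \<open>1/q\<close>.\<close>

lemma norm_red_log_coeff_le: "psi \<in> chars \<Longrightarrow>
  norm (red_log_coeff psi n) \<le> CARD('a) * (real n * (real n + 1) * real CARD('a) ^ n) + real CARD('a) ^ n"
proof -
  assume psi: "psi \<in> chars"
  let ?q = "real CARD('a)"
  have "norm (log_coeff psi n) \<le> (\<Sum>(P, j)\<in>(prime_powers n :: ('a poly \<times> nat) set). real n)"
    unfolding log_coeff_def
  proof (rule sum_norm_le)
    fix x :: "'a poly \<times> nat" assume x: "x \<in> prime_powers n"
    obtain P j where Pj: "x = (P, j)" by (cases x)
    have "norm (psi P) ^ j \<le> 1" using character_norm_le_1[OF psi] by (intro power_le_one) auto
    moreover have "real (degree P) \<le> real n" using prime_powers_bound(3)[of P j n] x Pj by simp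
    ultimately have "real (degree P) * norm (psi P) ^ j \<le> real n * 1" by (intro mult_mono) auto
    then show "norm (case x of (P, j) \<Rightarrow> of_nat (degree P) * psi P ^ j) \<le> (case x of (P, j) \<Rightarrow> real n)"
      using Pj by (simp add: norm_mult norm_power)
  qed
  also have "\<dots> = real n * real (card (prime_powers n :: ('a poly \<times> nat) set))"
    by (simp add: case_prod_unfold)
  also have "\<dots> \<le> real n * real (CARD('a) ^ Suc n * (n + 1))"
    using card_prime_powers_le[where 'a = 'a, of n] by (intro mult_left_mono) (simp_all only: of_nat_le_iff of_nat_0_le_iff)
  finally have log_coeff: "norm (log_coeff psi n) \<le> ?q * (real n * (real n + 1) * ?q ^ n)"
    by (simp add: algebra_simps)
  have "norm (degree_root psi) \<le> 1" using character_norm_le_1[OF psi] by (simp add: degree_root_def)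
  then have "norm ((of_nat CARD('a) * degree_root psi) ^ n) \<le> ?q ^ n"
    by (simp add: norm_mult norm_power power_mult_distrib mult_left_le power_le_one)
  moreover have "norm (red_log_coeff psi n) \<le> norm (log_coeff psi n) + norm ((of_nat CARD('a) * degree_root psi) ^ n)"
    by (auto simp: red_log_coeff_def norm_triangle_ineq4 intro: add_nonneg_nonneg)
  ultimately show ?thesis using log_coeff by linarith
qed

lemma red_log_coeff_summable:
  assumes psi: "psi \<in> chars" and u: "0 < u" "u < 1 / real CARD('a)"
  shows "summable (\<lambda>n. red_log_coeff psi n * of_real u ^ n)"
proof (rule summable_comparison_test)
  let ?q = "real CARD('a)"
  have qu: "0 < ?q * u" "?q * u < 1" using u q_gt_1 by (auto simp: field_simps)
  show "summable (\<lambda>n. ?q * (real n * (real n + 1) * (?q * u) ^ n) + (?q * u) ^ n)"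
    by (intro summable_add summable_mult summable_quadratic_geometric summable_geometric) (use qu in auto)
  have "norm (red_log_coeff psi n * of_real u ^ n) \<le> ?q * (real n * (real n + 1) * (?q * u) ^ n) + (?q * u) ^ n" for n
  proof -
    have "norm (red_log_coeff psi n * of_real u ^ n) = norm (red_log_coeff psi n) * u ^ n"
      using u by (simp add: norm_mult norm_power)
    also have "\<dots> \<le> (?q * (real n * (real n + 1) * ?q ^ n) + ?q ^ n) * u ^ n"
      using norm_red_log_coeff_le[OF psi] u by (intro mult_right_mono) auto
    finally show ?thesis by (simp add: power_mult_distrib algebra_simps)
  qed
  then show "\<exists>N. \<forall>n\<ge>N. norm (red_log_coeff psi n * of_real u ^ n)
      \<le> ?q * (real n * (real n + 1) * (?q * u) ^ n) + (?q * u) ^ n" by blast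
qed

text \<open>Inside the circle the series equals \<open>u N'(u) / N(u)\<close>, which is continuous at \<open>1/q\<close> because
  the numerator \<open>N\<close> does not vanish there.\<close>

lemma red_log_series_bounded:
  assumes psi: "psi \<in> chars"
  shows "\<exists>B. \<forall>\<^sub>F u in at_left (1 / real CARD('a)). norm (suminf (\<lambda>n. red_log_coeff psi n * of_real u ^ n)) \<le> B"
proof -
  let ?Q = "1 / real CARD('a)"
  define p where "p = Lpoly psi"
  have p0: "poly p (of_real ?Q) \<noteq> 0" using Lpoly_nonzero[OF psi] by (simp add: p_def)
  define R where "R u = of_real u * poly (pderiv p) (of_real u) / poly p (of_real u)" for u :: real
  have Q0: "0 < ?Q" by simp
  have "(R \<longlongrightarrow> R ?Q) (at_left ?Q)"
    unfolding R_def by (intro tendsto_intros p0)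
  then have "((\<lambda>u. norm (R u)) \<longlongrightarrow> norm (R ?Q)) (at_left ?Q)" by (rule tendsto_norm)
  then have 1: "\<forall>\<^sub>F u in at_left ?Q. norm (R u) < norm (R ?Q) + 1"
    by (rule order_tendstoD) simp
  have "((\<lambda>u. poly p (of_real u)) \<longlongrightarrow> poly p (of_real ?Q)) (at_left ?Q)"
    by (intro tendsto_intros)
  then have 2: "\<forall>\<^sub>F u in at_left ?Q. poly p (of_real u) \<noteq> 0"
    using p0 by (rule tendsto_imp_eventually_ne)
  have 3: "\<forall>\<^sub>F u in at_left ?Q. u \<in> {0<..<?Q}"
    by (rule eventually_at_leftI[OF _ Q0])
  have "\<forall>\<^sub>F u in at_left ?Q. norm (suminf (\<lambda>n. red_log_coeff psi n * of_real u ^ n)) \<le> norm (R ?Q) + 1"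
    using 1 2 3
  proof eventually_elim
    case (elim u)
    let ?V = "Abs_fps (red_log_coeff psi)"
    have u: "0 < u" "u < ?Q" using elim(3) by auto
    define u' where "u' = (u + ?Q) / 2"
    have u': "u < u'" "u' < ?Q" using u by (auto simp: u'_def)
    have "ereal (norm (complex_of_real u')) \<le> conv_radius (red_log_coeff psi)"
      using red_log_coeff_summable[OF psi, of u'] u u' by (intro conv_radius_geI) auto
    then have "ereal u' \<le> fps_conv_radius ?V" using u u' by (simp add: fps_conv_radius_def)
    then have rad: "ereal (norm (complex_of_real u)) < fps_conv_radius ?V"
      using u u' by (simp add: less_le_trans[of "ereal u" "ereal u'"])
    have V: "eval_fps ?V (of_real u) = (suminf (\<lambda>n. red_log_coeff psi n * of_real u ^ n))"
      by (simp add: eval_fps_def)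
    have "eval_fps (fps_of_poly p * ?V) (of_real u) = poly p (of_real u) * (suminf (\<lambda>n. red_log_coeff psi n * of_real u ^ n))"
      using eval_fps_mult[OF _ rad, of "fps_of_poly p"] V by simp
    moreover have "fps_of_poly p * ?V = fps_of_poly ([:0, 1:] * pderiv p)"
      using log_deriv_Lpoly[OF psi] by (simp only: p_def fps_of_poly_mult fps_of_poly_pderiv fps_of_poly_fps_X)
    ultimately have "poly p (of_real u) * (suminf (\<lambda>n. red_log_coeff psi n * of_real u ^ n)) = of_real u * poly (pderiv p) (of_real u)"
      by (simp only: eval_fps_of_poly) simp
    then have "(suminf (\<lambda>n. red_log_coeff psi n * of_real u ^ n)) = R u"
      using elim(2) by (simp add: R_def field_simps)
    then show ?case using elim(1) by simp
  qed
  then show ?thesis by blast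
qed

text \<open>Without irreducible polynomials in the class, only proper powers contribute, and their bases have degree
  at most \<open>n/2\<close>. So the weight is \<open>q\<^bsup>n/2\<^esup>\<close> up to a polynomial factor.\<close>

lemma class_weight_le:
  assumes none: "\<not> (\<exists>P\<in>units. irreducible P \<and> ray_class P = ray_class g)"
  shows "class_weight g n \<le> n * ((n + 1) * CARD('a) ^ Suc (n div 2))"
proof -
  let ?S = "{(P, j)\<in>prime_powers n. P \<in> units \<and> ray_class (P ^ j) = ray_class g}"
  have sub: "?S \<subseteq> polys_below (Suc (n div 2)) \<times> {..n}"
  proof (rule subrelI)
    fix P j assume Pj: "(P, j) \<in> ?S"
    then have Pn: "(P, j) \<in> prime_powers n" by simp
    then have "0 < j" "irreducible P" by (auto simp: prime_powers_def)
    moreover have "j \<noteq> 1" using none Pj \<open>irreducible P\<close> by auto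
    ultimately have j: "2 \<le> j" by simp
    have "degree P \<le> n div j" using prime_powers_bound(2)[OF Pn] by (simp add: polys_below_iff)
    also have "\<dots> \<le> n div 2" using j by (rule div_le_mono2[OF pos2])
    finally show "(P, j) \<in> polys_below (Suc (n div 2)) \<times> {..n}"
      using prime_powers_bound(1)[OF Pn] by (simp add: polys_below_iff)
  qed
  have "class_weight g n \<le> (\<Sum>x\<in>?S. n)"
    unfolding class_weight_def
  proof (rule sum_mono)
    fix x assume "x \<in> ?S"
    then show "(case x of (P, j) \<Rightarrow> degree P) \<le> n"
      using prime_powers_bound(3) by (cases x) auto
  qed
  also have "\<dots> = card ?S * n" by simp
  also have "card ?S \<le> card (polys_below (Suc (n div 2)) \<times> {..n} :: ('a poly \<times> nat) set)"
    by (rule card_mono[OF _ sub]) (simp add: finite_polys_below)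
  also have "\<dots> = (n + 1) * CARD('a) ^ Suc (n div 2)"
    by (simp add: card_cartesian_product card_polys_below)
  finally show ?thesis by (simp add: mult.commute)
qed

lemma summable_class_weight:
  assumes none: "\<not> (\<exists>P\<in>units. irreducible P \<and> ray_class P = ray_class g)"
  shows "summable (\<lambda>n. real (class_weight g n) * (1 / real CARD('a)) ^ n)"
proof (rule summable_comparison_test)
  let ?q = "real CARD('a)"
  define s where "s = sqrt ?q"
  have q1: "1 < ?q" using q_gt_1 by simp
  have s: "1 < s" "s ^ 2 = ?q" using q1 by (simp_all add: s_def)
  show "summable (\<lambda>n. ?q * (real n * (real n + 1) * (1 / s) ^ n))"
    by (intro summable_mult summable_quadratic_geometric) (use s in auto)
  have "norm (real (class_weight g n) * (1 / ?q) ^ n) \<le> ?q * (real n * (real n + 1) * (1 / s) ^ n)" for n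
  proof -
    have "?q ^ (n div 2) = s ^ (2 * (n div 2))" by (simp add: power_mult s(2))
    also have "\<dots> \<le> s ^ n" using s by (intro power_increasing) auto
    finally have qs: "?q ^ (n div 2) \<le> s ^ n" .
    have "real (class_weight g n) \<le> real (n * ((n + 1) * CARD('a) ^ Suc (n div 2)))"
      using class_weight_le[OF none, of n] by (simp only: of_nat_le_iff)
    also have "\<dots> = ?q * (real n * (real n + 1)) * ?q ^ (n div 2)" by (simp add: algebra_simps)
    also have "\<dots> \<le> ?q * (real n * (real n + 1)) * s ^ n"
      by (intro mult_left_mono qs) auto
    finally have "real (class_weight g n) * (1 / ?q) ^ n \<le> (?q * (real n * (real n + 1)) * s ^ n) * (1 / ?q) ^ n"
      by (intro mult_right_mono) auto
    also have "s ^ n * (1 / ?q) ^ n = (1 / s) ^ n"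
      unfolding s(2)[symmetric] using s(1) by (simp add: power_mult_distrib[symmetric] power2_eq_square)
    then have "(?q * (real n * (real n + 1)) * s ^ n) * (1 / ?q) ^ n = ?q * (real n * (real n + 1) * (1 / s) ^ n)"
      by (simp add: mult.assoc)
    finally show ?thesis by simp
  qed
  then show "\<exists>N. \<forall>n\<ge>N. norm (real (class_weight g n) * (1 / ?q) ^ n) \<le> ?q * (real n * (real n + 1) * (1 / s) ^ n)"
    by blast
qed

text \<open>Otherwise the weights of the class of \<open>g\<close> have a convergent generating series at \<open>1/q\<close>. By
  \<open>sum_red_log_coeff\<close> this series, times the number of characters, differs by a bounded amount from the sum of \<open>r (q u)\<^sup>n\<close> over an
  arithmetic progression of exponents \<open>n\<close>, which is unbounded as \<open>u\<close> tends to \<open>1/q\<close>.\<close>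

lemma ex_irreducible_ray_class:
  assumes g: "g \<in> units"
  shows "\<exists>P\<in>units. irreducible P \<and> ray_class P = ray_class g"
proof (rule ccontr)
  assume none: "\<not> ?thesis"
  let ?q = "real CARD('a)"
  let ?Q = "1 / ?q"
  let ?d = "degree (g ^ (ray_exponent - 1))"
  (* The main term comes from the poles: the coefficient b n of (q u)^n is r along a progression. *)
  define b where "b n = (if 0 < n \<and> r dvd ?d + n then real r else 0)" for n
  define cw where "cw n = real (card chars) * real (class_weight g n)" for n
  define B where "B psi = (SOME B. \<forall>\<^sub>F u in at_left ?Q. norm (suminf (\<lambda>n. red_log_coeff psi n * of_real u ^ n)) \<le> B)" for psi
  have B: "\<forall>\<^sub>F u in at_left ?Q. norm (suminf (\<lambda>n. red_log_coeff psi n * of_real u ^ n)) \<le> B psi" if "psi \<in> chars" for psi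
    unfolding B_def by (rule someI_ex[OF red_log_series_bounded[OF that]])
  have Q0: "0 < ?Q" by simp
  have sumcw: "summable (\<lambda>n. cw n * ?Q ^ n)"
    using summable_mult[OF summable_class_weight[OF none], of "real (card chars)"] by (simp add: cw_def mult.assoc)
  define C where "C = (suminf (\<lambda>n. cw n * ?Q ^ n))"
  define T where "T = C + (\<Sum>psi\<in>chars. B psi)"
  have term_eq: "complex_of_real (b n * (?q * u) ^ n)
      = of_real (cw n * u ^ n) - (\<Sum>psi\<in>chars. psi (g ^ (ray_exponent - 1)) * (red_log_coeff psi n * of_real u ^ n))" for n u
  proof (cases "n = 0")
    case True
    have "prime_powers 0 = ({} :: ('a poly \<times> nat) set)"
      using prime_powers_bound(4)[where n = 0] by auto
    then have "class_weight g 0 = 0" by (simp add: class_weight_def)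
    then show ?thesis using True by (simp add: b_def cw_def red_log_coeff_def)
  next
    case False
    have "(\<Sum>psi\<in>chars. psi (g ^ (ray_exponent - 1)) * (red_log_coeff psi n * of_real u ^ n))
        = (\<Sum>psi\<in>chars. psi (g ^ (ray_exponent - 1)) * red_log_coeff psi n) * of_real u ^ n"
      by (simp add: sum_distrib_right mult.assoc)
    also have "(\<Sum>psi\<in>chars. psi (g ^ (ray_exponent - 1)) * red_log_coeff psi n) = of_real (cw n) - of_real (b n * ?q ^ n)"
      using False sum_red_log_coeff[OF g, of n] by (simp add: b_def cw_def)
    finally show ?thesis by (simp add: left_diff_distrib power_mult_distrib mult.assoc)
  qed
  have "\<forall>\<^sub>F u in at_left ?Q. \<forall>psi\<in>chars. norm (suminf (\<lambda>n. red_log_coeff psi n * of_real u ^ n)) \<le> B psi"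
    by (rule eventually_ball_finite[OF finite_characters]) (use B in blast)
  moreover have "\<forall>\<^sub>F u in at_left ?Q. u \<in> {0<..<?Q}"
    by (rule eventually_at_leftI[OF _ Q0])
  ultimately have bound: "\<forall>\<^sub>F u in at_left ?Q. (\<Sum>n<M. b n * (?q * u) ^ n) \<le> T" for M
  proof eventually_elim
    case (elim u)
    have u: "0 < u" "u < ?Q" using elim(2) by auto
    have cwle: "cw n * u ^ n \<le> cw n * ?Q ^ n" for n
      using u by (intro mult_left_mono power_mono) (auto simp: cw_def)
    have scw: "summable (\<lambda>n. cw n * u ^ n)"
      by (rule summable_comparison_test[OF _ sumcw]) (use u cwle in \<open>auto simp: cw_def\<close>)
    have scw': "summable (\<lambda>n. complex_of_real (cw n * u ^ n))"
      using scw by (rule summable_of_real)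
    have sv: "summable (\<lambda>n. psi (g ^ (ray_exponent - 1)) * (red_log_coeff psi n * of_real u ^ n))" if "psi \<in> chars" for psi
      using red_log_coeff_summable[OF that u] by (rule summable_mult)
    have sv': "summable (\<lambda>n. \<Sum>psi\<in>chars. psi (g ^ (ray_exponent - 1)) * (red_log_coeff psi n * of_real u ^ n))"
      using sv by (intro summable_sum)
    have sb': "summable (\<lambda>n. complex_of_real (b n * (?q * u) ^ n))"
      unfolding term_eq by (rule summable_diff[OF scw' sv'])
    then have sb: "summable (\<lambda>n. b n * (?q * u) ^ n)"
      using summable_Re[OF sb'] by simp
    have "complex_of_real (suminf (\<lambda>n. b n * (?q * u) ^ n)) = (suminf (\<lambda>n. complex_of_real (b n * (?q * u) ^ n)))"
      by (rule suminf_of_real[OF sb])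
    also have "\<dots> = (suminf (\<lambda>n. complex_of_real (cw n * u ^ n))) - (suminf (\<lambda>n. \<Sum>psi\<in>chars. psi (g ^ (ray_exponent - 1)) * (red_log_coeff psi n * of_real u ^ n)))"
      unfolding term_eq by (rule suminf_diff[OF scw' sv', symmetric])
    also have "(suminf (\<lambda>n. complex_of_real (cw n * u ^ n))) = complex_of_real (suminf (\<lambda>n. cw n * u ^ n))"
      by (rule suminf_of_real[OF scw, symmetric])
    also have "(suminf (\<lambda>n. \<Sum>psi\<in>chars. psi (g ^ (ray_exponent - 1)) * (red_log_coeff psi n * of_real u ^ n)))
        = (\<Sum>psi\<in>chars. (suminf (\<lambda>n. psi (g ^ (ray_exponent - 1)) * (red_log_coeff psi n * of_real u ^ n))))"
      by (rule suminf_sum[OF sv])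
    also have "\<dots> = (\<Sum>psi\<in>chars. psi (g ^ (ray_exponent - 1)) * (suminf (\<lambda>n. red_log_coeff psi n * of_real u ^ n)))"
      by (intro sum.cong refl suminf_mult[OF red_log_coeff_summable[OF _ u]])
    finally have eq: "complex_of_real (suminf (\<lambda>n. b n * (?q * u) ^ n))
        = of_real (suminf (\<lambda>n. cw n * u ^ n)) - (\<Sum>psi\<in>chars. psi (g ^ (ray_exponent - 1)) * (suminf (\<lambda>n. red_log_coeff psi n * of_real u ^ n)))" .
    have "norm (\<Sum>psi\<in>chars. psi (g ^ (ray_exponent - 1)) * (suminf (\<lambda>n. red_log_coeff psi n * of_real u ^ n))) \<le> (\<Sum>psi\<in>chars. B psi)"
    proof (rule sum_norm_le)
      fix psi assume psi: "psi \<in> chars"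
      have "norm (psi (g ^ (ray_exponent - 1))) * norm (suminf (\<lambda>n. red_log_coeff psi n * of_real u ^ n)) \<le> 1 * B psi"
        using elim(1) psi character_norm_le_1[OF psi] by (intro mult_mono) auto
      then show "norm (psi (g ^ (ray_exponent - 1)) * (suminf (\<lambda>n. red_log_coeff psi n * of_real u ^ n))) \<le> B psi"
        by (simp add: norm_mult)
    qed
    moreover have "(suminf (\<lambda>n. b n * (?q * u) ^ n)) = (suminf (\<lambda>n. cw n * u ^ n))
        - Re (\<Sum>psi\<in>chars. psi (g ^ (ray_exponent - 1)) * (suminf (\<lambda>n. red_log_coeff psi n * of_real u ^ n)))"
      using arg_cong[OF eq, of Re] by simp
    moreover have "(suminf (\<lambda>n. cw n * u ^ n)) \<le> C"
      unfolding C_def by (rule suminf_le[OF cwle scw sumcw])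
    moreover have "- Re (\<Sum>psi\<in>chars. psi (g ^ (ray_exponent - 1)) * (suminf (\<lambda>n. red_log_coeff psi n * of_real u ^ n)))
        \<le> norm (\<Sum>psi\<in>chars. psi (g ^ (ray_exponent - 1)) * (suminf (\<lambda>n. red_log_coeff psi n * of_real u ^ n)))"
      by (meson abs_Re_le_cmod abs_le_D2 order_trans)
    ultimately have "(suminf (\<lambda>n. b n * (?q * u) ^ n)) \<le> T"
      unfolding T_def by linarith
    moreover have "(\<Sum>n<M. b n * (?q * u) ^ n) \<le> (suminf (\<lambda>n. b n * (?q * u) ^ n))"
      by (rule sum_le_suminf[OF sb]) (use u in \<open>auto simp: b_def\<close>)
    ultimately show ?case by linarith
  qed
  have le: "(\<Sum>n<M. b n) \<le> T" for M
  proof (rule tendsto_upperbound)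
    have "((\<lambda>u. \<Sum>n<M. b n * (?q * u) ^ n) \<longlongrightarrow> (\<Sum>n<M. b n * (?q * ?Q) ^ n)) (at_left ?Q)"
      by (intro tendsto_intros)
    then show "((\<lambda>u. \<Sum>n<M. b n * (?q * u) ^ n) \<longlongrightarrow> (\<Sum>n<M. b n)) (at_left ?Q)" by simp
    show "\<forall>\<^sub>F u in at_left ?Q. (\<Sum>n<M. b n * (?q * u) ^ n) \<le> T" by (rule bound)
  qed simp
  (* The exponents in the progression; each of them contributes r to a partial sum. *)
  define m where "m k = r * (?d + k + 1) - ?d" for k
  have dle: "?d < r * (?d + k + 1)" for k
  proof -
    have "1 * (?d + k + 1) \<le> r * (?d + k + 1)" using r_pos by (intro mult_le_mono1) simp
    then show ?thesis by (rule less_le_trans[rotated]) simp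
  qed
  have bm: "b (m k) = real r" for k
    using dle[of k] by (simp add: b_def m_def)
  have "inj m"
  proof (rule injI)
    fix k k' assume "m k = m k'"
    then have "r * (?d + k + 1) = r * (?d + k' + 1)"
      using dle[of k] dle[of k'] unfolding m_def by (metis eq_diff_iff less_imp_le)
    then show "k = k'" using r_pos by simp
  qed
  obtain K :: nat where K: "T < real K" using reals_Archimedean2 by blast
  have "real K * 1 \<le> real K * real r" using r_pos by (intro mult_left_mono) auto
  then have "real K \<le> (\<Sum>k<K. real r)" by simp
  also have "\<dots> = (\<Sum>k<K. b (m k))" by (simp add: bm)
  also have "\<dots> = (\<Sum>n\<in>m ` {..<K}. b n)"
    using sum.reindex[OF inj_on_subset[OF \<open>inj m\<close> subset_UNIV], of b "{..<K}"] by (simp add: o_def)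
  also have "\<dots> \<le> (\<Sum>n<Suc (Max (m ` {..<K})). b n)"
    by (rule sum_mono2) (auto simp: b_def less_Suc_eq_le)
  also have "\<dots> \<le> T" by (rule le)
  finally show False using K by simp
qed

end

theorem ex_irreducible_in_progression:
  fixes h c :: "'a::{finite,field} poly"
  assumes "h \<noteq> 0" "coprime c h" "0 < r"
  shows "\<exists>P. lead_coeff P = 1 \<and> irreducible P \<and> h dvd P - c \<and> degree P mod r = s mod r"
proof -
  define h' where "h' = smult (inverse (lead_coeff h)) h"
  have h': "lead_coeff h' = 1" "h dvd h'" "h' dvd h" using assms(1) by (simp_all add: h'_def dvd_smult_iff smult_dvd_iff)
  interpret ray h' r by unfold_locales (use h' assms in auto)
  have "coprime c h'" using assms(2) h' unfolding coprime_def by (meson dvd_trans)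
  then obtain g where g: "g \<in> units" "ray_class g = (c mod h', s mod r)" by (rule ex_units)
  obtain P where P: "P \<in> units" "irreducible P" "ray_class P = ray_class g" using ex_irreducible_ray_class[OF g(1)] by blast
  then have "P mod h' = c mod h'" using g(2) by (simp add: ray_class_def)
  then have "h' dvd P - c" using mod_eq_dvd_iff by blast
  then have "h dvd P - c" using h'(2) by (rule dvd_trans[rotated])
  then show ?thesis using P g(2) by (auto simp: units_def ray_class_def)
qed

section \<open>Covering the special linear group\<close>

text \<open>Prescribing the degree modulo a large multiple of \<open>t\<close> also forces it to be large.\<close>

lemma ex_large_irreducible_in_progression:
  fixes h c :: "'a::{finite,field} poly"
  assumes "h \<noteq> 0" "coprime c h" "0 < t"
  obtains P y where "irreducible P" "P = c + y * h" "degree P mod t = 1 mod t" "B < degree P"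
proof -
  (* The residue s is 1 modulo t, less than the modulus r, and exceeds B. *)
  let ?r = "t * (B + 3)" and ?s = "1 + t * (B + 1)"
  obtain P where P: "irreducible P" "h dvd P - c" "degree P mod ?r = ?s mod ?r"
    using ex_irreducible_in_progression[OF assms(1,2), of ?r ?s] assms(3) by auto
  have "?s < ?r" using assms(3) by (simp add: algebra_simps)
  then have s: "degree P mod ?r = ?s" using P(3) by simp
  have "degree P mod t = (degree P mod ?r) mod t" by (simp add: mod_mod_cancel)
  also have "\<dots> = 1 mod t" unfolding s by (rule mod_mult_self2)
  finally have 1: "degree P mod t = 1 mod t" .
  have "B + 1 \<le> t * (B + 1)" using mult_le_mono1[of 1 t "B + 1"] assms(3) by simp
  then have 2: "B < degree P" using s mod_less_eq_dividend[of "degree P" ?r] by linarith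
  obtain y where "P - c = h * y" using P(2) by (elim dvdE)
  then have "P = c + y * h" by (simp add: algebra_simps)
  with P(1) 1 2 show ?thesis using that by blast
qed

lemma is_unit_2_poly:
  assumes "(2 :: 'a::field) \<noteq> 0"
  shows "is_unit (2 :: 'a poly)"
proof -
  have "(2 :: 'a poly) * [:inverse 2:] = 1"
    using assms by (simp add: numeral_poly one_pCons)
  then show ?thesis by (metis dvdI)
qed

text \<open>By Dirichlet's theorem \<open>b\<close> can be replaced by an irreducible polynomial of degree 1 modulo \<open>q - 1\<close> in its class
  modulo \<open>p\<close>. Then \<open>p\<close> is, modulo that polynomial, a constant times a \<open>(q - 1)\<close>-th power,
  hence a constant times a square because \<open>q\<close> is odd. The parameters are two transvections (6), three
  elementary matrices (3) and one application of \<open>swindle\<close> (5).\<close>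

lemma polycover_reflection_commutator:
  assumes two: "(2 :: 'a::{finite,field}) \<noteq> 0" and even: "even (CARD('a) - 1)"
  shows "polycover 14 {reflection_commutator p b z u |p b z (u :: 'a poly). p \<noteq> 0 \<and> p * u - b * z = 2}"
proof -
  let ?T = "{transvec x v w |x v w :: 'a poly. True}"
  let ?S = "{swindle s a b c d |s a b c d :: 'a poly. True}"
  let ?L = "range lower :: ('a poly ^ 2 ^ 2) set"
  let ?U = "range upper :: ('a poly ^ 2 ^ 2) set"
  let ?P = "\<lambda>S T :: ('a poly ^ 2 ^ 2) set. {A ** B |A B. A \<in> S \<and> B \<in> T}"
  have "polycover (3 + (3 + (((1 + 1) + 1) + 5))) (?P ?T (?P ?T (?P (?P (?P ?L ?U) ?L) ?S)))"
    by (intro polycover_mult polycover_transvec polycover_swindle polycover_upper polycover_lower)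
  then have "polycover 14 (?P ?T (?P ?T (?P (?P (?P ?L ?U) ?L) ?S)))" by simp
  then show ?thesis
  proof (rule polycover_subset, safe)
    fix p b z u :: "'a poly"
    assume p: "p \<noteq> 0" and rel: "p * u - b * z = 2"
    have unit2: "is_unit (2 :: 'a poly)" using two by (rule is_unit_2_poly)
    have "coprime b p"
    proof (rule coprimeI)
      fix d assume d: "d dvd b" "d dvd p"
      then have "d dvd p * u - b * z" by (simp add: dvd_diff)
      then show "is_unit d" using rel unit2 by (metis dvd_trans)
    qed
    moreover have "0 < CARD('a) - 1"
      using card_mono[of UNIV "{0, 1 :: 'a}"] by simp
    ultimately obtain b1 y where b1: "irreducible b1" "b1 = b + y * p"
      "degree b1 mod (CARD('a) - 1) = 1 mod (CARD('a) - 1)"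
      using ex_large_irreducible_in_progression[OF p] by metis
    (* Adding y times the first column of the matrix with rows (p, b), (z, u) to its second column. *)
    define u1 where "u1 = u + y * z"
    have rel1: "p * u1 - b1 * z = 2"
      using rel by (simp add: u1_def b1(2) algebra_simps)
    have ndvd: "\<not> b1 dvd p"
    proof
      assume "b1 dvd p"
      then have "b1 dvd p * u1 - b1 * z" by (simp add: dvd_diff)
      then have "is_unit b1" using rel1 unit2 by (metis dvd_trans)
      then show False using b1(1) by (simp add: irreducible_def)
    qed
    obtain k Y where k: "k \<noteq> 0" "[p = [:k:] * Y ^ (CARD('a) - 1)] (mod b1)"
      using cong_const_times_power[OF b1(1) ndvd] b1(3) by (auto simp: unique_euclidean_semiring_class.cong_def)
    (* Here oddness of q enters: a (q - 1)-th power is a square. *)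
    obtain j where j: "CARD('a) - 1 = 2 * j" using even by (elim evenE)
    define R where "R = Y ^ j"
    have "R ^ 2 = Y ^ (2 * j)" by (simp add: R_def power_mult[symmetric] mult.commute)
    then have "b1 dvd p - [:k:] * R ^ 2"
      using k(2) unfolding cong_iff_dvd_diff j[symmetric] by simp
    then obtain w where "p - [:k:] * R ^ 2 = b1 * w" by (elim dvdE)
    then have p2: "p + (- w) * b1 = [:k:] * R ^ 2" by (simp add: algebra_simps)
    define z2 where "z2 = z + (- w) * u1"
    have rel2: "[:k:] * R ^ 2 * u1 - b1 * z2 = 2"
      using rel1 unfolding p2[symmetric] z2_def by (simp add: algebra_simps)
    have kk: "[:k:] * [:inverse k:] = 1" using k(1) by (simp add: one_pCons)
    obtain x where x: "reflection_commutator ([:k:] * R ^ 2) b1 z2 u1 = lower x ** upper ([:k:] * b1) ** lower (z2 * [:inverse k:])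
        ** swindle R (- ([:k:] * R * u1)) (- ([:k:] * b1)) (- (z2 * u1)) (- ([:k:] * R * u1))"
      using reflection_commutator_square[OF rel2 kk] by blast
    have "reflection_commutator p b z u = transvec (- y) p z ** reflection_commutator p b1 z u1"
      unfolding b1(2) u1_def by (rule reflection_commutator_upper[OF rel])
    also have "reflection_commutator p b1 z u1 = transvec (- w) b1 u1 ** reflection_commutator ([:k:] * R ^ 2) b1 z2 u1"
      unfolding p2[symmetric] z2_def by (rule reflection_commutator_lower[OF rel1])
    finally show "\<exists>A B. reflection_commutator p b z u = A ** B \<and> A \<in> ?T \<and> B \<in> ?P ?T (?P (?P (?P ?L ?U) ?L) ?S)"
      unfolding x by blast
  qed
qed

text \<open>The matrices that the two special families reach: \<open>s\<^sup>2\<close> can be moved away, and the remaining row \<open>(x, e)\<close>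
  belongs to a reflection commutator. That \<open>s\<close> is not a unit excludes \<open>x = -1\<close>, \<open>e = 0\<close>.\<close>

definition reducible_rows :: "('a::{finite,field} poly ^ 2 ^ 2) set" where
  "reducible_rows = {mat2 x (s ^ 2 * e) w y |x s e w y.
     x * y - s ^ 2 * e * w = 1 \<and> s dvd x - 1 \<and> e dvd x ^ 2 - 1 \<and> s \<noteq> 0 \<and> \<not> is_unit s}"

text \<open>Once \<open>s\<^sup>2\<close> has been moved to the lower left entry, let \<open>d\<close> be the gcd of \<open>e\<close> and \<open>x - 1\<close>, and \<open>e = d p\<close>. As
  \<open>e\<close> divides \<open>(x - 1)(x + 1)\<close>, the cofactor \<open>p\<close> divides \<open>x + 1\<close>. Writing \<open>x = 1 + d z\<close> and \<open>x + 1 = p u\<close>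
  gives \<open>p u - d z = 2\<close>, so the reflection commutator with these entries has first row \<open>(x, e)\<close>, and one
  lower elementary matrix adjusts the second row.\<close>

lemma polycover_reducible_rows:
  assumes two: "(2 :: 'a::{finite,field}) \<noteq> 0" and even: "even (CARD('a) - 1)"
  shows "polycover 20 (reducible_rows :: ('a poly ^ 2 ^ 2) set)"
proof -
  let ?S = "{swindle s a b c d |s a b c d :: 'a poly. True}"
  let ?L = "range lower :: ('a poly ^ 2 ^ 2) set"
  let ?C = "{reflection_commutator p b z u |p b z (u :: 'a poly). p \<noteq> 0 \<and> p * u - b * z = 2}"
  let ?P = "\<lambda>S T :: ('a poly ^ 2 ^ 2) set. {A ** B |A B. A \<in> S \<and> B \<in> T}"
  have "polycover ((1 + 14) + 5) (?P (?P ?L ?C) ?S)"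
    by (intro polycover_mult polycover_swindle polycover_lower polycover_reflection_commutator assms)
  then have "polycover 20 (?P (?P ?L ?C) ?S)" by simp
  then show ?thesis
  proof (rule polycover_subset, unfold reducible_rows_def, safe)
    fix x s e w y :: "'a poly"
    assume det: "x * y - s ^ 2 * e * w = 1" and sx: "s dvd x - 1" and ex: "e dvd x ^ 2 - 1"
      and s: "s \<noteq> 0" "\<not> is_unit s"
    have "\<exists>p b z u. p \<noteq> 0 \<and> p * u - b * z = 2 \<and> x = 1 + b * z \<and> e = b * p"
    proof (cases "e = 0")
      case True
      then have "(x - 1) * (x + 1) = 0" using ex by (simp add: algebra_simps power2_eq_square)
      then have "x = 1 \<or> x + 1 = 0" by auto
      moreover have "x + 1 \<noteq> 0"
      proof
        assume "x + 1 = 0"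
        then have "x - 1 = - 2" by (simp add: algebra_simps eq_neg_iff_add_eq_0)
        then have "s dvd 2" using sx by (metis dvd_minus_iff)
        then show False using s(2) is_unit_2_poly[OF two] by (metis dvd_trans)
      qed
      ultimately show ?thesis using True two
        by (intro exI[of _ 2] exI[of _ 0] exI[of _ 0] exI[of _ 1]) (auto simp: numeral_poly)
    next
      case False
      obtain d i j where d: "d = i * e + j * (x - 1)" "d dvd e" "d dvd x - 1" using poly_bezout by metis
      obtain p where p: "e = d * p" using d(2) by (elim dvdE)
      obtain z where z: "x - 1 = d * z" using d(3) by (elim dvdE)
      have d0: "d \<noteq> 0" and p0: "p \<noteq> 0" using p False by auto
      have "d * 1 = d * (i * p + j * z)" using d(1) unfolding p z by (simp add: algebra_simps)
      then have ij: "i * p + j * z = 1" using d0 by (metis mult_left_cancel)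
      have "d * p dvd d * (z * (x + 1))"
      proof -
        have "x ^ 2 - 1 = (x - 1) * (x + 1)" by (simp add: algebra_simps power2_eq_square)
        then show ?thesis using ex unfolding p z by (simp add: mult.assoc)
      qed
      then have "p dvd z * (x + 1)" using d0 by simp
      then have "p dvd j * (z * (x + 1)) + p * (i * (x + 1))" by simp
      also have "j * (z * (x + 1)) + p * (i * (x + 1)) = (i * p + j * z) * (x + 1)"
        by (simp add: algebra_simps)
      finally obtain u where u: "x + 1 = p * u" unfolding ij by (auto elim: dvdE)
      have "p * u - d * z = (x + 1) - (x - 1)" unfolding u z ..
      then have "p * u - d * z = 2" by simp
      moreover have "x = 1 + d * z" using z by (simp add: algebra_simps)
      ultimately show ?thesis using p p0 by blast
    qed
    then obtain p b z u where p: "p \<noteq> 0" "p * u - b * z = 2" "x = 1 + b * z" "e = b * p" by blast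
    obtain a' where "x - 1 = s * a'" using sx by (elim dvdE)
    then have a': "x = 1 + s * a'" by (simp add: algebra_simps)
    have "y - 1 = y * (1 - x) + s * (s * e * w)"
      using det by (simp add: algebra_simps power2_eq_square)
    also have "\<dots> = s * (s * e * w - y * a')" unfolding a' by (simp add: algebra_simps)
    finally have y1: "y - 1 = s * (s * e * w - y * a')" .
    define d' where "d' = s * e * w - y * a'"
    have d': "y = 1 + s * d'"
      using y1 unfolding d'_def by (metis add.commute diff_add_cancel)
    have "s * (a' + d' + s * a' * d') = s * (s * e * w)"
      using det unfolding a' d' by (simp add: algebra_simps power2_eq_square)
    then have "a' + d' + s * a' * d' = s * e * w" using s(1) by simp
    from mat2_times_swindle[OF this a' d']
    have 1: "mat2 x (s ^ 2 * e) w y = mat2 x e (w * s ^ 2) y ** swindle s a' e w d'"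
      by (simp add: mult.commute)
    have "x * x - e * (z * u) = 1 + b * z * (2 + b * z - p * u)"
      unfolding p(3,4) by (simp add: algebra_simps)
    also have "2 + b * z - p * u = 0" using p(2) by (simp add: algebra_simps)
    finally have "mat2 x e (w * s ^ 2) y = lower (w * s ^ 2 * x - z * u * y) ** mat2 x e (z * u) x"
      using det by (intro mat2_same_first_row) (simp_all add: algebra_simps)
    also have "mat2 x e (z * u) x = reflection_commutator p b z u" by (simp add: reflection_commutator_def p(3,4))
    finally show "\<exists>A B. mat2 x (s ^ 2 * e) w y = A ** B \<and> A \<in> ?P ?L ?C \<and> B \<in> ?S"
      unfolding 1 using p(1,2) by blast
  qed
qed

lemma lower_reducible_rows: "lower x \<in> (reducible_rows :: ('a::{finite,field} poly ^ 2 ^ 2) set)"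
proof -
  (* With off-diagonal entry 0, any nonunit may serve as s; the indeterminate is one. *)
  have "\<not> is_unit ([:0, 1:] :: 'a poly)" by (simp add: is_unit_iff_degree)
  then show ?thesis unfolding reducible_rows_def
    by (intro CollectI exI[of _ 1] exI[of _ "[:0, 1:]"] exI[of _ 0] exI[of _ x]) auto
qed

definition mat2_power :: "'r::comm_ring_1 ^ 2 ^ 2 \<Rightarrow> nat \<Rightarrow> 'r ^ 2 ^ 2" where
  "mat2_power M n = ((**) M ^^ n) (mat 1)"

lemma mat2_power_Suc: "mat2_power M (Suc n) = M ** mat2_power M n"
  by (simp add: mat2_power_def)

text \<open>By the Cayley-Hamilton theorem every power of \<open>\<beta>\<close> is \<open>f + g \<beta>\<close> with scalars \<open>f\<close> and \<open>g\<close>. Modulo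
  \<open>b c\<close> the diagonal entries multiply as for a triangular matrix.\<close>

lemma mat2_power_form:
  fixes a b c d :: "'a::field poly"
  assumes det: "a * d - b * c = 1"
  shows "\<exists>f g. mat2_power (mat2 a b c d) n = mat2 (f + g * a) (g * b) (g * c) (f + g * d) \<and>
     (f + g * a) * (f + g * d) - g * b * (g * c) = 1 \<and>
     [f + g * a = a ^ n] (mod (b * c)) \<and> [f + g * d = d ^ n] (mod (b * c))"
proof (induction n)
  case 0
  show ?case by (intro exI[of _ 1] exI[of _ 0]) (simp add: mat2_power_def mat_1_mat2)
next
  case (Suc n)
  then obtain f g where fg: "mat2_power (mat2 a b c d) n = mat2 (f + g * a) (g * b) (g * c) (f + g * d)"
    "(f + g * a) * (f + g * d) - g * b * (g * c) = 1"
    "[f + g * a = a ^ n] (mod (b * c))" "[f + g * d = d ^ n] (mod (b * c))" by blast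
  define f' g' where "f' = - g" and "g' = f + g * (a + d)"
  have bc: "b * c = a * d - 1" using det by (simp add: algebra_simps)
  have x: "f' + g' * a = a * (f + g * a) + g * (b * c)"
    unfolding f'_def g'_def bc by (simp add: algebra_simps)
  have y: "f' + g' * d = d * (f + g * d) + g * (b * c)"
    unfolding f'_def g'_def bc by (simp add: algebra_simps)
  have eq: "mat2_power (mat2 a b c d) (Suc n) = mat2 (f' + g' * a) (g' * b) (g' * c) (f' + g' * d)"
    unfolding mat2_power_Suc fg(1) x y by (simp add: g'_def algebra_simps)
  have "det (mat2_power (mat2 a b c d) (Suc n)) = 1"
    unfolding mat2_power_Suc fg(1) det_mul det_mat2 using det fg(2) by simp
  then have "(f' + g' * a) * (f' + g' * d) - g' * b * (g' * c) = 1" unfolding eq by simp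
  moreover have "[f' + g' * a = a ^ Suc n] (mod (b * c))"
  proof -
    have "[a * (f + g * a) + g * (b * c) = a * a ^ n + 0] (mod (b * c))"
      by (intro cong_add cong_mult fg(3) cong_refl) (simp add: cong_iff_dvd_diff)
    then show ?thesis unfolding x by simp
  qed
  moreover have "[f' + g' * d = d ^ Suc n] (mod (b * c))"
  proof -
    have "[d * (f + g * d) + g * (b * c) = d * d ^ n + 0] (mod (b * c))"
      by (intro cong_add cong_mult fg(4) cong_refl) (simp add: cong_iff_dvd_diff)
    then show ?thesis unfolding y by simp
  qed
  ultimately show ?case using eq by blast
qed

text \<open>Modulo \<open>P\<close> both diagonal entries of the power are 1, so \<open>P\<close> divides their difference \<open>g (a - d)\<close>. It does
  not divide \<open>a - d\<close>, since \<open>a d = 1\<close> modulo \<open>P\<close> and \<open>a\<^sup>2 \<noteq> 1\<close>. That \<open>g\<close> divides \<open>x\<^sup>2 - 1\<close> is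
  the determinant equation modulo \<open>g\<close>.\<close>

lemma mat2_power_offdiagonal:
  fixes a b c d P :: "'a::field poly"
  assumes det: "a * d - b * c = 1" and P: "irreducible P" "P dvd b * c"
    and an: "[a ^ n = 1] (mod P)" and na: "\<not> P dvd a ^ 2 - 1"
  obtains x y g where "mat2_power (mat2 a b c d) n = mat2 x (g * b) (g * c) y"
    "x * y - g * b * (g * c) = 1" "P dvd x - 1" "P dvd y - 1" "P dvd g" "g dvd x ^ 2 - 1" "g dvd y ^ 2 - 1"
proof -
  obtain f g where fg: "mat2_power (mat2 a b c d) n = mat2 (f + g * a) (g * b) (g * c) (f + g * d)"
    "(f + g * a) * (f + g * d) - g * b * (g * c) = 1"
    "[f + g * a = a ^ n] (mod (b * c))" "[f + g * d = d ^ n] (mod (b * c))"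
    using mat2_power_form[OF det] by blast
  define x y where "x = f + g * a" and "y = f + g * d"
  have prime: "prime_elem P" using P(1) by (rule irreducible_poly_imp_prime_elem)
  have xP: "[x = a ^ n] (mod P)" "[y = d ^ n] (mod P)"
    using fg(3,4) P(2) by (auto simp: x_def y_def intro: cong_dvd_modulus)
  have "[a * d = 1] (mod P)"
    using det P(2) by (metis cong_iff_dvd_diff add_diff_cancel_left' diff_add_cancel)
  then have "[(a * d) ^ n = 1 ^ n] (mod P)" by (rule cong_pow)
  moreover have "[a ^ n * d ^ n = 1 * d ^ n] (mod P)" using an by (intro cong_mult) simp_all
  ultimately have dn: "[d ^ n = 1] (mod P)"
    by (metis cong_sym cong_trans mult_1 power_mult_distrib power_one)
  have x1: "P dvd x - 1" and y1: "P dvd y - 1"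
    using xP an dn cong_trans unfolding cong_iff_dvd_diff[symmetric] by blast+
  have "P dvd (x - 1) - (y - 1)" using x1 y1 by (rule dvd_diff)
  then have "P dvd g * (a - d)" by (simp add: x_def y_def algebra_simps)
  moreover have "\<not> P dvd a - d"
  proof
    assume "P dvd a - d"
    then have "P dvd a * (a - d) + b * c" using P(2) by simp
    moreover have "a * (a - d) + b * c = a ^ 2 - 1"
      using det by (simp add: algebra_simps power2_eq_square)
    ultimately show False using na by simp
  qed
  ultimately have Pg: "P dvd g" using prime_elem_dvd_mult_iff[OF prime] by blast
  have "x ^ 2 - 1 = g * (g * b * c - x * (d - a))"
    using fg(2) by (simp add: x_def algebra_simps power2_eq_square)
  then have gx: "g dvd x ^ 2 - 1" by simp
  have "y ^ 2 - 1 = g * (g * b * c - y * (a - d))"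
    using fg(2) by (simp add: y_def algebra_simps power2_eq_square)
  then have gy: "g dvd y ^ 2 - 1" by simp
  show ?thesis
    using that[of x g y] fg(1,2) x1 y1 Pg gx gy unfolding x_def y_def by blast
qed

text \<open>With \<open>N = 1 + q + \<dots> + q\<^sup>n\<^sup>-\<^sup>1\<close>, the number \<open>(q - 1)(N - 1)\<close> is \<open>q (q\<^sup>n\<^sup>-\<^sup>1 - 1)\<close>, and \<open>m\<close> divides \<open>n - 1\<close>.\<close>

lemma geometric_exponents:
  assumes q: "1 < q" and n: "n mod m = 1 mod m" "1 < n" "0 < (m :: nat)"
  obtains N i where "N = Suc (N - 1)" "(q - 1) * N = q ^ n - (1 :: nat)" "(q - 1) * (N - 1) = (q ^ m - 1) * i"
proof -
  define N where "N = (\<Sum>i<n. q ^ i)"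
  have "N \<ge> 1" using n(2) unfolding N_def by (subst sum.remove[of _ 0]) auto
  then have N: "N = Suc (N - 1)" by simp
  have qN: "(q - 1) * N = q ^ n - 1"
    using geometric_sum_nat[of q n] q by (simp add: N_def mult.commute)
  have "m dvd n - 1" using n(1,2) by (metis less_imp_le mod_eq_dvd_iff_nat)
  then obtain j where j: "n - 1 = m * j" by (elim dvdE)
  have "(q - 1) * (N - 1) = (q ^ n - 1) - (q - 1)"
    by (simp only: diff_mult_distrib2 qN mult_1_right)
  also have "\<dots> = q ^ n - q" using q by simp
  also have "\<dots> = q * (q ^ (n - 1) - 1)"
    using n(2) by (simp add: diff_mult_distrib2 power_eq_if[of q n])
  also have "q ^ (n - 1) - 1 = (\<Sum>i<j. (q ^ m) ^ i) * (q ^ m - 1)"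
    unfolding j power_mult by (rule geometric_sum_nat[symmetric]) (use q in simp)
  finally have "(q - 1) * (N - 1) = (q ^ m - 1) * (q * (\<Sum>i<j. (q ^ m) ^ i))"
    by (simp only: mult_ac)
  then show ?thesis using that[OF N qN] by blast
qed

text \<open>The parameters of the covering family are, from left to right: one lower elementary matrix, the transpose of a
  matrix in \<open>reducible_rows\<close>, a matrix in \<open>reducible_rows\<close>, four elementary matrices for a constant
  diagonal matrix, and one lower and one upper elementary matrix.\<close>

lemma polycover_SL2_poly:
  assumes two: "(2 :: 'a::{finite,field}) \<noteq> 0" and even: "even (CARD('a) - 1)"
  shows "polycover 47 (SL2 :: ('a poly ^ 2 ^ 2) set)"
proof -
  let ?q = "CARD('a)"
  let ?L = "range lower :: ('a poly ^ 2 ^ 2) set"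
  let ?U = "range upper :: ('a poly ^ 2 ^ 2) set"
  let ?R = "reducible_rows :: ('a poly ^ 2 ^ 2) set"
  let ?P = "\<lambda>S T :: ('a poly ^ 2 ^ 2) set. {A ** B |A B. A \<in> S \<and> B \<in> T}"
  (* Four elementary matrices suffice for diag(k, 1/k). *)
  let ?D = "?P (?P (?P ?U ?L) ?U) ?L"
  let ?G = "?P (?P (?P (?P ?L (?P {M. transpose M \<in> ?R} ?R)) ?D) ?L) ?U"
  have "polycover ((((1 + (20 + 20)) + (((1 + 1) + 1) + 1)) + 1) + 1) ?G"
    by (intro polycover_mult polycover_lower polycover_upper polycover_transpose
        polycover_reducible_rows[OF two even])
  then have "polycover 47 ?G" by simp
  moreover have "SL2 \<subseteq> ?G"
  proof
    have diag: "mat2 k 0 0 k' \<in> ?D" if kk: "k * k' = 1" for k k' :: "'a poly"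
    proof -
      have k'k: "k' * k = 1" using kk by (simp add: mult.commute)
      have "mat2 k 0 0 k' = ((upper (-1) ** lower (1 - k)) ** upper k') ** lower (k * (k - 1))"
        by (simp add: algebra_simps kk k'k mult.assoc[symmetric])
      then show ?thesis by blast
    qed
    have G_I: "lower t ** (A ** B) ** mat2 k 0 0 k' ** lower x ** upper y \<in> ?G"
      if A: "transpose A \<in> ?R" and B: "B \<in> ?R" and kk: "k * k' = 1" for t A B k k' x y
    proof -
      have "A ** B \<in> ?P {M. transpose M \<in> ?R} ?R" using A B by blast
      then have "lower t ** (A ** B) \<in> ?P ?L (?P {M. transpose M \<in> ?R} ?R)" by blast
      then have "lower t ** (A ** B) ** mat2 k 0 0 k' \<in> ?P (?P ?L (?P {M. transpose M \<in> ?R} ?R)) ?D"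
        using diag[OF kk] by blast
      then show ?thesis by blast
    qed
    fix M :: "'a poly ^ 2 ^ 2" assume M: "M \<in> SL2"
    obtain a b c d where abcd: "M = mat2 a b c d" by (cases M)
    have det: "a * d - b * c = 1" using M abcd by (simp add: SL2_def)
    have cancel: "M = N ** mat2 k 0 0 k' ** lower (- x) ** upper (- y)"
      if N: "N = M ** upper y ** lower x ** mat2 k' 0 0 k" and kk: "k * k' = 1" for N k k' x y
    proof -
      have "N ** mat2 k 0 0 k' ** lower (- x) ** upper (- y)
          = M ** (upper y ** (lower x ** (mat2 k' 0 0 k ** mat2 k 0 0 k') ** lower (- x)) ** upper (- y))"
        unfolding N by (simp only: matrix_mul_assoc)
      also have "upper y ** (lower x ** (mat2 k' 0 0 k ** mat2 k 0 0 k') ** lower (- x)) ** upper (- y) = mat 1"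
        using kk by (simp add: mat_1_mat2 mult.commute[of k'])
      finally show ?thesis by simp
    qed
    (* If a is constant, elementary matrices alone suffice. Otherwise a is not
       constant modulo b1 below, which keeps the corner entry z away from 1 and -1. *)
    show "M \<in> ?G"
    proof (cases "degree a = 0")
      case True
      have "\<exists>x y. a + x * (b + y * a) = 1"
      proof (cases "a = 0")
        case True
        then show ?thesis using det by (intro exI[of _ "- c"] exI[of _ 0]) (simp add: algebra_simps)
      next
        case False
        then have "is_unit a" using True is_unit_iff_degree by blast
        then obtain a' where "1 = a * a'" by (elim dvdE)
        then have "b + (1 - b) * a' * a = 1" by (simp add: algebra_simps)
        then show ?thesis by (intro exI[of _ "1 - a"] exI[of _ "(1 - b) * a'"]) simp
      qed
      then obtain x y where xy: "a + x * (b + y * a) = 1" by blast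
      define b1 d1 c1 where "b1 = b + y * a" and "d1 = d + y * c" and "c1 = c + x * d1"
      have N: "M ** upper y ** lower x ** mat2 1 0 0 1 = mat2 1 b1 c1 d1"
        using xy by (simp add: abcd b1_def d1_def c1_def algebra_simps)
      have "(a + x * b1) * d1 - b1 * c1 = 1"
        using det by (simp add: b1_def d1_def c1_def algebra_simps)
      then have "1 * d1 - b1 * c1 = 1" using xy by (simp add: b1_def)
      then have "mat2 1 b1 c1 d1 = lower c1 ** upper b1"
        by (simp add: algebra_simps)
      also have "\<dots> = lower c1 ** (upper b1 ** lower 0)" by simp
      finally have Meq: "M = lower c1 ** (upper b1 ** lower 0) ** mat2 1 0 0 1 ** lower (- x) ** upper (- y)"
        using cancel[OF N[symmetric]] by simp
      have "transpose (upper b1) \<in> ?R" using lower_reducible_rows[of b1] by simp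
      then show ?thesis unfolding Meq by (rule G_I[OF _ lower_reducible_rows]) simp
    next
      case False
      then have a0: "a \<noteq> 0" by auto
      have q1: "1 < ?q" using card_mono[of UNIV "{0, 1 :: 'a}"] by simp
      have "coprime b a"
      proof (rule coprimeI)
        fix f assume "f dvd b" "f dvd a"
        then have "f dvd a * d - b * c" by (simp add: dvd_diff)
        then show "is_unit f" using det by simp
      qed
      then obtain b1 y where b1: "irreducible b1" "b1 = b + y * a"
        "degree b1 mod (?q - 1) = 1 mod (?q - 1)" "degree a < degree b1"
        using ex_large_irreducible_in_progression[OF a0, of b "?q - 1"] q1 by (metis zero_less_diff)
      define m where "m = degree b1"
      have m0: "0 < m" using irreducible_poly_degree[OF b1(1)] by (simp add: m_def)
      have b1a: "\<not> b1 dvd a" using dvd_imp_degree_le[of b1 a] a0 b1(4) by auto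
      obtain k Y where k: "k \<noteq> 0" and kY: "[a = [:k:] * Y ^ (?q - 1)] (mod b1)"
        using cong_const_times_power[OF b1(1) b1a] b1(3) by (auto simp: unique_euclidean_semiring_class.cong_def)
      (* The corner entry becomes K z with z a (q - 1)-th power; diag(1/K, K) removes the constant K. *)
      define z K K' where "z = Y ^ (?q - 1)" and "K = [:k:]" and "K' = [:inverse k:]"
      have KK: "K * K' = 1" using k by (simp add: K_def K'_def one_pCons)
      have K'K: "K' * K = 1" using KK by (simp add: mult.commute)
      have azb: "b1 dvd a - K * z" using kY by (simp add: cong_iff_dvd_diff z_def K_def)
      then obtain x' where "a - K * z = b1 * x'" by (elim dvdE)
      then have x: "a + (- x') * b1 = K * z" by (simp add: algebra_simps)
      define x where "x = - x'"
      define d1 c1 where "d1 = d + y * c" and "c1 = c + x * d1"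
      have N: "M ** upper y ** lower x ** mat2 K' 0 0 K = mat2 z (K * b1) (K' * c1) (K * d1)"
      proof -
        have "M ** upper y ** lower x = mat2 (K * z) b1 c1 d1"
          using x by (simp add: abcd b1(2) d1_def c1_def x_def algebra_simps)
        then show ?thesis using KK by (simp add: mult_ac)
      qed
      have "(a + x * b1) * d1 - b1 * c1 = 1"
        using det by (simp add: b1(2) d1_def c1_def algebra_simps)
      then have det1: "K * z * d1 - b1 * c1 = 1" using x by (simp add: x_def)
      have z0: "z \<noteq> 0" using azb b1a by auto
      have "z * (K * d1) - (K * b1) * (K' * c1) = K * z * d1 - (K * K') * (b1 * c1)"
        by (simp add: mult_ac)
      then have det2: "z * (K * d1) - (K * b1) * (K' * c1) = 1" using det1 KK by simp
      have "coprime (K' * c1) z"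
      proof (rule coprimeI)
        fix f assume "f dvd K' * c1" "f dvd z"
        then have "f dvd z * (K * d1) - (K * b1) * (K' * c1)" by (simp only: dvd_diff dvd_mult dvd_mult2)
        then show "is_unit f" unfolding det2 .
      qed
      then obtain c2 t where c2: "irreducible c2" "c2 = K' * c1 + t * z" "degree c2 mod m = 1 mod m"
        "max 1 (degree z) < degree c2"
        using ex_large_irreducible_in_progression[OF z0 _ m0] by metis
      define d2 where "d2 = K * d1 + t * (K * b1)"
      (* Now both off-diagonal entries are irreducible up to a constant, and z is the corner entry. *)
      define beta where "beta = mat2 z (K * b1) c2 d2"
      have beta: "mat2 z (K * b1) (K' * c1) (K * d1) = lower (- t) ** beta"
        by (simp add: beta_def c2(2) d2_def algebra_simps)
      have det3: "z * d2 - (K * b1) * c2 = 1"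
        using det2 by (simp add: c2(2) d2_def algebra_simps)
      (* The two exponents N and N - 1 are consecutive, so the powers of beta differ by one factor beta. *)
      obtain N i where Ni: "N = Suc (N - 1)" "(?q - 1) * N = ?q ^ degree c2 - 1"
        "(?q - 1) * (N - 1) = (?q ^ m - 1) * i"
        using geometric_exponents[OF q1 c2(3) _ m0] c2(4) by auto
      have b1Y: "\<not> b1 dvd Y"
      proof
        assume "b1 dvd Y"
        then have "b1 dvd z" unfolding z_def using q1 by (metis dvd_power dvd_trans zero_less_diff)
        then have "b1 dvd K * z" by (rule dvd_mult)
        then have "b1 dvd (a - K * z) + K * z" using azb by (rule dvd_add[rotated])
        then show False using b1a by simp
      qed
      have c2Y: "\<not> c2 dvd Y"
      proof
        assume "c2 dvd Y"
        then have "c2 dvd z" unfolding z_def using q1 by (metis dvd_power dvd_trans zero_less_diff)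
        then have "c2 dvd z * d2 - (K * b1) * c2" by (simp add: dvd_diff)
        then show False using c2(1) unfolding det3 by (simp add: irreducible_def)
      qed
      have zN: "[z ^ N = 1] (mod c2)"
        using poly_fermat[OF c2(1) c2Y] unfolding z_def power_mult[symmetric] Ni(2) .
      have "[(Y ^ (?q ^ m - 1)) ^ i = 1 ^ i] (mod b1)"
        using poly_fermat[OF b1(1) b1Y] unfolding m_def by (rule cong_pow)
      then have zN1: "[z ^ (N - 1) = 1] (mod b1)"
        unfolding z_def power_mult[symmetric] Ni(3) by simp
      (* A congruence of z to a constant modulo b1 would make a congruent to a constant, but a has
         positive degree less than that of b1. *)
      have b1z: "\<not> b1 dvd z - u" if u: "u = [:u0:]" for u u0
      proof
        assume "b1 dvd z - u"
        then have "b1 dvd (a - K * z) + K * (z - u)" using azb by (intro dvd_add dvd_mult)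
        also have "(a - K * z) + K * (z - u) = a - [:k * u0:]" by (simp add: algebra_simps K_def u)
        finally have dv: "b1 dvd a - [:k * u0:]" .
        have "degree (a - [:k * u0:]) \<le> degree a" by (rule degree_diff_le) auto
        then have "a - [:k * u0:] = 0" using dvd_imp_degree_le[OF dv] b1(4) by linarith
        then have "degree a = 0" by simp
        then show False using False by simp
      qed
      have c2z: "\<not> c2 dvd z - u" if u: "u = [:u0:]" for u u0
      proof
        assume dv: "c2 dvd z - u"
        have "degree (z - u) \<le> degree z" unfolding u by (rule degree_diff_le) auto
        then have "z - u = 0" using dvd_imp_degree_le[OF dv] c2(4) by linarith
        then show False using b1z[OF u] by simp
      qed
      have sq: "z ^ 2 - 1 = (z - [:1:]) * (z - [:-1:])"
        by (simp add: algebra_simps power2_eq_square one_pCons[symmetric])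
      have b1sq: "\<not> b1 dvd z ^ 2 - 1"
        unfolding sq using prime_elem_dvd_mult_iff[OF irreducible_poly_imp_prime_elem[OF b1(1)]]
          b1z[OF refl, of 1] b1z[OF refl, of "-1"] by blast
      have c2sq: "\<not> c2 dvd z ^ 2 - 1"
        unfolding sq using prime_elem_dvd_mult_iff[OF irreducible_poly_imp_prime_elem[OF c2(1)]]
          c2z[OF refl, of 1] c2z[OF refl, of "-1"] by blast
      have "c2 dvd (K * b1) * c2" "b1 dvd (K * b1) * c2" by (simp_all add: mult.assoc mult.left_commute[of K])
      note dvds = this
      obtain x1 y1 g where A: "mat2_power beta N = mat2 x1 (g * (K * b1)) (g * c2) y1"
        "x1 * y1 - g * (K * b1) * (g * c2) = 1" "c2 dvd x1 - 1" "c2 dvd g" "g dvd x1 ^ 2 - 1"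
        using mat2_power_offdiagonal[OF det3 c2(1) dvds(1) zN c2sq] unfolding beta_def by metis
      obtain x2 y2 g' where B: "mat2_power beta (N - 1) = mat2 x2 (g' * (K * b1)) (g' * c2) y2"
        "x2 * y2 - g' * (K * b1) * (g' * c2) = 1" "b1 dvd y2 - 1" "b1 dvd g'" "g' dvd y2 ^ 2 - 1"
        using mat2_power_offdiagonal[OF det3 b1(1) dvds(2) zN1 b1sq] unfolding beta_def by metis
      let ?A = "mat2_power beta N" and ?B = "mat2 y2 (- (g' * (K * b1))) (- (g' * c2)) x2"
      have "mat2_power beta (N - 1) ** ?B = mat 1"
        unfolding B(1) mat_1_mat2 mat2_mult using B(2) by (simp add: algebra_simps)
      moreover have "?A = beta ** mat2_power beta (N - 1)"
        using mat2_power_Suc[of beta "N - 1"] Ni(1) by metis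
      ultimately have AB: "beta = ?A ** ?B" by (simp add: matrix_mul_assoc[symmetric])
      have R1: "transpose ?A \<in> ?R"
      proof -
        obtain e where e: "g = c2 * e" using A(4) by (elim dvdE)
        have "transpose ?A = mat2 x1 (c2 ^ 2 * e) (g * (K * b1)) y1"
          by (simp add: A(1) e power2_eq_square mult_ac)
        moreover have "x1 * y1 - c2 ^ 2 * e * (g * (K * b1)) = 1"
          using A(2) by (simp add: e power2_eq_square mult_ac)
        moreover have "e dvd x1 ^ 2 - 1" using A(5) unfolding e by (rule dvd_mult_right)
        moreover have "c2 \<noteq> 0" "\<not> is_unit c2" using c2(1) by (auto simp: irreducible_def)
        ultimately show ?thesis unfolding reducible_rows_def using A(3) by blast
      qed
      have R2: "?B \<in> ?R"
      proof -
        obtain e where e: "g' = b1 * e" using B(4) by (elim dvdE)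
        have "?B = mat2 y2 (b1 ^ 2 * (- (K * e))) (- (g' * c2)) x2"
          by (simp add: e power2_eq_square mult_ac)
        moreover have "y2 * x2 - b1 ^ 2 * (- (K * e)) * (- (g' * c2)) = 1"
          using B(2) by (simp add: e power2_eq_square mult_ac)
        moreover have "- (K * e) dvd y2 ^ 2 - 1"
        proof -
          have "e dvd y2 ^ 2 - 1" using B(5) unfolding e by (rule dvd_mult_right)
          then obtain f where f: "y2 ^ 2 - 1 = e * f" by (elim dvdE)
          have "y2 ^ 2 - 1 = (K * K') * (e * f)" using f KK by simp
          also have "\<dots> = - (K * e) * (- (K' * f))" by (simp add: mult_ac)
          finally show ?thesis by (rule dvdI)
        qed
        moreover have "b1 \<noteq> 0" "\<not> is_unit b1" using b1(1) by (auto simp: irreducible_def)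
        ultimately show ?thesis unfolding reducible_rows_def using B(3) by blast
      qed
      have Meq: "M = lower (- t) ** (?A ** ?B) ** mat2 K 0 0 K' ** lower (- x) ** upper (- y)"
        using cancel[OF N[symmetric] KK] unfolding beta AB[symmetric] .
      show ?thesis unfolding Meq by (rule G_I[OF R1 R2 KK])
    qed
  qed
  ultimately show ?thesis by (rule polycover_subset)
qed

lemma of_nat_CARD_eq_0: "of_nat CARD('a::{finite,ring_1}) = (0 :: 'a)"
proof -
  (* Translation by 1 permutes the ring, so it does not change the sum of all elements. *)
  have "(\<Sum>x\<in>UNIV. x :: 'a) = (\<Sum>x\<in>UNIV. x + 1)"
    by (rule sum.reindex_bij_witness[of _ "\<lambda>x. x + 1" "\<lambda>x. x - 1"]) auto
  then show ?thesis by (simp add: sum.distrib)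
qed

text \<open>An odd number of elements gives both facts on which the construction rests: 2 is invertible in the
  field, and \<open>q - 1\<close> is even.\<close>

theorem theorem1p5:
  fixes p q k :: nat
  assumes "prime p" and "odd p" and "0 < k" and "q = p ^ k"
    and "CARD('a::{finite, field}) = q"
  shows "polynomial_family 4 52 (matrix_entries ` (SL2 :: ('a poly ^ 2 ^ 2) set))"
proof (rule polycover_SL2_imp_polynomial_family)
  have odd: "odd (CARD('a))" using assms by simp
  then obtain m where m: "CARD('a) = 2 * m + 1" by (elim oddE)
  have "(2 :: 'a) \<noteq> 0"
  proof
    assume "(2 :: 'a) = 0"
    have "of_nat CARD('a) = (2 :: 'a) * of_nat m + 1" by (simp add: m)
    also have "\<dots> = 1" unfolding \<open>2 = 0\<close> by simp
    finally show False by (simp add: of_nat_CARD_eq_0)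
  qed
  then have "polycover 47 (SL2 :: ('a poly ^ 2 ^ 2) set)"
    by (rule polycover_SL2_poly) (use odd in simp)
  then show "polycover 52 (SL2 :: ('a poly ^ 2 ^ 2) set)" by (rule polycover_mono) simp
qed simp

end
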